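(* Let $\mathbf{k}$ be a unitary commutative ring, $\lambda\in\mathbf{k}$, and let $(A,d)$ be a commutative differential $\mathbf{k}$-algebra of weight $\lambda$. Let $(\mathrm{Sh}(A),d_A,P_A)$ be the differential Rota-Baxter algebra of weight $\lambda$ described in the context, and let $J=P_A\circ d_A$ and $E=\mathrm{id}_{\mathrm{Sh}(A)}-P_A\circ d_A$. Let $I$ be the differential Rota-Baxter ideal of $\mathrm{Sh}(A)$ generated by the set $$\{J(E(x)J(y))-E(x)J(y)\mid x,y\in\mathrm{Sh}(A)\}.$$ Let $\delta_A$ and $\Pi_A$ denote the operators induced by $d_A$ and $P_A$ on $\mathrm{Sh}(A)/I$. Then the quotient differential Rota-Baxter algebra $(\mathrm{Sh}(A)/I,\delta_A,\Pi_A)$, together with the natural map $i_A\colon A\to\mathrm{Sh}(A)\to\mathrm{Sh}(A)/I$, is the free commutative integro-differential algebra of weight $\lambda$ on $(A,d)$. That is, it is a commutative integro-differential algebra of weight $\lambda$, $i_A$ is a homomorphism of differential algebras, and for every commutative integro-differential $\mathbf{k}$-algebra $(R,D,\Pi)$ of weight $\lambda$ and every homomorphism of differential algebras $f\colon(A,d)\to(R,D)$ there is a unique homomorphism of integro-differential algebras $\bar f\colon\mathrm{Sh}(A)/I\to R$ with $\bar f\circ i_A=f$.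
   Context: Tensor products are over $\mathbf{k}$; algebras are unitary and associative. Homomorphisms of differential (resp. integro-differential) algebras are unital $\mathbf{k}$-algebra homomorphisms commuting with the derivations (resp. with both operators). A differential $\mathbf{k}$-algebra of weight $\lambda$ is a unitary $\mathbf{k}$-algebra $R$ with a $\mathbf{k}$-linear $d\colon R\to R$ such that $d(xy)=d(x)y+xd(y)+\lambda d(x)d(y)$ for all $x,y$ and $d(1)=0$. A differential Rota-Baxter algebra of weight $\lambda$ is a differential algebra $(R,d)$ of weight $\lambda$ with a $\mathbf{k}$-linear $P\colon R\to R$ such that $P(x)P(y)=P(xP(y))+P(P(x)y)+\lambda P(xy)$ for all $x,y$ and $d\circ P=\mathrm{id}_R$. An integro-differential algebra of weight $\lambda$ is a differential algebra $(R,D)$ of weight $\lambda$ with a $\mathbf{k}$-linear $\Pi\colon R\to R$ such that $D\circ\Pi=\mathrm{id}_R$ and $\Pi(D(x))\Pi(D(y))=\Pi(D(x))y+x\Pi(D(y))-\Pi(D(xy))$ for all $x,y\in R$. A differential Rota-Baxter ideal is an ideal closed under both operators; the one generated by a set is the smallest such ideal containing the set. $\mathrm{Sh}(A)=\bigoplus_{k\ge0}A^{\otimes(k+1)}$, with bilinear product $\diamond$ (written as juxtaposition) defined as follows for $\mathfrak a=a_0\otimes\cdots\otimes a_m$, $\mathfrak b=b_0\otimes\cdots\otimes b_n$: if $m=0$, $\mathfrak a\diamond\mathfrak b=a_0b_0\otimes b_1\otimes\cdots\otimes b_n$; if $n=0$, $\mathfrak a\diamond\mathfrak b=a_0b_0\otimes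 a_1\otimes\cdots\otimes a_m$; if $m,n>0$, recursively $$\mathfrak a\diamond\mathfrak b=a_0b_0\otimes\Big((a_1\otimes\cdots\otimes a_m)\diamond(1\otimes b_1\otimes\cdots\otimes b_n)+(1\otimes a_1\otimes\cdots\otimes a_m)\diamond(b_1\otimes\cdots\otimes b_n)+\lambda(a_1\otimes\cdots\otimes a_m)\diamond(b_1\otimes\cdots\otimes b_n)\Big).$$ The operators are $P_A(a_0\otimes\cdots\otimes a_n)=1\otimes a_0\otimes\cdots\otimes a_n$, and $d_A(a_0)=d(a_0)$ and, for $n\ge1$, $d_A(a_0\otimes\cdots\otimes a_n)=d(a_0)\otimes a_1\otimes\cdots\otimes a_n+a_0a_1\otimes a_2\otimes\cdots\otimes a_n+\lambda d(a_0)a_1\otimes a_2\otimes\cdots\otimes a_n$. It is known that $(\mathrm{Sh}(A),d_A,P_A)$, with the inclusion $A\to\mathrm{Sh}(A)$ as first summand, is the free commutative differential Rota-Baxter algebra of weight $\lambda$ on $(A,d)$. *)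

theory Defs
  imports "HOL-Algebra.Module" "HOL-Algebra.QuotRing"
begin

section \<open>Modules, quotients, direct sums and tensor powers\<close>

definition linear_map ::
  "('k, 'x) ring_scheme \<Rightarrow> ('k, 'm, 'y) module_scheme \<Rightarrow> ('k, 'n, 'z) module_scheme
     \<Rightarrow> ('m \<Rightarrow> 'n) \<Rightarrow> bool"
  where "linear_map k M N f \<longleftrightarrow>
    f \<in> carrier M \<rightarrow> carrier N \<and>
    (\<forall>x\<in>carrier M. \<forall>y\<in>carrier M. f (x \<oplus>\<^bsub>M\<^esub> y) = f x \<oplus>\<^bsub>N\<^esub> f y) \<and>
    (\<forall>c\<in>carrier k. \<forall>x\<in>carrier M. f (c \<odot>\<^bsub>M\<^esub> x) = c \<odot>\<^bsub>N\<^esub> f x)"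

text \<open>The operation induced by \<open>f\<close> on the cosets of \<open>I\<close>, in the style of
  \<^const>\<open>rcoset_mult\<close>.\<close>

definition coset_map :: "('a, 'm) ring_scheme \<Rightarrow> 'a set \<Rightarrow> ('a \<Rightarrow> 'a) \<Rightarrow> 'a set \<Rightarrow> 'a set"
  where "coset_map R I f X = (\<Union>x\<in>X. I +>\<^bsub>R\<^esub> f x)"

text \<open>\<^const>\<open>FactRing\<close> with the induced scalar multiplication. It serves for quotients of algebras
  by ideals and for quotients of modules by submodules; in the latter case, as for any
  \<^typ>\<open>('k, 'm) module\<close> record that only stands for a module, the fields \<^const>\<open>mult\<close>
  and \<^const>\<open>one\<close> carry no meaning.\<close>

definition quotient :: "('k, 'a, 'm) module_scheme \<Rightarrow> 'a set \<Rightarrow> ('k, 'a set) module"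
  where "quotient M I =
    \<lparr>carrier = carrier (M Quot I), mult = mult (M Quot I), one = one (M Quot I),
     zero = zero (M Quot I), add = add (M Quot I),
     smult = (\<lambda>c. coset_map M I (\<lambda>x. c \<odot>\<^bsub>M\<^esub> x))\<rparr>"

definition gen_submodule :: "('k, 'x) ring_scheme \<Rightarrow> ('k, 'm, 'y) module_scheme \<Rightarrow> 'm set \<Rightarrow> 'm set"
  where "gen_submodule k M S = \<Inter>{N. submodule N k M \<and> S \<subseteq> N}"

definition free_module :: "('k, 'x) ring_scheme \<Rightarrow> 'w set \<Rightarrow> ('k, 'w \<Rightarrow> 'k) module"
  where "free_module k X =
    \<lparr>carrier = {f. f \<in> X \<rightarrow> carrier k \<and> (\<forall>w. w \<notin> X \<longrightarrow> f w = \<zero>\<^bsub>k\<^esub>) \<and> finite {w. f w \<noteq> \<zero>\<^bsub>k\<^esub>}},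
     mult = undefined, one = undefined,
     zero = (\<lambda>w. \<zero>\<^bsub>k\<^esub>), add = (\<lambda>f g w. f w \<oplus>\<^bsub>k\<^esub> g w),
     smult = (\<lambda>c f w. c \<otimes>\<^bsub>k\<^esub> f w)\<rparr>"

definition basis_vec :: "('k, 'x) ring_scheme \<Rightarrow> 'w \<Rightarrow> 'w \<Rightarrow> 'k"
  where "basis_vec k w = (\<lambda>v. if v = w then \<one>\<^bsub>k\<^esub> else \<zero>\<^bsub>k\<^esub>)"

definition direct_sum :: "('i \<Rightarrow> ('k, 'm) module) \<Rightarrow> ('k, 'i \<Rightarrow> 'm) module"
  where "direct_sum M =
    \<lparr>carrier = {s. (\<forall>i. s i \<in> carrier (M i)) \<and> finite {i. s i \<noteq> \<zero>\<^bsub>M i\<^esub>}},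
     mult = undefined, one = undefined,
     zero = (\<lambda>i. \<zero>\<^bsub>M i\<^esub>), add = (\<lambda>s t i. s i \<oplus>\<^bsub>M i\<^esub> t i),
     smult = (\<lambda>c s i. c \<odot>\<^bsub>M i\<^esub> s i)\<rparr>"

definition words :: "('a, 'm) ring_scheme \<Rightarrow> nat \<Rightarrow> 'a list set"
  where "words A n = {w \<in> lists (carrier A). length w = n}"

text \<open>The \<open>n\<close>-th tensor power over \<open>k\<close>: formal combinations of words of length \<open>n\<close>, modulo the
  relations of additivity and homogeneity in each letter.\<close>

definition tensor_relations ::
  "('k, 'x) ring_scheme \<Rightarrow> ('k, 'a, 'y) module_scheme \<Rightarrow> nat \<Rightarrow> ('a list \<Rightarrow> 'k) set"
  where "tensor_relations k A n = (let F = free_module k (words A n); e = basis_vec k in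
    gen_submodule k F
     ({e (u @ (a \<oplus>\<^bsub>A\<^esub> b) # v) \<ominus>\<^bsub>F\<^esub> (e (u @ a # v) \<oplus>\<^bsub>F\<^esub> e (u @ b # v)) | u v a b.
         u @ a # v \<in> words A n \<and> b \<in> carrier A}
      \<union> {e (u @ (c \<odot>\<^bsub>A\<^esub> a) # v) \<ominus>\<^bsub>F\<^esub> c \<odot>\<^bsub>F\<^esub> e (u @ a # v) | u v a c.
         u @ a # v \<in> words A n \<and> c \<in> carrier k}))"

definition tensor_power ::
  "('k, 'x) ring_scheme \<Rightarrow> ('k, 'a, 'y) module_scheme \<Rightarrow> nat \<Rightarrow> ('k, ('a list \<Rightarrow> 'k) set) module"
  where "tensor_power k A n = quotient (free_module k (words A n)) (tensor_relations k A n)"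


section \<open>Differential and integro-differential algebras\<close>

locale comm_differential_algebra = algebra k R
  for k :: "('k, 'x) ring_scheme" (structure) and R :: "('k, 'r, 'y) module_scheme" (structure) +
  fixes lam :: 'k and d :: "'r \<Rightarrow> 'r"
  assumes weight_closed: "lam \<in> carrier k"
    and d_linear: "linear_map k R R d"
    and d_mult: "\<lbrakk>x \<in> carrier R; y \<in> carrier R\<rbrakk> \<Longrightarrow>
      d (x \<otimes>\<^bsub>R\<^esub> y) = d x \<otimes>\<^bsub>R\<^esub> y \<oplus>\<^bsub>R\<^esub> x \<otimes>\<^bsub>R\<^esub> d y \<oplus>\<^bsub>R\<^esub> lam \<odot>\<^bsub>R\<^esub> (d x \<otimes>\<^bsub>R\<^esub> d y)"
    and d_one: "d \<one>\<^bsub>R\<^esub> = \<zero>\<^bsub>R\<^esub>"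

locale comm_integro_differential_algebra = comm_differential_algebra k R lam D
  for k :: "('k, 'x) ring_scheme" (structure) and R :: "('k, 'r, 'y) module_scheme" (structure)
    and lam :: 'k and D :: "'r \<Rightarrow> 'r" +
  fixes P :: "'r \<Rightarrow> 'r"
  assumes P_linear: "linear_map k R R P"
    and D_P: "x \<in> carrier R \<Longrightarrow> D (P x) = x"
    and hybrid: "\<lbrakk>x \<in> carrier R; y \<in> carrier R\<rbrakk> \<Longrightarrow>
      P (D x) \<otimes>\<^bsub>R\<^esub> P (D y) =
        P (D x) \<otimes>\<^bsub>R\<^esub> y \<oplus>\<^bsub>R\<^esub> x \<otimes>\<^bsub>R\<^esub> P (D y) \<ominus>\<^bsub>R\<^esub> P (D (x \<otimes>\<^bsub>R\<^esub> y))"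

definition differential_hom ::
  "('k, 'x) ring_scheme \<Rightarrow> ('k, 'a, 'y) module_scheme \<Rightarrow> ('a \<Rightarrow> 'a)
     \<Rightarrow> ('k, 'b, 'z) module_scheme \<Rightarrow> ('b \<Rightarrow> 'b) \<Rightarrow> ('a \<Rightarrow> 'b) set"
  where "differential_hom k A d B D =
    {f \<in> ring_hom A B. linear_map k A B f \<and> (\<forall>x\<in>carrier A. f (d x) = D (f x))}"

definition integro_differential_hom ::
  "('k, 'x) ring_scheme \<Rightarrow> ('k, 'a, 'y) module_scheme \<Rightarrow> ('a \<Rightarrow> 'a) \<Rightarrow> ('a \<Rightarrow> 'a)
     \<Rightarrow> ('k, 'b, 'z) module_scheme \<Rightarrow> ('b \<Rightarrow> 'b) \<Rightarrow> ('b \<Rightarrow> 'b) \<Rightarrow> ('a \<Rightarrow> 'b) set"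
  where "integro_differential_hom k A d P B D Q =
    {f \<in> differential_hom k A d B D. \<forall>x\<in>carrier A. f (P x) = Q (f x)}"

definition diff_RB_ideal ::
  "('a, 'x) ring_scheme \<Rightarrow> ('a \<Rightarrow> 'a) \<Rightarrow> ('a \<Rightarrow> 'a) \<Rightarrow> 'a set \<Rightarrow> bool"
  where "diff_RB_ideal R d P I \<longleftrightarrow> ideal I R \<and> d ` I \<subseteq> I \<and> P ` I \<subseteq> I"

definition gen_diff_RB_ideal ::
  "('a, 'x) ring_scheme \<Rightarrow> ('a \<Rightarrow> 'a) \<Rightarrow> ('a \<Rightarrow> 'a) \<Rightarrow> 'a set \<Rightarrow> 'a set"
  where "gen_diff_RB_ideal R d P S = \<Inter>{I. diff_RB_ideal R d P I \<and> S \<subseteq> I}"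


section \<open>The differential Rota-Baxter algebra on the shuffle module\<close>

type_synonym ('k, 'a) sh = "nat \<Rightarrow> ('a list \<Rightarrow> 'k) set"

definition Sh_module ::
  "('k, 'x) ring_scheme \<Rightarrow> ('k, 'a, 'y) module_scheme \<Rightarrow> ('k, ('k, 'a) sh) module"
  where "Sh_module k A = direct_sum (\<lambda>n. tensor_power k A (Suc n))"

text \<open>The elementary tensor of a nonempty word, placed in the summand determined by its length.\<close>

definition etensor ::
  "('k, 'x) ring_scheme \<Rightarrow> ('k, 'a, 'y) module_scheme \<Rightarrow> 'a list \<Rightarrow> ('k, 'a) sh"
  where "etensor k A w = (\<lambda>n. if length w = Suc n
      then tensor_relations k A (Suc n) +>\<^bsub>free_module k (words A (Suc n))\<^esub> basis_vec k w
      else \<zero>\<^bsub>tensor_power k A (Suc n)\<^esub>)"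

text \<open>The \<open>k\<close>-linear map on the shuffle module with prescribed values \<open>\<phi>\<close> on elementary tensors.
  It exists, and is unique as a map on the carrier, whenever \<open>\<phi>\<close> is multilinear on the words of
  each length; it is only used for such \<open>\<phi>\<close>.\<close>

definition lin_ext ::
  "('k, 'x) ring_scheme \<Rightarrow> ('k, 'a, 'y) module_scheme \<Rightarrow> ('k, 'n, 'z) module_scheme
     \<Rightarrow> ('a list \<Rightarrow> 'n) \<Rightarrow> ('k, 'a) sh \<Rightarrow> 'n"
  where "lin_ext k A N \<phi> = (THE g.
    g \<in> extensional (carrier (Sh_module k A)) \<and>
    linear_map k (Sh_module k A) N g \<and>
    (\<forall>w\<in>lists (carrier A). w \<noteq> [] \<longrightarrow> g (etensor k A w) = \<phi> w))"

definition tensor_prefix ::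
  "('k, 'x) ring_scheme \<Rightarrow> ('k, 'a, 'y) module_scheme \<Rightarrow> 'a \<Rightarrow> ('k, 'a) sh \<Rightarrow> ('k, 'a) sh"
  where "tensor_prefix k A a = lin_ext k A (Sh_module k A) (\<lambda>w. etensor k A (a # w))"

text \<open>The product of two elementary tensors; the clauses for an empty word are junk values.\<close>

fun shuffle ::
  "('k, 'x) ring_scheme \<Rightarrow> ('k, 'a, 'y) module_scheme \<Rightarrow> 'k \<Rightarrow> 'a list \<Rightarrow> 'a list \<Rightarrow> ('k, 'a) sh"
  where
    "shuffle k A lam [] w = \<zero>\<^bsub>Sh_module k A\<^esub>"
  | "shuffle k A lam (a # u) [] = \<zero>\<^bsub>Sh_module k A\<^esub>"
  | "shuffle k A lam [a] (b # v) = etensor k A ((a \<otimes>\<^bsub>A\<^esub> b) # v)"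
  | "shuffle k A lam (a # a' # u) [b] = etensor k A ((a \<otimes>\<^bsub>A\<^esub> b) # a' # u)"
  | "shuffle k A lam (a # a' # u) (b # b' # v) =
      tensor_prefix k A (a \<otimes>\<^bsub>A\<^esub> b)
       (shuffle k A lam (a' # u) (\<one>\<^bsub>A\<^esub> # b' # v)
        \<oplus>\<^bsub>Sh_module k A\<^esub> shuffle k A lam (\<one>\<^bsub>A\<^esub> # a' # u) (b' # v)
        \<oplus>\<^bsub>Sh_module k A\<^esub> lam \<odot>\<^bsub>Sh_module k A\<^esub> shuffle k A lam (a' # u) (b' # v))"

definition Sh ::
  "('k, 'x) ring_scheme \<Rightarrow> ('k, 'a, 'y) module_scheme \<Rightarrow> 'k \<Rightarrow> ('k, ('k, 'a) sh) module"
  where "Sh k A lam = (Sh_module k A)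
    \<lparr>mult := (\<lambda>s t. lin_ext k A (Sh_module k A)
        (\<lambda>u. lin_ext k A (Sh_module k A) (\<lambda>v. shuffle k A lam u v) t) s),
     one := etensor k A [\<one>\<^bsub>A\<^esub>]\<rparr>"

definition Sh_P ::
  "('k, 'x) ring_scheme \<Rightarrow> ('k, 'a, 'y) module_scheme \<Rightarrow> ('k, 'a) sh \<Rightarrow> ('k, 'a) sh"
  where "Sh_P k A = tensor_prefix k A \<one>\<^bsub>A\<^esub>"

fun d_word ::
  "('k, 'x) ring_scheme \<Rightarrow> ('k, 'a, 'y) module_scheme \<Rightarrow> 'k \<Rightarrow> ('a \<Rightarrow> 'a) \<Rightarrow> 'a list \<Rightarrow> ('k, 'a) sh"
  where
    "d_word k A lam d [] = \<zero>\<^bsub>Sh_module k A\<^esub>"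
  | "d_word k A lam d [a] = etensor k A [d a]"
  | "d_word k A lam d (a # b # w) =
      etensor k A (d a # b # w)
      \<oplus>\<^bsub>Sh_module k A\<^esub> etensor k A ((a \<otimes>\<^bsub>A\<^esub> b) # w)
      \<oplus>\<^bsub>Sh_module k A\<^esub> lam \<odot>\<^bsub>Sh_module k A\<^esub> etensor k A ((d a \<otimes>\<^bsub>A\<^esub> b) # w)"

definition Sh_d ::
  "('k, 'x) ring_scheme \<Rightarrow> ('k, 'a, 'y) module_scheme \<Rightarrow> 'k \<Rightarrow> ('a \<Rightarrow> 'a) \<Rightarrow> ('k, 'a) sh \<Rightarrow> ('k, 'a) sh"
  where "Sh_d k A lam d = lin_ext k A (Sh_module k A) (d_word k A lam d)"


section \<open>The quotient of the shuffle algebra\<close>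

definition Sh_J ::
  "('k, 'x) ring_scheme \<Rightarrow> ('k, 'a, 'y) module_scheme \<Rightarrow> 'k \<Rightarrow> ('a \<Rightarrow> 'a) \<Rightarrow> ('k, 'a) sh \<Rightarrow> ('k, 'a) sh"
  where "Sh_J k A lam d x = Sh_P k A (Sh_d k A lam d x)"

definition Sh_E ::
  "('k, 'x) ring_scheme \<Rightarrow> ('k, 'a, 'y) module_scheme \<Rightarrow> 'k \<Rightarrow> ('a \<Rightarrow> 'a) \<Rightarrow> ('k, 'a) sh \<Rightarrow> ('k, 'a) sh"
  where "Sh_E k A lam d x = x \<ominus>\<^bsub>Sh k A lam\<^esub> Sh_P k A (Sh_d k A lam d x)"

definition ID_ideal ::
  "('k, 'x) ring_scheme \<Rightarrow> ('k, 'a, 'y) module_scheme \<Rightarrow> 'k \<Rightarrow> ('a \<Rightarrow> 'a) \<Rightarrow> ('k, 'a) sh set"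
  where "ID_ideal k A lam d = (let S = Sh k A lam; J = Sh_J k A lam d; E = Sh_E k A lam d in
    gen_diff_RB_ideal S (Sh_d k A lam d) (Sh_P k A)
      {J (E x \<otimes>\<^bsub>S\<^esub> J y) \<ominus>\<^bsub>S\<^esub> E x \<otimes>\<^bsub>S\<^esub> J y | x y. x \<in> carrier S \<and> y \<in> carrier S})"

definition ID ::
  "('k, 'x) ring_scheme \<Rightarrow> ('k, 'a, 'y) module_scheme \<Rightarrow> 'k \<Rightarrow> ('a \<Rightarrow> 'a) \<Rightarrow> ('k, ('k, 'a) sh set) module"
  where "ID k A lam d = quotient (Sh k A lam) (ID_ideal k A lam d)"

definition ID_delta ::
  "('k, 'x) ring_scheme \<Rightarrow> ('k, 'a, 'y) module_scheme \<Rightarrow> 'k \<Rightarrow> ('a \<Rightarrow> 'a)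
     \<Rightarrow> ('k, 'a) sh set \<Rightarrow> ('k, 'a) sh set"
  where "ID_delta k A lam d = coset_map (Sh k A lam) (ID_ideal k A lam d) (Sh_d k A lam d)"

definition ID_Pi ::
  "('k, 'x) ring_scheme \<Rightarrow> ('k, 'a, 'y) module_scheme \<Rightarrow> 'k \<Rightarrow> ('a \<Rightarrow> 'a)
     \<Rightarrow> ('k, 'a) sh set \<Rightarrow> ('k, 'a) sh set"
  where "ID_Pi k A lam d = coset_map (Sh k A lam) (ID_ideal k A lam d) (Sh_P k A)"

definition ID_incl ::
  "('k, 'x) ring_scheme \<Rightarrow> ('k, 'a, 'y) module_scheme \<Rightarrow> 'k \<Rightarrow> ('a \<Rightarrow> 'a) \<Rightarrow> 'a \<Rightarrow> ('k, 'a) sh set"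
  where "ID_incl k A lam d a = ID_ideal k A lam d +>\<^bsub>Sh k A lam\<^esub> etensor k A [a]"

end

theory Submission
  imports Defs
begin

text \<open>Put \<open>J = P \<circ> d\<close> and \<open>E = id - J\<close>. In a differential Rota-Baxter algebra \<open>J\<close> and \<open>E\<close> are
  complementary projections, onto the image of \<open>P\<close> and the kernel of \<open>d\<close>, and the hybrid axiom says
  \<open>E (x y) = E x E y\<close>. Since \<open>J x J y\<close> lies in the image of \<open>P\<close> by the Rota-Baxter identity and
  \<open>d (E x E y) = 0\<close>, expanding \<open>x y = (E x + J x) (E y + J y)\<close> shows that this holds if and only if
  \<open>J\<close> fixes all the products \<open>E x J y\<close>, which is what passing to the quotient by \<open>I\<close> enforces.
  Conversely every integro-differential algebra satisfies the Rota-Baxter identity and these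
  relations. So a homomorphism \<open>f\<close> extends first to the shuffle algebra, by
  \<open>a\<^sub>0 \<otimes> \<dots> \<otimes> a\<^sub>n \<mapsto> f a\<^sub>0 \<cdot> \<Pi> (f a\<^sub>1 \<cdot> \<Pi> (\<dots> \<cdot> \<Pi> (f a\<^sub>n)))\<close>, and then to the quotient; uniqueness holds because
  \<open>a \<otimes> w = a \<cdot> P w\<close>, so that the letters generate.

  The algebra structure of the shuffle module rests on the same normal form: in
  \<open>(a \<cdot> P u) (b \<cdot> P v) = a b \<cdot> P (u P v + P u v + \<lambda> u v)\<close> the letters factor out, associativity reduces
  to products of elements \<open>P u\<close>, and there the Rota-Baxter identity lowers the length.\<close>

section \<open>Linear maps and quotient modules\<close>

text \<open>An element of \<open>Sh\<close> is a family of cosets of finitely supported functions on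
  words. It has no canonical expression by elementary tensors, so a map cannot be defined by
  recursion on it, nor an identity checked by inspecting it. Each operation therefore starts as a
  function of words, has to be proved multilinear, and is then extended by \<open>lin_ext\<close>;
  each identity is linear in every argument and is checked on elementary tensors by
  \<open>Sh_induct\<close>. This is why multilinearity of \<open>shuffle\<close>,
  \<open>d_word\<close> and \<open>word_ext\<close> takes so much room. The Leibniz rule on
  \<open>Sh\<close> is reduced like associativity: split off the first letters, treat the letters in
  \<open>A\<close> and the remaining factors by the Rota-Baxter identity, and recombine by an
  identity of commutative rings. Freeness of \<open>Sh\<close> is not presupposed. Its algebra
  structure is proved, and its universal property is established for integro-differential targets.
  The ideal \<open>I\<close> is never computed: its generators give the axioms of the quotient, and
  its minimality puts it inside the kernel of the extended map.\<close>

lemma linear_mapI: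
  assumes "\<And>x. x \<in> carrier M \<Longrightarrow> f x \<in> carrier N"
    and "\<And>x y. \<lbrakk>x \<in> carrier M; y \<in> carrier M\<rbrakk> \<Longrightarrow> f (x \<oplus>\<^bsub>M\<^esub> y) = f x \<oplus>\<^bsub>N\<^esub> f y"
    and "\<And>c x. \<lbrakk>c \<in> carrier k; x \<in> carrier M\<rbrakk> \<Longrightarrow> f (c \<odot>\<^bsub>M\<^esub> x) = c \<odot>\<^bsub>N\<^esub> f x"
  shows "linear_map k M N f"
  using assms by (auto simp: linear_map_def)

lemma linear_map_closed: "\<lbrakk>linear_map k M N f; x \<in> carrier M\<rbrakk> \<Longrightarrow> f x \<in> carrier N"
  by (auto simp: linear_map_def)

lemma linear_map_add:
  "\<lbrakk>linear_map k M N f; x \<in> carrier M; y \<in> carrier M\<rbrakk> \<Longrightarrow> f (x \<oplus>\<^bsub>M\<^esub> y) = f x \<oplus>\<^bsub>N\<^esub> f y"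
  by (auto simp: linear_map_def)

lemma linear_map_smult:
  "\<lbrakk>linear_map k M N f; c \<in> carrier k; x \<in> carrier M\<rbrakk> \<Longrightarrow> f (c \<odot>\<^bsub>M\<^esub> x) = c \<odot>\<^bsub>N\<^esub> f x"
  by (auto simp: linear_map_def)

lemma linear_map_zero:
  assumes "module k M" "module k N" "linear_map k M N f"
  shows "f \<zero>\<^bsub>M\<^esub> = \<zero>\<^bsub>N\<^esub>"
proof -
  interpret M: module k M by fact
  interpret N: module k N by fact
  show ?thesis
    using linear_map_smult[OF assms(3), of "\<zero>\<^bsub>k\<^esub>" "\<zero>\<^bsub>M\<^esub>"] linear_map_closed[OF assms(3), of "\<zero>\<^bsub>M\<^esub>"]
    by simp
qed

lemma linear_map_uminus:
  assumes "module k M" "module k N" "linear_map k M N f" "x \<in> carrier M"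
  shows "f (\<ominus>\<^bsub>M\<^esub> x) = \<ominus>\<^bsub>N\<^esub> f x"
proof -
  interpret M: module k M by fact
  interpret N: module k N by fact
  have "f (\<ominus>\<^bsub>M\<^esub> x) \<oplus>\<^bsub>N\<^esub> f x = f (\<ominus>\<^bsub>M\<^esub> x \<oplus>\<^bsub>M\<^esub> x)"
    using assms by (simp add: linear_map_add)
  also have "\<dots> = \<zero>\<^bsub>N\<^esub>"
    using assms by (simp add: M.M.l_neg linear_map_zero)
  finally show ?thesis
    using assms linear_map_closed[OF assms(3)] by (metis M.M.a_inv_closed N.M.minus_equality)
qed

lemma linear_map_minus:
  assumes "module k M" "module k N" "linear_map k M N f" "x \<in> carrier M" "y \<in> carrier M"
  shows "f (x \<ominus>\<^bsub>M\<^esub> y) = f x \<ominus>\<^bsub>N\<^esub> f y"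
proof -
  interpret M: module k M by fact
  show ?thesis
    using assms by (simp add: a_minus_def linear_map_add linear_map_uminus)
qed

lemma linear_map_comp:
  "\<lbrakk>linear_map k M N f; linear_map k N P g\<rbrakk> \<Longrightarrow> linear_map k M P (\<lambda>x. g (f x))"
  by (auto simp: linear_map_def Pi_def)

lemma linear_map_plus:
  assumes "module k N" "linear_map k M N f" "linear_map k M N g"
  shows "linear_map k M N (\<lambda>x. f x \<oplus>\<^bsub>N\<^esub> g x)"
proof -
  interpret N: module k N by fact
  show ?thesis
    by (rule linear_mapI)
      (use assms in \<open>auto simp: linear_map_closed linear_map_add linear_map_smult
        N.smult_r_distr N.M.a_ac intro!: N.M.a_closed\<close>)
qed

lemma linear_map_scale:
  assumes "module k N" "linear_map k M N f" "c \<in> carrier k"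
  shows "linear_map k M N (\<lambda>x. c \<odot>\<^bsub>N\<^esub> f x)"
proof -
  interpret N: module k N by fact
  show ?thesis
    by (rule linear_mapI)
      (use assms in \<open>auto simp: linear_map_closed linear_map_add linear_map_smult
        N.smult_r_distr N.m_comm N.smult_assoc1[symmetric]\<close>)
qed

lemma linear_map_const_zero:
  assumes "module k N"
  shows "linear_map k M N (\<lambda>x. \<zero>\<^bsub>N\<^esub>)"
proof -
  interpret N: module k N by fact
  show ?thesis by (rule linear_mapI) auto
qed

lemma linear_map_cong:
  assumes "module k M" "linear_map k M N f" "\<And>x. x \<in> carrier M \<Longrightarrow> f x = g x"
  shows "linear_map k M N g"
proof -
  interpret M: module k M by fact
  show ?thesis
    by (rule linear_mapI)
      (use assms in \<open>auto simp: assms(3)[symmetric] linear_map_closed linear_map_add linear_map_smult\<close>)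
qed

text \<open>Applied with \<open>g\<close> constantly zero, that is, to kernels: of the map that must
  kill the tensor relations, and of \<open>ext\<close>.\<close>

lemma submodule_equalizer:
  assumes "module k M" "module k N" "linear_map k M N f" "linear_map k M N g"
  shows "submodule {x \<in> carrier M. f x = g x} k M"
proof -
  interpret M: module k M by fact
  interpret N: module k N by fact
  show ?thesis
    by (rule M.submoduleI)
      (use assms in \<open>auto simp: linear_map_zero linear_map_uminus linear_map_add linear_map_smult\<close>)
qed

section \<open>Generated submodules and quotient modules\<close>

lemma (in module) submodule_gen:
  assumes "S \<subseteq> carrier M"
  shows "submodule (gen_submodule R M S) R M"
proof (rule submoduleI)
  show "gen_submodule R M S \<subseteq> carrier M"
    unfolding gen_submodule_def using carrier_is_submodule assms by blast
  show "\<zero>\<^bsub>M\<^esub> \<in> gen_submodule R M S"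
    unfolding gen_submodule_def
    by (auto dest!: submodule.axioms(1) subgroup.one_closed)
qed (auto simp: gen_submodule_def dest: submoduleE)

lemma gen_submodule_subset: "\<lbrakk>submodule N k M; S \<subseteq> N\<rbrakk> \<Longrightarrow> gen_submodule k M S \<subseteq> N"
  unfolding gen_submodule_def by blast

lemma gen_submodule_superset: "S \<subseteq> gen_submodule k M S"
  unfolding gen_submodule_def by blast

text \<open>Interpreted for the tensor powers, for the submodule cut out by a predicate in
  \<open>Sh_induct\<close>, and for the module underlying the quotient by a differential Rota-Baxter
  ideal.\<close>

locale quotient_module = module k M for k :: "('k, 'x) ring_scheme" (structure)
    and M :: "('k, 'm, 'y) module_scheme" (structure) +
  fixes N assumes submodule: "submodule N k M"
begin

sublocale coset: abelian_subgroup N M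
  by (intro abelian_subgroupI3 additive_subgroupI submodule.axioms(1)[OF submodule] M.abelian_group_axioms)

lemma coset_eq_iff:
  assumes "x \<in> carrier M" "y \<in> carrier M"
  shows "N +>\<^bsub>M\<^esub> x = N +>\<^bsub>M\<^esub> y \<longleftrightarrow> x \<ominus>\<^bsub>M\<^esub> y \<in> N"
proof
  assume "N +>\<^bsub>M\<^esub> x = N +>\<^bsub>M\<^esub> y"
  then have "x \<in> N +>\<^bsub>M\<^esub> y"
    using coset.a_rcos_self[OF assms(1)] by simp
  then show "x \<ominus>\<^bsub>M\<^esub> y \<in> N"
    using coset.a_rcos_module[OF assms(2,1)] by (simp add: a_minus_def)
next
  assume "x \<ominus>\<^bsub>M\<^esub> y \<in> N"
  then have "x \<in> N +>\<^bsub>M\<^esub> y"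
    using coset.a_rcos_module[OF assms(2,1)] by (simp add: a_minus_def)
  then show "N +>\<^bsub>M\<^esub> x = N +>\<^bsub>M\<^esub> y"
    using coset.a_repr_independence'[OF _ assms(2)] by simp
qed

text \<open>If \<open>y = n + x\<close> with \<open>n\<close> in \<open>N\<close>, then
  \<open>f y\<close> and \<open>f x\<close> differ by \<open>f n\<close>, again in \<open>N\<close>.
  So all cosets in the union that defines \<open>coset_map\<close> coincide, and the union is
  nonempty.\<close>

lemma coset_map_coset:
  assumes f: "\<And>x. x \<in> carrier M \<Longrightarrow> f x \<in> carrier M"
    and add: "\<And>x y. \<lbrakk>x \<in> carrier M; y \<in> carrier M\<rbrakk> \<Longrightarrow> f (x \<oplus>\<^bsub>M\<^esub> y) = f x \<oplus>\<^bsub>M\<^esub> f y"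
    and N: "f ` N \<subseteq> N" and x: "x \<in> carrier M"
  shows "coset_map M N f (N +>\<^bsub>M\<^esub> x) = N +>\<^bsub>M\<^esub> f x"
proof -
  have "N +>\<^bsub>M\<^esub> f y = N +>\<^bsub>M\<^esub> f x" if y: "y \<in> N +>\<^bsub>M\<^esub> x" for y
  proof -
    obtain n where n: "n \<in> N" "y = n \<oplus>\<^bsub>M\<^esub> x"
      using y by (auto simp: a_r_coset_def')
    then have "f y = f n \<oplus>\<^bsub>M\<^esub> f x" and "f n \<in> N"
      using add x N by auto
    then have "f y \<in> N +>\<^bsub>M\<^esub> f x"
      by (auto simp: a_r_coset_def')
    then show ?thesis
      using coset.a_repr_independence'[OF _ f[OF x]] by simp
  qed
  then have "coset_map M N f (N +>\<^bsub>M\<^esub> x) = (\<Union>y\<in>N +>\<^bsub>M\<^esub> x. N +>\<^bsub>M\<^esub> f x)"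
    unfolding coset_map_def by (rule SUP_cong[OF refl])
  moreover have "N +>\<^bsub>M\<^esub> x \<noteq> {}"
    using coset.a_rcos_self[OF x] by blast
  ultimately show ?thesis
    by simp
qed

lemma smult_N: "(\<lambda>x. c \<odot>\<^bsub>M\<^esub> x) ` N \<subseteq> N" if "c \<in> carrier k"
  using submodule.smult_closed[OF submodule that] by auto

lemma carrier_quotient: "carrier (quotient M N) = (\<lambda>x. N +>\<^bsub>M\<^esub> x) ` carrier M"
  by (auto simp: quotient_def FactRing_def A_RCOSETS_def RCOSETS_def a_r_coset_def)

lemma quotient_simps:
  shows "\<lbrakk>x \<in> carrier M; y \<in> carrier M\<rbrakk> \<Longrightarrow>
      (N +>\<^bsub>M\<^esub> x) \<oplus>\<^bsub>quotient M N\<^esub> (N +>\<^bsub>M\<^esub> y) = N +>\<^bsub>M\<^esub> (x \<oplus>\<^bsub>M\<^esub> y)"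
    and "\<zero>\<^bsub>quotient M N\<^esub> = N +>\<^bsub>M\<^esub> \<zero>\<^bsub>M\<^esub>"
    and "\<lbrakk>c \<in> carrier k; x \<in> carrier M\<rbrakk> \<Longrightarrow>
      c \<odot>\<^bsub>quotient M N\<^esub> (N +>\<^bsub>M\<^esub> x) = N +>\<^bsub>M\<^esub> (c \<odot>\<^bsub>M\<^esub> x)"
proof -
  show "\<lbrakk>x \<in> carrier M; y \<in> carrier M\<rbrakk> \<Longrightarrow>
      (N +>\<^bsub>M\<^esub> x) \<oplus>\<^bsub>quotient M N\<^esub> (N +>\<^bsub>M\<^esub> y) = N +>\<^bsub>M\<^esub> (x \<oplus>\<^bsub>M\<^esub> y)"
    by (simp add: quotient_def FactRing_def coset.a_rcos_sum)
  show "\<zero>\<^bsub>quotient M N\<^esub> = N +>\<^bsub>M\<^esub> \<zero>\<^bsub>M\<^esub>"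
    by (simp add: quotient_def FactRing_def coset.a_rcos_const)
  show "\<lbrakk>c \<in> carrier k; x \<in> carrier M\<rbrakk> \<Longrightarrow>
      c \<odot>\<^bsub>quotient M N\<^esub> (N +>\<^bsub>M\<^esub> x) = N +>\<^bsub>M\<^esub> (c \<odot>\<^bsub>M\<^esub> x)"
    by (simp add: quotient_def) (rule coset_map_coset, auto simp: smult_r_distr smult_N)
qed

lemma module_quotient: "module k (quotient M N)"
proof (rule moduleI)
  show "cring k" by (rule R.cring_axioms)
  show "abelian_group (quotient M N)"
  proof (rule abelian_groupI)
    fix X assume "X \<in> carrier (quotient M N)"
    then obtain x where x: "x \<in> carrier M" "X = N +>\<^bsub>M\<^esub> x"
      by (auto simp: carrier_quotient)
    then have "(N +>\<^bsub>M\<^esub> (\<ominus>\<^bsub>M\<^esub> x)) \<oplus>\<^bsub>quotient M N\<^esub> X = \<zero>\<^bsub>quotient M N\<^esub>"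
      by (simp add: quotient_simps M.l_neg)
    with x show "\<exists>Y\<in>carrier (quotient M N). Y \<oplus>\<^bsub>quotient M N\<^esub> X = \<zero>\<^bsub>quotient M N\<^esub>"
      by (auto simp: carrier_quotient)
  qed (auto simp: carrier_quotient quotient_simps M.a_ac)
qed (auto simp: carrier_quotient quotient_simps smult_l_distr smult_r_distr smult_assoc1)

lemma linear_map_coset: "linear_map k M (quotient M N) (\<lambda>x. N +>\<^bsub>M\<^esub> x)"
  by (rule linear_mapI) (auto simp: quotient_simps carrier_quotient)

text \<open>The source of all maps out of quotients: out of the tensor powers, and in the end out of
  \<open>Sh\<close> modulo \<open>I\<close>.\<close>

lemma factor_linear_map:
  assumes P: "module k P" and g: "linear_map k M P g" and N: "\<And>x. x \<in> N \<Longrightarrow> g x = \<zero>\<^bsub>P\<^esub>"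
  obtains h where "linear_map k (quotient M N) P h" "\<And>x. x \<in> carrier M \<Longrightarrow> h (N +>\<^bsub>M\<^esub> x) = g x"
proof -
  interpret P: module k P by fact
  \<comment> \<open>The choice is harmless: two representatives differ by an element of
    \<open>N\<close>, which \<open>g\<close> kills.\<close>
  define h where "h X = g (SOME x. x \<in> X)" for X
  have h: "h (N +>\<^bsub>M\<^esub> x) = g x" if x: "x \<in> carrier M" for x
  proof -
    define y where "y = (SOME y. y \<in> N +>\<^bsub>M\<^esub> x)"
    have "y \<in> N +>\<^bsub>M\<^esub> x"
      unfolding y_def by (rule someI[of _ x]) (rule coset.a_rcos_self[OF x])
    then obtain n where n: "n \<in> N" "y = n \<oplus>\<^bsub>M\<^esub> x"
      by (auto simp: a_r_coset_def')
    then have "g y = g n \<oplus>\<^bsub>P\<^esub> g x"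
      using linear_map_add[OF g] x by auto
    with n N x linear_map_closed[OF g] have "g y = g x" by simp
    then show ?thesis by (simp add: h_def y_def)
  qed
  have "linear_map k (quotient M N) P h"
    by (rule linear_mapI)
      (use g in \<open>auto simp: carrier_quotient h quotient_simps linear_map_closed linear_map_add linear_map_smult\<close>)
  with h show ?thesis using that by blast
qed

end

section \<open>Free modules, direct sums and tensor powers\<close>

text \<open>The default value \<open>z i\<close> may depend on \<open>i\<close>. Thus one rule
  serves free modules, with a single zero, and direct sums, where every summand has its own.\<close>

lemma finite_support_induct [consumes 1, case_names zero step]:
  assumes "finite {i. s i \<noteq> z i}"
    and zero: "Q z"
    and step: "\<And>s i. \<lbrakk>s i \<noteq> z i; Q (s(i := z i))\<rbrakk> \<Longrightarrow> Q s"
  shows "Q s"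
proof -
  have "finite T \<Longrightarrow> {i. s i \<noteq> z i} = T \<Longrightarrow> Q s" for T
  proof (induction T arbitrary: s rule: finite_induct)
    case empty
    then have "s = z" by auto
    with zero show ?case by simp
  next
    case (insert i T)
    have "{j. (s(i := z i)) j \<noteq> z j} = T"
      using insert.prems insert.hyps by auto
    then have "Q (s(i := z i))" by (rule insert.IH)
    moreover have "s i \<noteq> z i" using insert.prems by auto
    ultimately show ?case by (rule step[rotated])
  qed
  with assms(1) show ?thesis by blast
qed

text \<open>Allows sums over different supports to be compared over one common finite index
  set.\<close>

lemma (in abelian_monoid) finsum_support:
  assumes "finite T" "{i. s i \<noteq> z i} \<subseteq> T" "\<And>i. h i (s i) \<in> carrier G" "\<And>i. h i (z i) = \<zero>"
  shows "finsum G (\<lambda>i. h i (s i)) {i. s i \<noteq> z i} = finsum G (\<lambda>i. h i (s i)) T"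
proof (rule add.finprod_mono_neutral_cong_left[OF assms(1,2)])
  fix i assume "i \<in> T - {i. s i \<noteq> z i}"
  then have "s i = z i" by auto
  with assms(4)[of i] show "h i (s i) = \<zero>" by simp
qed (use assms in auto)

text \<open>\<open>F\<close> is known only through the coordinates of its elements, so that free
  modules and direct sums can share the construction of a linear map by summing over the
  support.\<close>

lemma (in module) linear_map_finsum_support:
  assumes fin: "\<And>s. s \<in> carrier F \<Longrightarrow> finite {i. s i \<noteq> z i}"
    and closed: "\<And>s t. \<lbrakk>s \<in> carrier F; t \<in> carrier F\<rbrakk> \<Longrightarrow> s \<oplus>\<^bsub>F\<^esub> t \<in> carrier F"
      "\<And>c s. \<lbrakk>c \<in> carrier R; s \<in> carrier F\<rbrakk> \<Longrightarrow> c \<odot>\<^bsub>F\<^esub> s \<in> carrier F"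
    and h: "\<And>i s. s \<in> carrier F \<Longrightarrow> h i (s i) \<in> carrier M" "\<And>i. h i (z i) = \<zero>\<^bsub>M\<^esub>"
    and add: "\<And>i s t. \<lbrakk>s \<in> carrier F; t \<in> carrier F\<rbrakk> \<Longrightarrow> h i ((s \<oplus>\<^bsub>F\<^esub> t) i) = h i (s i) \<oplus>\<^bsub>M\<^esub> h i (t i)"
    and smult: "\<And>i c s. \<lbrakk>c \<in> carrier R; s \<in> carrier F\<rbrakk> \<Longrightarrow> h i ((c \<odot>\<^bsub>F\<^esub> s) i) = c \<odot>\<^bsub>M\<^esub> h i (s i)"
  shows "linear_map R F M (\<lambda>s. finsum M (\<lambda>i. h i (s i)) {i. s i \<noteq> z i})"
proof (rule linear_mapI)
  fix s t assume st: "s \<in> carrier F" "t \<in> carrier F"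
  \<comment> \<open>Cancellation may make the support of the sum smaller than the union of the other
    two; over \<open>T\<close> all three sums have the same index set.\<close>
  define T where "T = {i. s i \<noteq> z i} \<union> {i. t i \<noteq> z i} \<union> {i. (s \<oplus>\<^bsub>F\<^esub> t) i \<noteq> z i}"
  have T: "finite T" using fin st closed by (simp add: T_def)
  have sub: "{i. s i \<noteq> z i} \<subseteq> T" "{i. t i \<noteq> z i} \<subseteq> T" "{i. (s \<oplus>\<^bsub>F\<^esub> t) i \<noteq> z i} \<subseteq> T"
    unfolding T_def by blast+
  have "finsum M (\<lambda>i. h i ((s \<oplus>\<^bsub>F\<^esub> t) i)) T
      = finsum M (\<lambda>i. h i (s i)) T \<oplus>\<^bsub>M\<^esub> finsum M (\<lambda>i. h i (t i)) T"
    using st by (simp add: add h M.finsum_addf)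
  moreover have "finsum M (\<lambda>i. h i (u i)) {i. u i \<noteq> z i} = finsum M (\<lambda>i. h i (u i)) T"
    if "u \<in> carrier F" "{i. u i \<noteq> z i} \<subseteq> T" for u
    by (rule M.finsum_support) (use that h T in auto)
  ultimately show "finsum M (\<lambda>i. h i ((s \<oplus>\<^bsub>F\<^esub> t) i)) {i. (s \<oplus>\<^bsub>F\<^esub> t) i \<noteq> z i}
      = finsum M (\<lambda>i. h i (s i)) {i. s i \<noteq> z i} \<oplus>\<^bsub>M\<^esub> finsum M (\<lambda>i. h i (t i)) {i. t i \<noteq> z i}"
    using st closed sub by simp
next
  fix c s assume cs: "c \<in> carrier R" "s \<in> carrier F"
  define T where "T = {i. s i \<noteq> z i} \<union> {i. (c \<odot>\<^bsub>F\<^esub> s) i \<noteq> z i}"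
  have T: "finite T" using fin cs closed by (simp add: T_def)
  have sub: "{i. s i \<noteq> z i} \<subseteq> T" "{i. (c \<odot>\<^bsub>F\<^esub> s) i \<noteq> z i} \<subseteq> T"
    unfolding T_def by blast+
  have "finsum M (\<lambda>i. h i ((c \<odot>\<^bsub>F\<^esub> s) i)) T = c \<odot>\<^bsub>M\<^esub> finsum M (\<lambda>i. h i (s i)) T"
    using cs T by (simp add: smult h finsum_smult_ldistr)
  moreover have "finsum M (\<lambda>i. h i (u i)) {i. u i \<noteq> z i} = finsum M (\<lambda>i. h i (u i)) T"
    if "u \<in> carrier F" "{i. u i \<noteq> z i} \<subseteq> T" for u
    by (rule M.finsum_support) (use that h T in auto)
  ultimately show "finsum M (\<lambda>i. h i ((c \<odot>\<^bsub>F\<^esub> s) i)) {i. (c \<odot>\<^bsub>F\<^esub> s) i \<noteq> z i}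
      = c \<odot>\<^bsub>M\<^esub> finsum M (\<lambda>i. h i (s i)) {i. s i \<noteq> z i}"
    using cs closed sub by simp
qed (use h in auto)

section \<open>Free modules: the module axioms and the universal property\<close>

lemma free_module_simps:
  "f \<in> carrier (free_module k X) \<longleftrightarrow>
    f \<in> X \<rightarrow> carrier k \<and> (\<forall>w. w \<notin> X \<longrightarrow> f w = \<zero>\<^bsub>k\<^esub>) \<and> finite {w. f w \<noteq> \<zero>\<^bsub>k\<^esub>}"
  "\<zero>\<^bsub>free_module k X\<^esub> = (\<lambda>w. \<zero>\<^bsub>k\<^esub>)"
  "f \<oplus>\<^bsub>free_module k X\<^esub> g = (\<lambda>w. f w \<oplus>\<^bsub>k\<^esub> g w)"
  "c \<odot>\<^bsub>free_module k X\<^esub> f = (\<lambda>w. c \<otimes>\<^bsub>k\<^esub> f w)"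
  by (auto simp: free_module_def)

lemma (in cring) free_module_closed: "f \<in> carrier (free_module R X) \<Longrightarrow> f w \<in> carrier R"
  by (cases "w \<in> X") (auto simp: free_module_simps)

lemma (in cring) module_free_module: "module R (free_module R X)"
proof -
  have fin_add: "finite {w. f w \<oplus> g w \<noteq> \<zero>}" if "finite {w. f w \<noteq> \<zero>}" "finite {w. g w \<noteq> \<zero>}" for f g
    by (rule finite_subset[OF _ finite_UnI[OF that]]) auto
  have fin_smult: "finite {w. c \<otimes> f w \<noteq> \<zero>}" if "finite {w. f w \<noteq> \<zero>}" "c \<in> carrier R" for f c
    by (rule finite_subset[OF _ that(1)]) (use that(2) in auto)
  note closed = free_module_closed
  show ?thesis
  proof (rule moduleI)
    show "abelian_group (free_module R X)"
    proof (rule abelian_groupI)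
      fix f assume f: "f \<in> carrier (free_module R X)"
      \<comment> \<open>The negative is written as a scalar multiple, so that
        \<open>fin_smult\<close> provides its finite support.\<close>
      then have "(\<lambda>w. \<ominus> \<one> \<otimes> f w) \<in> carrier (free_module R X)"
        by (auto simp: free_module_simps fin_smult)
      moreover have "(\<lambda>w. \<ominus> \<one> \<otimes> f w) \<oplus>\<^bsub>free_module R X\<^esub> f = \<zero>\<^bsub>free_module R X\<^esub>"
        using closed[OF f] by (auto simp: free_module_simps l_minus l_neg)
      ultimately show "\<exists>g\<in>carrier (free_module R X). g \<oplus>\<^bsub>free_module R X\<^esub> f = \<zero>\<^bsub>free_module R X\<^esub>"
        by blast
    next
      fix f g h assume "f \<in> carrier (free_module R X)" "g \<in> carrier (free_module R X)" "h \<in> carrier (free_module R X)"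
      note c = this[THEN closed]
      show "f \<oplus>\<^bsub>free_module R X\<^esub> g \<oplus>\<^bsub>free_module R X\<^esub> h = f \<oplus>\<^bsub>free_module R X\<^esub> (g \<oplus>\<^bsub>free_module R X\<^esub> h)"
        using c by (simp add: free_module_simps(3) a_assoc)
    next
      fix f g assume "f \<in> carrier (free_module R X)" "g \<in> carrier (free_module R X)"
      note c = this[THEN closed]
      show "f \<oplus>\<^bsub>free_module R X\<^esub> g = g \<oplus>\<^bsub>free_module R X\<^esub> f"
        using c by (simp add: free_module_simps(3) a_comm)
    next
      fix f assume "f \<in> carrier (free_module R X)"
      note c = this[THEN closed]
      show "\<zero>\<^bsub>free_module R X\<^esub> \<oplus>\<^bsub>free_module R X\<^esub> f = f"
        using c by (simp add: free_module_simps(2,3))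
    qed (auto simp: free_module_simps fin_add Pi_iff)
  next
    fix f assume f: "f \<in> carrier (free_module R X)"
    show "\<one> \<odot>\<^bsub>free_module R X\<^esub> f = f"
      using closed[OF f] by (simp add: free_module_simps(4))
    fix c b assume c: "c \<in> carrier R" "b \<in> carrier R"
    show "(c \<oplus> b) \<odot>\<^bsub>free_module R X\<^esub> f = c \<odot>\<^bsub>free_module R X\<^esub> f \<oplus>\<^bsub>free_module R X\<^esub> b \<odot>\<^bsub>free_module R X\<^esub> f"
      using closed[OF f] c by (simp add: free_module_simps(3,4) l_distr)
    show "c \<otimes> b \<odot>\<^bsub>free_module R X\<^esub> f = c \<odot>\<^bsub>free_module R X\<^esub> (b \<odot>\<^bsub>free_module R X\<^esub> f)"
      using closed[OF f] c by (simp add: free_module_simps(4) m_assoc)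
    fix g assume g: "g \<in> carrier (free_module R X)"
    show "c \<odot>\<^bsub>free_module R X\<^esub> (f \<oplus>\<^bsub>free_module R X\<^esub> g) = c \<odot>\<^bsub>free_module R X\<^esub> f \<oplus>\<^bsub>free_module R X\<^esub> c \<odot>\<^bsub>free_module R X\<^esub> g"
      using closed[OF f] closed[OF g] c by (simp add: free_module_simps(3,4) r_distr)
  qed (auto simp: free_module_simps fin_smult Pi_iff is_cring)
qed

lemma (in cring) basis_vec_closed: "w \<in> X \<Longrightarrow> basis_vec R w \<in> carrier (free_module R X)"
  by (auto simp: basis_vec_def free_module_simps)

lemma (in module) free_module_extension:
  assumes "\<And>w. w \<in> X \<Longrightarrow> \<phi> w \<in> carrier M"
  obtains g where "linear_map R (free_module R X) M g" "\<And>w. w \<in> X \<Longrightarrow> g (basis_vec R w) = \<phi> w"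
proof
  \<comment> \<open>Nothing is known of \<open>\<phi> w\<close> outside \<open>X\<close>; the value
    zero there keeps every term of the sum in the carrier.\<close>
  define h where "h w c = (if w \<in> X then c \<odot>\<^bsub>M\<^esub> \<phi> w else \<zero>\<^bsub>M\<^esub>)" for w c
  define g where "g = (\<lambda>s. finsum M (\<lambda>i. h i (s i)) {i. s i \<noteq> \<zero>\<^bsub>R\<^esub>})"
  interpret F: module R "free_module R X" by (rule R.module_free_module)
  note closed = R.free_module_closed
  show "linear_map R (free_module R X) M g"
    unfolding g_def
  proof (rule linear_map_finsum_support[OF _ F.M.a_closed F.smult_closed])
    show "h i ((s \<oplus>\<^bsub>free_module R X\<^esub> t) i) = h i (s i) \<oplus>\<^bsub>M\<^esub> h i (t i)"
      if "s \<in> carrier (free_module R X)" "t \<in> carrier (free_module R X)" for i s t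
      using closed[OF that(1)] closed[OF that(2)] by (simp add: h_def free_module_simps(3) smult_l_distr assms)
    show "h i ((c \<odot>\<^bsub>free_module R X\<^esub> s) i) = c \<odot>\<^bsub>M\<^esub> h i (s i)"
      if "c \<in> carrier R" "s \<in> carrier (free_module R X)" for i c s
      using closed[OF that(2)] that(1) by (simp add: h_def free_module_simps(4) smult_assoc1 assms)
    show "h i (s i) \<in> carrier M" if "s \<in> carrier (free_module R X)" for i s
      using closed[OF that] by (simp add: h_def assms)
  qed (auto simp: free_module_simps(1) h_def assms)
  show "g (basis_vec R w) = \<phi> w" if w: "w \<in> X" for w
  proof -
    \<comment> \<open>The sum is taken over \<open>{w}\<close> and not over the support, which is
      empty when \<open>1 = 0\<close> in the base ring.\<close>
    have "g (basis_vec R w) = finsum M (\<lambda>i. h i (basis_vec R w i)) {w}"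
      unfolding g_def
      by (rule M.finsum_support) (auto simp: basis_vec_def h_def assms)
    also have "\<dots> = \<phi> w"
      using w assms by (simp add: h_def basis_vec_def)
    finally show ?thesis .
  qed
qed

lemma (in module) free_module_unique:
  assumes "linear_map R (free_module R X) M f" "linear_map R (free_module R X) M g"
    and eq: "\<And>w. w \<in> X \<Longrightarrow> f (basis_vec R w) = g (basis_vec R w)"
    and s: "s \<in> carrier (free_module R X)"
  shows "f s = g s"
proof -
  interpret F: module R "free_module R X" by (rule R.module_free_module)
  have "finite {w. s w \<noteq> \<zero>\<^bsub>R\<^esub>}"
    using s by (simp add: free_module_simps)
  then show ?thesis
    using s
  proof (induction s rule: finite_support_induct)
    case zero
    have "f \<zero>\<^bsub>free_module R X\<^esub> = g \<zero>\<^bsub>free_module R X\<^esub>"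
      using assms(1,2) F.module_axioms module_axioms by (metis linear_map_zero)
    then show ?case by (simp add: free_module_simps(2))
  next
    case (step s w)
    have w: "w \<in> X" using step.hyps step.prems by (auto simp: free_module_simps(1))
    let ?t = "s(w := \<zero>\<^bsub>R\<^esub>)"
    have "finite {v. ?t v \<noteq> \<zero>\<^bsub>R\<^esub>}"
      by (rule finite_subset[of _ "{v. s v \<noteq> \<zero>\<^bsub>R\<^esub>}"]) (use step.prems in \<open>auto simp: free_module_simps(1)\<close>)
    then have t: "?t \<in> carrier (free_module R X)"
      using step.prems by (auto simp: free_module_simps(1))
    have c: "s w \<in> carrier R" by (rule R.free_module_closed[OF step.prems])
    have b: "basis_vec R w \<in> carrier (free_module R X)" by (rule R.basis_vec_closed[OF w])
    have "s = ?t \<oplus>\<^bsub>free_module R X\<^esub> s w \<odot>\<^bsub>free_module R X\<^esub> basis_vec R w"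
      using R.free_module_closed[OF step.prems] by (auto simp: free_module_simps(3,4) basis_vec_def)
    then have "f s = f (?t \<oplus>\<^bsub>free_module R X\<^esub> s w \<odot>\<^bsub>free_module R X\<^esub> basis_vec R w)"
      and "g s = g (?t \<oplus>\<^bsub>free_module R X\<^esub> s w \<odot>\<^bsub>free_module R X\<^esub> basis_vec R w)"
      by simp_all
    moreover have "f ?t = g ?t"
      by (rule step.IH[OF t])
    ultimately show ?case
      using eq[OF w] assms(1,2) t c b F.smult_closed by (simp add: linear_map_add linear_map_smult)
  qed
qed

section \<open>Direct sums: the module axioms and the universal property\<close>

lemma direct_sum_simps:
  "s \<in> carrier (direct_sum M) \<longleftrightarrow> (\<forall>i. s i \<in> carrier (M i)) \<and> finite {i. s i \<noteq> \<zero>\<^bsub>M i\<^esub>}"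
  "\<zero>\<^bsub>direct_sum M\<^esub> = (\<lambda>i. \<zero>\<^bsub>M i\<^esub>)"
  "s \<oplus>\<^bsub>direct_sum M\<^esub> t = (\<lambda>i. s i \<oplus>\<^bsub>M i\<^esub> t i)"
  "c \<odot>\<^bsub>direct_sum M\<^esub> s = (\<lambda>i. c \<odot>\<^bsub>M i\<^esub> s i)"
  by (auto simp: direct_sum_def)

definition summand_incl :: "('i \<Rightarrow> ('k, 'm) module) \<Rightarrow> 'i \<Rightarrow> 'm \<Rightarrow> 'i \<Rightarrow> 'm"
  where "summand_incl M i x = (\<lambda>j. if j = i then x else \<zero>\<^bsub>M j\<^esub>)"

locale module_family = cring k for k :: "('k, 'x) ring_scheme" (structure) +
  fixes M :: "'i \<Rightarrow> ('k, 'm) module"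
  assumes module_family: "module k (M i)"
begin

sublocale family: module k "M i" for i
  by (rule module_family)

lemma module_direct_sum: "module k (direct_sum M)"
proof -
  have fin_add: "finite {i. s i \<oplus>\<^bsub>M i\<^esub> t i \<noteq> \<zero>\<^bsub>M i\<^esub>}"
    if "finite {i. s i \<noteq> \<zero>\<^bsub>M i\<^esub>}" "finite {i. t i \<noteq> \<zero>\<^bsub>M i\<^esub>}" for s t
    by (rule finite_subset[OF _ finite_UnI[OF that]]) auto
  have fin_smult: "finite {i. c \<odot>\<^bsub>M i\<^esub> s i \<noteq> \<zero>\<^bsub>M i\<^esub>}"
    if "finite {i. s i \<noteq> \<zero>\<^bsub>M i\<^esub>}" "c \<in> carrier k" for s c
    by (rule finite_subset[OF _ that(1)]) (use that(2) in auto)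
  have fin_minus: "finite {i. \<ominus>\<^bsub>M i\<^esub> s i \<noteq> \<zero>\<^bsub>M i\<^esub>}"
    if "finite {i. s i \<noteq> \<zero>\<^bsub>M i\<^esub>}" for s
    by (rule finite_subset[OF _ that(1)]) auto
  show ?thesis
  proof (rule moduleI)
    show "abelian_group (direct_sum M)"
    proof (rule abelian_groupI)
      fix s assume s: "s \<in> carrier (direct_sum M)"
      then have "(\<lambda>i. \<ominus>\<^bsub>M i\<^esub> s i) \<in> carrier (direct_sum M)"
        by (auto simp: direct_sum_simps fin_minus)
      moreover have "(\<lambda>i. \<ominus>\<^bsub>M i\<^esub> s i) \<oplus>\<^bsub>direct_sum M\<^esub> s = \<zero>\<^bsub>direct_sum M\<^esub>"
        using s by (auto simp: direct_sum_simps family.M.l_neg)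
      ultimately show "\<exists>t\<in>carrier (direct_sum M). t \<oplus>\<^bsub>direct_sum M\<^esub> s = \<zero>\<^bsub>direct_sum M\<^esub>"
        by blast
    qed (auto simp: direct_sum_simps fin_add family.M.a_ac)
  qed (auto simp: direct_sum_simps fin_smult is_cring family.smult_l_distr family.smult_r_distr
      family.smult_assoc1)
qed

lemma linear_map_summand_incl: "linear_map k (M i) (direct_sum M) (summand_incl M i)"
proof (rule linear_mapI)
  fix x assume "x \<in> carrier (M i)"
  moreover have "finite {j. summand_incl M i x j \<noteq> \<zero>\<^bsub>M j\<^esub>}"
    by (rule finite_subset[of _ "{i}"]) (auto simp: summand_incl_def)
  ultimately show "summand_incl M i x \<in> carrier (direct_sum M)"
    by (auto simp: direct_sum_simps summand_incl_def)
qed (auto simp: direct_sum_simps summand_incl_def)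

lemma direct_sum_extension:
  assumes N: "module k N" and g: "\<And>i. linear_map k (M i) N (g i)"
  obtains h where "linear_map k (direct_sum M) N h"
    "\<And>i x. x \<in> carrier (M i) \<Longrightarrow> h (summand_incl M i x) = g i x"
proof
  define h where "h = (\<lambda>s. finsum N (\<lambda>i. g i (s i)) {i. s i \<noteq> \<zero>\<^bsub>M i\<^esub>})"
  interpret N: module k N by fact
  interpret D: module k "direct_sum M" by (rule module_direct_sum)
  have zero: "g i \<zero>\<^bsub>M i\<^esub> = \<zero>\<^bsub>N\<^esub>" for i
    by (rule linear_map_zero[OF module_family N g])
  show "linear_map k (direct_sum M) N h"
    unfolding h_def
    by (rule N.linear_map_finsum_support[OF _ D.M.a_closed D.smult_closed])
      (auto simp: direct_sum_simps zero linear_map_add[OF g] linear_map_smult[OF g]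
        intro: linear_map_closed[OF g])
  show "h (summand_incl M i x) = g i x" if x: "x \<in> carrier (M i)" for i x
  proof -
    have "h (summand_incl M i x) = finsum N (\<lambda>j. g j (summand_incl M i x j)) {i}"
      unfolding h_def
      by (rule N.M.finsum_support) (use linear_map_closed[OF g x] in \<open>auto simp: summand_incl_def zero\<close>)
    also have "\<dots> = g i x"
      using linear_map_closed[OF g x] by (simp add: summand_incl_def)
    finally show ?thesis .
  qed
qed

lemma direct_sum_unique:
  assumes N: "module k N" and fg: "linear_map k (direct_sum M) N f" "linear_map k (direct_sum M) N g"
    and eq: "\<And>i x. x \<in> carrier (M i) \<Longrightarrow> f (summand_incl M i x) = g (summand_incl M i x)"
    and s: "s \<in> carrier (direct_sum M)"
  shows "f s = g s"
proof -
  interpret N: module k N by fact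
  interpret D: module k "direct_sum M" by (rule module_direct_sum)
  have "finite {i. s i \<noteq> \<zero>\<^bsub>M i\<^esub>}"
    using s by (simp add: direct_sum_simps)
  then show ?thesis
    using s
  proof (induction s rule: finite_support_induct)
    case zero
    have "f \<zero>\<^bsub>direct_sum M\<^esub> = g \<zero>\<^bsub>direct_sum M\<^esub>"
      using fg D.module_axioms N by (metis linear_map_zero)
    then show ?case by (simp add: direct_sum_simps(2))
  next
    case (step s i)
    let ?t = "s(i := \<zero>\<^bsub>M i\<^esub>)"
    have "finite {j. ?t j \<noteq> \<zero>\<^bsub>M j\<^esub>}"
      by (rule finite_subset[of _ "{j. s j \<noteq> \<zero>\<^bsub>M j\<^esub>}"]) (use step.prems in \<open>auto simp: direct_sum_simps(1)\<close>)
    then have t: "?t \<in> carrier (direct_sum M)"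
      using step.prems by (auto simp: direct_sum_simps(1))
    have c: "s i \<in> carrier (M i)" using step.prems by (simp add: direct_sum_simps(1))
    have b: "summand_incl M i (s i) \<in> carrier (direct_sum M)"
      by (rule linear_map_closed[OF linear_map_summand_incl c])
    have "s = ?t \<oplus>\<^bsub>direct_sum M\<^esub> summand_incl M i (s i)"
      using step.prems by (auto simp: direct_sum_simps summand_incl_def)
    then have "f s = f (?t \<oplus>\<^bsub>direct_sum M\<^esub> summand_incl M i (s i))"
      and "g s = g (?t \<oplus>\<^bsub>direct_sum M\<^esub> summand_incl M i (s i))"
      by simp_all
    moreover have "f ?t = g ?t"
      by (rule step.IH[OF t])
    ultimately show ?case
      using eq[OF c] fg t b by (simp add: linear_map_add)
  qed
qed

end

text \<open>One predicate for words of all lengths at once. The empty word has no letter to vary, so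
  its value is unconstrained; this is the origin of the conditions \<open>w \<noteq> []\<close>
  below.\<close>

definition multilinear ::
  "('k, 'x) ring_scheme \<Rightarrow> ('k, 'a, 'y) module_scheme \<Rightarrow> ('k, 'n, 'z) module_scheme
     \<Rightarrow> ('a list \<Rightarrow> 'n) \<Rightarrow> bool"
  where "multilinear k A N \<phi> \<longleftrightarrow>
    (\<forall>u\<in>lists (carrier A). \<forall>v\<in>lists (carrier A). linear_map k A N (\<lambda>a. \<phi> (u @ a # v)))"

lemma multilinear_closed:
  assumes "multilinear k A N \<phi>" "w \<in> lists (carrier A)" "w \<noteq> []"
  shows "\<phi> w \<in> carrier N"
proof -
  obtain a v where w: "w = [] @ a # v" using assms(3) by (cases w) auto
  with assms(2) have "a \<in> carrier A" "v \<in> lists (carrier A)" by auto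
  with assms(1) w show ?thesis
    unfolding multilinear_def by (metis linear_map_closed lists.Nil)
qed

lemma multilinear_cong:
  assumes "module k A" "multilinear k A N \<phi>"
    and "\<And>w. \<lbrakk>w \<in> lists (carrier A); w \<noteq> []\<rbrakk> \<Longrightarrow> \<phi> w = \<psi> w"
  shows "multilinear k A N \<psi>"
  unfolding multilinear_def
proof (intro ballI)
  fix u v assume uv: "u \<in> lists (carrier A)" "v \<in> lists (carrier A)"
  show "linear_map k A N (\<lambda>a. \<psi> (u @ a # v))"
  proof (rule linear_map_cong[OF assms(1)])
    show "linear_map k A N (\<lambda>a. \<phi> (u @ a # v))"
      using assms(2) uv by (simp add: multilinear_def)
    show "\<phi> (u @ a # v) = \<psi> (u @ a # v)" if "a \<in> carrier A" for a
      using uv that by (intro assms(3)) simp_all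
  qed
qed

lemma multilinear_plus:
  "\<lbrakk>module k N; multilinear k A N \<phi>; multilinear k A N \<psi>\<rbrakk> \<Longrightarrow> multilinear k A N (\<lambda>w. \<phi> w \<oplus>\<^bsub>N\<^esub> \<psi> w)"
  by (simp add: multilinear_def linear_map_plus)

lemma multilinear_scale:
  "\<lbrakk>module k N; multilinear k A N \<phi>; c \<in> carrier k\<rbrakk> \<Longrightarrow> multilinear k A N (\<lambda>w. c \<odot>\<^bsub>N\<^esub> \<phi> w)"
  by (simp add: multilinear_def linear_map_scale)

section \<open>Tensor powers and their universal property\<close>

locale shuffle_module = module k A
  for k :: "('k, 'x) ring_scheme" (structure) and A :: "('k, 'a, 'y) module_scheme" (structure)
begin

text \<open>The elementary tensor inside its own tensor power, before \<open>etensor\<close> places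
  it in the direct sum.\<close>

definition letters_tensor :: "'a list \<Rightarrow> ('a list \<Rightarrow> 'k) set"
  where "letters_tensor w = tensor_relations k A (length w)
    +>\<^bsub>free_module k (words A (length w))\<^esub> basis_vec k w"

lemma free_words: "module k (free_module k (words A n))"
  by (rule R.module_free_module)

sublocale F: module k "free_module k (words A n)" for n
  by (rule free_words)

lemma basis_words: "w \<in> words A n \<Longrightarrow> basis_vec k w \<in> carrier (free_module k (words A n))"
  by (rule R.basis_vec_closed)

lemma submodule_tensor_relations:
  "submodule (tensor_relations k A n) k (free_module k (words A n))"
  unfolding tensor_relations_def Let_def
proof (rule F.submodule_gen, safe)
  fix u v a b assume "u @ a # v \<in> words A n" "b \<in> carrier A"
  then have "u @ a # v \<in> words A n" "u @ b # v \<in> words A n" "u @ (a \<oplus>\<^bsub>A\<^esub> b) # v \<in> words A n"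
    by (auto simp: words_def)
  then show "basis_vec k (u @ (a \<oplus>\<^bsub>A\<^esub> b) # v) \<ominus>\<^bsub>free_module k (words A n)\<^esub>
      (basis_vec k (u @ a # v) \<oplus>\<^bsub>free_module k (words A n)\<^esub> basis_vec k (u @ b # v))
      \<in> carrier (free_module k (words A n))"
    by (intro F.M.minus_closed F.M.a_closed basis_words)
next
  fix u v a c assume "u @ a # v \<in> words A n" and c: "c \<in> carrier k"
  then have "u @ a # v \<in> words A n" "u @ (c \<odot>\<^bsub>A\<^esub> a) # v \<in> words A n"
    by (auto simp: words_def)
  with c show "basis_vec k (u @ (c \<odot>\<^bsub>A\<^esub> a) # v) \<ominus>\<^bsub>free_module k (words A n)\<^esub>
      c \<odot>\<^bsub>free_module k (words A n)\<^esub> basis_vec k (u @ a # v) \<in> carrier (free_module k (words A n))"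
    by (intro F.M.minus_closed F.smult_closed basis_words)
qed

sublocale T: quotient_module k "free_module k (words A n)" "tensor_relations k A n" for n
  by (intro quotient_module.intro quotient_module_axioms.intro free_words submodule_tensor_relations)

lemma module_tensor_power: "module k (tensor_power k A n)"
  unfolding tensor_power_def by (rule T.module_quotient)

text \<open>The generators of \<open>tensor_relations\<close> are precisely the defects of
  additivity and homogeneity in one letter, and they vanish in the quotient.\<close>

lemma letters_tensor_linear:
  assumes "u \<in> lists (carrier A)" "v \<in> lists (carrier A)"
  shows "linear_map k A (tensor_power k A (length u + Suc (length v))) (\<lambda>a. letters_tensor (u @ a # v))"
proof -
  define n where "n = length u + Suc (length v)"
  let ?F = "free_module k (words A n)"
  have w: "u @ a # v \<in> words A n" if "a \<in> carrier A" for a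
    using that assms by (auto simp: words_def n_def)
  note b = basis_words[OF w]
  have t: "letters_tensor (u @ a # v) = tensor_relations k A n +>\<^bsub>?F\<^esub> basis_vec k (u @ a # v)" for a
    by (simp add: letters_tensor_def n_def)
  have "linear_map k A (tensor_power k A n) (\<lambda>a. letters_tensor (u @ a # v))"
  proof (rule linear_mapI)
    fix a assume a: "a \<in> carrier A"
    show "letters_tensor (u @ a # v) \<in> carrier (tensor_power k A n)"
      using b[OF a] by (auto simp: t tensor_power_def T.carrier_quotient)
    fix a' assume a': "a' \<in> carrier A"
    have "basis_vec k (u @ (a \<oplus>\<^bsub>A\<^esub> a') # v) \<ominus>\<^bsub>?F\<^esub> (basis_vec k (u @ a # v) \<oplus>\<^bsub>?F\<^esub> basis_vec k (u @ a' # v))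
        \<in> tensor_relations k A n"
      unfolding tensor_relations_def Let_def
      using w[OF a] a' by (intro subsetD[OF gen_submodule_superset]) blast
    then have "letters_tensor (u @ (a \<oplus>\<^bsub>A\<^esub> a') # v)
        = tensor_relations k A n +>\<^bsub>?F\<^esub> (basis_vec k (u @ a # v) \<oplus>\<^bsub>?F\<^esub> basis_vec k (u @ a' # v))"
      unfolding t using a a' b by (subst T.coset_eq_iff) auto
    then show "letters_tensor (u @ (a \<oplus>\<^bsub>A\<^esub> a') # v)
        = letters_tensor (u @ a # v) \<oplus>\<^bsub>tensor_power k A n\<^esub> letters_tensor (u @ a' # v)"
      unfolding t tensor_power_def using a a' b by (simp add: T.quotient_simps)
  next
    fix c a assume c: "c \<in> carrier k" and a: "a \<in> carrier A"
    have "basis_vec k (u @ (c \<odot>\<^bsub>A\<^esub> a) # v) \<ominus>\<^bsub>?F\<^esub> c \<odot>\<^bsub>?F\<^esub> basis_vec k (u @ a # v)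
        \<in> tensor_relations k A n"
      unfolding tensor_relations_def Let_def
      using w[OF a] c by (intro subsetD[OF gen_submodule_superset]) blast
    then have "letters_tensor (u @ (c \<odot>\<^bsub>A\<^esub> a) # v)
        = tensor_relations k A n +>\<^bsub>?F\<^esub> (c \<odot>\<^bsub>?F\<^esub> basis_vec k (u @ a # v))"
      unfolding t using a c b by (subst T.coset_eq_iff) auto
    then show "letters_tensor (u @ (c \<odot>\<^bsub>A\<^esub> a) # v)
        = c \<odot>\<^bsub>tensor_power k A n\<^esub> letters_tensor (u @ a # v)"
      unfolding t tensor_power_def using a c b by (simp add: T.quotient_simps)
  qed
  then show ?thesis by (simp add: n_def)
qed

text \<open>The exponent is \<open>Suc n\<close> because multilinearity does not even place the
  value at the empty word in the carrier.\<close>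

lemma tensor_power_extension:
  assumes N: "module k N" and \<phi>: "multilinear k A N \<phi>"
  obtains g where "linear_map k (tensor_power k A (Suc n)) N g"
    "\<And>w. w \<in> words A (Suc n) \<Longrightarrow> g (letters_tensor w) = \<phi> w"
proof -
  let ?F = "free_module k (words A (Suc n))"
  interpret N: module k N by fact
  have "\<phi> w \<in> carrier N" if "w \<in> words A (Suc n)" for w
    using \<phi> that by (intro multilinear_closed) (auto simp: words_def)
  then obtain f where f: "linear_map k ?F N f" "\<And>w. w \<in> words A (Suc n) \<Longrightarrow> f (basis_vec k w) = \<phi> w"
    using N.free_module_extension by blast
  \<comment> \<open>The kernel of \<open>f\<close> is a submodule, so it is enough that it contains
    the generators.\<close>
  have "tensor_relations k A (Suc n) \<subseteq> {x \<in> carrier ?F. f x = \<zero>\<^bsub>N\<^esub>}"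
    unfolding tensor_relations_def Let_def
  proof (rule gen_submodule_subset[OF submodule_equalizer[OF free_words N f(1) linear_map_const_zero[OF N]]], safe)
    fix u v a b assume ab: "u @ a # v \<in> words A (Suc n)" "b \<in> carrier A"
    then have w: "u @ a # v \<in> words A (Suc n)" "u @ b # v \<in> words A (Suc n)"
        "u @ (a \<oplus>\<^bsub>A\<^esub> b) # v \<in> words A (Suc n)"
      by (auto simp: words_def)
    show "basis_vec k (u @ (a \<oplus>\<^bsub>A\<^esub> b) # v) \<ominus>\<^bsub>?F\<^esub> (basis_vec k (u @ a # v) \<oplus>\<^bsub>?F\<^esub> basis_vec k (u @ b # v))
      \<in> carrier ?F"
      using w by (intro F.M.minus_closed F.M.a_closed basis_words)
    have lin: "linear_map k A N (\<lambda>a. \<phi> (u @ a # v))"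
      using \<phi> ab(1) by (auto simp: multilinear_def words_def)
    have "\<phi> (u @ (a \<oplus>\<^bsub>A\<^esub> b) # v) = \<phi> (u @ a # v) \<oplus>\<^bsub>N\<^esub> \<phi> (u @ b # v)"
      and "\<phi> (u @ a # v) \<in> carrier N" "\<phi> (u @ b # v) \<in> carrier N"
      using ab by (auto simp: words_def linear_map_add[OF lin] intro: linear_map_closed[OF lin])
    then show "f (basis_vec k (u @ (a \<oplus>\<^bsub>A\<^esub> b) # v) \<ominus>\<^bsub>?F\<^esub>
        (basis_vec k (u @ a # v) \<oplus>\<^bsub>?F\<^esub> basis_vec k (u @ b # v))) = \<zero>\<^bsub>N\<^esub>"
      using w by (simp add: linear_map_minus[OF free_words N f(1)] linear_map_add[OF f(1)] basis_words f(2)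
          a_minus_def[of N] N.M.r_neg)
  next
    fix u v a c assume a: "u @ a # v \<in> words A (Suc n)" and c: "c \<in> carrier k"
    then have w: "u @ a # v \<in> words A (Suc n)" "u @ (c \<odot>\<^bsub>A\<^esub> a) # v \<in> words A (Suc n)"
      by (auto simp: words_def)
    show "basis_vec k (u @ (c \<odot>\<^bsub>A\<^esub> a) # v) \<ominus>\<^bsub>?F\<^esub> c \<odot>\<^bsub>?F\<^esub> basis_vec k (u @ a # v) \<in> carrier ?F"
      using w c by (intro F.M.minus_closed F.smult_closed basis_words)
    have lin: "linear_map k A N (\<lambda>a. \<phi> (u @ a # v))"
      using \<phi> a by (auto simp: multilinear_def words_def)
    have "\<phi> (u @ (c \<odot>\<^bsub>A\<^esub> a) # v) = c \<odot>\<^bsub>N\<^esub> \<phi> (u @ a # v)" and "\<phi> (u @ a # v) \<in> carrier N"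
      using a c by (auto simp: words_def linear_map_smult[OF lin] intro: linear_map_closed[OF lin])
    then show "f (basis_vec k (u @ (c \<odot>\<^bsub>A\<^esub> a) # v) \<ominus>\<^bsub>?F\<^esub> c \<odot>\<^bsub>?F\<^esub> basis_vec k (u @ a # v)) = \<zero>\<^bsub>N\<^esub>"
      using w c by (simp add: linear_map_minus[OF free_words N f(1)] linear_map_smult[OF f(1)] basis_words f(2)
          a_minus_def[of N] N.M.r_neg)
  qed
  then obtain g where g: "linear_map k (tensor_power k A (Suc n)) N g"
      "\<And>x. x \<in> carrier ?F \<Longrightarrow> g (tensor_relations k A (Suc n) +>\<^bsub>?F\<^esub> x) = f x"
    unfolding tensor_power_def using T.factor_linear_map[OF N f(1)] by blast
  have "g (letters_tensor w) = \<phi> w" if "w \<in> words A (Suc n)" for w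
  proof -
    have "length w = Suc n" using that by (simp add: words_def)
    then show ?thesis using g(2)[OF basis_words[OF that]] f(2)[OF that] by (simp add: letters_tensor_def)
  qed
  with g(1) show ?thesis using that by blast
qed

lemma tensor_power_unique:
  assumes N: "module k N"
    and fg: "linear_map k (tensor_power k A n) N f" "linear_map k (tensor_power k A n) N g"
    and eq: "\<And>w. w \<in> words A n \<Longrightarrow> f (letters_tensor w) = g (letters_tensor w)"
    and x: "x \<in> carrier (tensor_power k A n)"
  shows "f x = g x"
proof -
  interpret N: module k N by fact
  let ?F = "free_module k (words A n)"
  let ?c = "\<lambda>y. tensor_relations k A n +>\<^bsub>?F\<^esub> y"
  obtain y where y: "y \<in> carrier ?F" "x = ?c y"
    using x by (auto simp: tensor_power_def T.carrier_quotient)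
  have c: "linear_map k ?F (tensor_power k A n) ?c"
    unfolding tensor_power_def by (rule T.linear_map_coset)
  have "f (?c y) = g (?c y)"
  proof (rule N.free_module_unique[OF linear_map_comp[OF c fg(1)] linear_map_comp[OF c fg(2)] _ y(1)])
    fix w assume w: "w \<in> words A n"
    then have "length w = n" by (simp add: words_def)
    then show "f (?c (basis_vec k w)) = g (?c (basis_vec k w))"
      using eq[OF w] by (simp add: letters_tensor_def)
  qed
  with y show ?thesis by simp
qed

section \<open>The shuffle module: linear extension from words, and induction on elements\<close>

sublocale S: module_family k "\<lambda>n. tensor_power k A (Suc n)"
  by (intro module_family.intro module_family_axioms.intro module_tensor_power R.is_cring)

lemma module_Sh_module: "module k (Sh_module k A)"
  unfolding Sh_module_def by (rule S.module_direct_sum)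

lemma etensor_eq_summand_incl:
  "length w = Suc n \<Longrightarrow> etensor k A w = summand_incl (\<lambda>n. tensor_power k A (Suc n)) n (letters_tensor w)"
  by (rule ext) (auto simp: etensor_def summand_incl_def letters_tensor_def)

lemma multilinear_etensor: "multilinear k A (Sh_module k A) (etensor k A)"
  unfolding multilinear_def
proof (intro ballI)
  fix u v assume uv: "u \<in> lists (carrier A)" "v \<in> lists (carrier A)"
  let ?n = "length u + length v"
  have "linear_map k A (tensor_power k A (Suc ?n)) (\<lambda>a. letters_tensor (u @ a # v))"
    using letters_tensor_linear[OF uv] by simp
  from linear_map_comp[OF this S.linear_map_summand_incl]
  show "linear_map k A (Sh_module k A) (\<lambda>a. etensor k A (u @ a # v))"
    by (simp add: Sh_module_def etensor_eq_summand_incl[of _ ?n])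
qed

lemma etensor_closed [intro]:
  "\<lbrakk>w \<in> lists (carrier A); w \<noteq> []\<rbrakk> \<Longrightarrow> etensor k A w \<in> carrier (Sh_module k A)"
  by (rule multilinear_closed[OF multilinear_etensor])

lemma Sh_linear_unique:
  assumes N: "module k N" and fg: "linear_map k (Sh_module k A) N f" "linear_map k (Sh_module k A) N g"
    and eq: "\<And>w. \<lbrakk>w \<in> lists (carrier A); w \<noteq> []\<rbrakk> \<Longrightarrow> f (etensor k A w) = g (etensor k A w)"
    and s: "s \<in> carrier (Sh_module k A)"
  shows "f s = g s"
proof (rule S.direct_sum_unique[OF N])
  fix n x assume x: "x \<in> carrier (tensor_power k A (Suc n))"
  let ?i = "summand_incl (\<lambda>n. tensor_power k A (Suc n)) n"
  have i: "linear_map k (tensor_power k A (Suc n)) (Sh_module k A) ?i"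
    unfolding Sh_module_def by (rule S.linear_map_summand_incl)
  show "f (?i x) = g (?i x)"
    by (rule tensor_power_unique[OF N linear_map_comp[OF i fg(1)] linear_map_comp[OF i fg(2)] _ x])
      (use eq in \<open>force simp: words_def etensor_eq_summand_incl[symmetric]\<close>)
qed (use fg s in \<open>auto simp: Sh_module_def\<close>)

text \<open>Justifies the definite description in \<open>lin_ext\<close>. Linearity and the values
  on words determine \<open>g\<close> on the carrier only; membership in \<open>extensional\<close>
  turns this into equality of functions.\<close>

lemma lin_ext_exists:
  assumes N: "module k N" and \<phi>: "multilinear k A N \<phi>"
  shows "\<exists>!g. g \<in> extensional (carrier (Sh_module k A)) \<and> linear_map k (Sh_module k A) N g
    \<and> (\<forall>w\<in>lists (carrier A). w \<noteq> [] \<longrightarrow> g (etensor k A w) = \<phi> w)"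
proof (rule ex_ex1I)
  have "\<exists>g. linear_map k (tensor_power k A (Suc n)) N g \<and> (\<forall>w\<in>words A (Suc n). g (letters_tensor w) = \<phi> w)" for n
    by (rule tensor_power_extension[OF N \<phi>]) (intro exI conjI ballI, assumption+)
  \<comment> \<open>One map for each tensor power, collected by choice into a family that the direct
    sum can glue.\<close>
  then obtain g where g: "\<And>n. linear_map k (tensor_power k A (Suc n)) N (g n)"
      "\<And>n w. w \<in> words A (Suc n) \<Longrightarrow> g n (letters_tensor w) = \<phi> w"
    using choice[of "\<lambda>n g. linear_map k (tensor_power k A (Suc n)) N g
      \<and> (\<forall>w\<in>words A (Suc n). g (letters_tensor w) = \<phi> w)"] by blast
  obtain h where h: "linear_map k (Sh_module k A) N h"
      "\<And>n x. x \<in> carrier (tensor_power k A (Suc n)) \<Longrightarrow>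
        h (summand_incl (\<lambda>n. tensor_power k A (Suc n)) n x) = g n x"
    by (rule S.direct_sum_extension[OF N g(1), folded Sh_module_def]) (rule that)
  have "h (etensor k A w) = \<phi> w" if w: "w \<in> lists (carrier A)" "w \<noteq> []" for w
  proof -
    obtain a v where av: "w = [] @ a # v" using w by (cases w) auto
    have "letters_tensor w \<in> carrier (tensor_power k A (Suc (length v)))"
      using linear_map_closed[OF letters_tensor_linear[of "[]" v], of a] w av by simp
    then show ?thesis
      using w av h(2) g(2)[of w "length v"] by (simp add: etensor_eq_summand_incl words_def)
  qed
  moreover have "linear_map k (Sh_module k A) N (restrict h (carrier (Sh_module k A)))"
    by (rule linear_map_cong[OF module_Sh_module h(1)]) simp
  ultimately show "\<exists>g. g \<in> extensional (carrier (Sh_module k A)) \<and> linear_map k (Sh_module k A) N g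
    \<and> (\<forall>w\<in>lists (carrier A). w \<noteq> [] \<longrightarrow> g (etensor k A w) = \<phi> w)"
    by (intro exI[of _ "restrict h (carrier (Sh_module k A))"]) (simp add: etensor_closed)
next
  fix f g
  assume f: "f \<in> extensional (carrier (Sh_module k A)) \<and> linear_map k (Sh_module k A) N f
      \<and> (\<forall>w\<in>lists (carrier A). w \<noteq> [] \<longrightarrow> f (etensor k A w) = \<phi> w)"
    and g: "g \<in> extensional (carrier (Sh_module k A)) \<and> linear_map k (Sh_module k A) N g
      \<and> (\<forall>w\<in>lists (carrier A). w \<noteq> [] \<longrightarrow> g (etensor k A w) = \<phi> w)"
  show "f = g"
    by (rule extensionalityI[of _ "carrier (Sh_module k A)"]) (use f g Sh_linear_unique[OF N] in auto)
qed

text \<open>Everything that is used about \<open>lin_ext\<close> from here on.\<close>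

lemma
  assumes N: "module k N" and \<phi>: "multilinear k A N \<phi>"
  shows linear_map_lin_ext: "linear_map k (Sh_module k A) N (lin_ext k A N \<phi>)"
    and lin_ext_etensor: "\<lbrakk>w \<in> lists (carrier A); w \<noteq> []\<rbrakk> \<Longrightarrow> lin_ext k A N \<phi> (etensor k A w) = \<phi> w"
  using theI'[OF lin_ext_exists[OF assms]] unfolding lin_ext_def by blast+

text \<open>Avoids expressing \<open>x\<close> as a sum. The elements with property \<open>Q\<close>
  form a submodule \<open>N\<close>; the projection modulo \<open>N\<close> vanishes on elementary
  tensors, hence everywhere by \<open>Sh_linear_unique\<close>, and so \<open>x\<close> lies in
  \<open>N\<close>.\<close>

lemma Sh_induct [consumes 1, case_names etensor add smult]:
  assumes x: "x \<in> carrier (Sh_module k A)"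
    and et: "\<And>w. \<lbrakk>w \<in> lists (carrier A); w \<noteq> []\<rbrakk> \<Longrightarrow> Q (etensor k A w)"
    and add: "\<And>x y. \<lbrakk>x \<in> carrier (Sh_module k A); y \<in> carrier (Sh_module k A); Q x; Q y\<rbrakk>
      \<Longrightarrow> Q (x \<oplus>\<^bsub>Sh_module k A\<^esub> y)"
    and smult: "\<And>c x. \<lbrakk>c \<in> carrier k; x \<in> carrier (Sh_module k A); Q x\<rbrakk> \<Longrightarrow> Q (c \<odot>\<^bsub>Sh_module k A\<^esub> x)"
  shows "Q x"
proof -
  interpret S: module k "Sh_module k A" by (rule module_Sh_module)
  define N where "N = {x \<in> carrier (Sh_module k A). Q x}"
  have eN: "etensor k A w \<in> N" if "w \<in> lists (carrier A)" "w \<noteq> []" for w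
    unfolding N_def using et[OF that] etensor_closed[OF that] by simp
  have "submodule N k (Sh_module k A)"
  proof (rule S.submoduleI)
    \<comment> \<open>The rule has no case for zero: it is obtained as zero times an elementary
      tensor. Negatives likewise come from the scalar \<open>-1\<close>.\<close>
    have w: "[\<zero>\<^bsub>A\<^esub>] \<in> lists (carrier A)" by simp
    show "\<zero>\<^bsub>Sh_module k A\<^esub> \<in> N"
      using smult[OF R.zero_closed etensor_closed[OF w] et[OF w]] etensor_closed[OF w] by (simp add: N_def)
    show "\<ominus>\<^bsub>Sh_module k A\<^esub> y \<in> N" if "y \<in> N" for y
      using that smult[of "\<ominus> \<one>" y] by (simp add: N_def S.smult_l_minus)
  qed (auto simp: N_def add smult)
  then interpret quotient_module k "Sh_module k A" N
    by (intro quotient_module.intro quotient_module_axioms.intro module_Sh_module)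
  have "N +>\<^bsub>Sh_module k A\<^esub> x = \<zero>\<^bsub>quotient (Sh_module k A) N\<^esub>"
  proof (rule Sh_linear_unique[OF module_quotient linear_map_coset linear_map_const_zero[OF module_quotient] _ x])
    fix w assume w: "w \<in> lists (carrier A)" "w \<noteq> []"
    then have "etensor k A w \<in> N" by (rule eN)
    then show "N +>\<^bsub>Sh_module k A\<^esub> etensor k A w = \<zero>\<^bsub>quotient (Sh_module k A) N\<^esub>"
      unfolding quotient_simps(2) by (simp only: coset.a_rcos_const coset.zero_closed)
  qed
  then have "N +>\<^bsub>Sh_module k A\<^esub> x = N"
    unfolding quotient_simps(2) by (simp only: coset.a_rcos_const coset.zero_closed)
  then have "x \<in> N"
    using coset.a_rcos_self[OF x] by (simp only:)
  then show ?thesis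
    unfolding N_def by simp
qed

end

section \<open>The shuffle product\<close>

text \<open>The notion halfway: \<open>Sh\<close> is an instance, its quotient by a differential
  Rota-Baxter ideal is another, and the latter is then promoted to an integro-differential
  algebra.\<close>

locale comm_diff_RB_algebra = comm_differential_algebra k R lam D
  for k :: "('k, 'x) ring_scheme" (structure) and R :: "('k, 'r, 'y) module_scheme" (structure)
    and lam :: 'k and D :: "'r \<Rightarrow> 'r" +
  fixes P :: "'r \<Rightarrow> 'r"
  assumes P_linear: "linear_map k R R P"
    and D_P: "x \<in> carrier R \<Longrightarrow> D (P x) = x"
    and Rota_Baxter: "\<lbrakk>x \<in> carrier R; y \<in> carrier R\<rbrakk> \<Longrightarrow>
      P x \<otimes>\<^bsub>R\<^esub> P y = P (x \<otimes>\<^bsub>R\<^esub> P y \<oplus>\<^bsub>R\<^esub> P x \<otimes>\<^bsub>R\<^esub> y \<oplus>\<^bsub>R\<^esub> lam \<odot>\<^bsub>R\<^esub> (x \<otimes>\<^bsub>R\<^esub> y))"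

text \<open>With primes for derivatives and \<open>l\<close> for the weight: the Leibniz rule gives the same value for
  \<open>(a b) (x y)\<close> and for \<open>(a x) (b y)\<close>.\<close>

lemma (in cring) derivation_product:
  assumes "a \<in> carrier R" "a' \<in> carrier R" "b \<in> carrier R" "b' \<in> carrier R"
    "x \<in> carrier R" "x' \<in> carrier R" "y \<in> carrier R" "y' \<in> carrier R" "l \<in> carrier R"
  shows "(a' \<otimes> b \<oplus> a \<otimes> b' \<oplus> l \<otimes> (a' \<otimes> b')) \<otimes> (x \<otimes> y) \<oplus> (a \<otimes> b) \<otimes> (x' \<otimes> y \<oplus> x \<otimes> y' \<oplus> l \<otimes> (x' \<otimes> y'))
      \<oplus> l \<otimes> ((a' \<otimes> b \<oplus> a \<otimes> b' \<oplus> l \<otimes> (a' \<otimes> b')) \<otimes> (x' \<otimes> y \<oplus> x \<otimes> y' \<oplus> l \<otimes> (x' \<otimes> y')))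
    = (a' \<otimes> x \<oplus> a \<otimes> x' \<oplus> l \<otimes> (a' \<otimes> x')) \<otimes> (b \<otimes> y) \<oplus> (a \<otimes> x) \<otimes> (b' \<otimes> y \<oplus> b \<otimes> y' \<oplus> l \<otimes> (b' \<otimes> y'))
      \<oplus> l \<otimes> ((a' \<otimes> x \<oplus> a \<otimes> x' \<oplus> l \<otimes> (a' \<otimes> x')) \<otimes> (b' \<otimes> y \<oplus> b \<otimes> y' \<oplus> l \<otimes> (b' \<otimes> y')))"
  using assms by (simp add: l_distr r_distr a_ac m_ac)

locale shuffle_algebra = comm_differential_algebra k A lam d
  for k :: "('k, 'x) ring_scheme" (structure) and A :: "('k, 'a, 'y) module_scheme" (structure)
    and lam :: 'k and d :: "'a \<Rightarrow> 'a"
begin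

sublocale shuffle_module k A
  by (rule shuffle_module.intro) (rule module)

abbreviation "V \<equiv> Sh_module k A"
abbreviation "S \<equiv> Sh k A lam"
abbreviation "e \<equiv> etensor k A"

sublocale V: module k V
  by (rule module_Sh_module)

lemma Sh_simps [simp]:
  "carrier S = carrier V" "(\<oplus>\<^bsub>S\<^esub>) = (\<oplus>\<^bsub>V\<^esub>)" "\<zero>\<^bsub>S\<^esub> = \<zero>\<^bsub>V\<^esub>" "(\<odot>\<^bsub>S\<^esub>) = (\<odot>\<^bsub>V\<^esub>)"
  "\<one>\<^bsub>S\<^esub> = e [\<one>\<^bsub>A\<^esub>]"
  by (simp_all add: Sh_def)

lemma e_linear: "\<lbrakk>u \<in> lists (carrier A); v \<in> lists (carrier A)\<rbrakk> \<Longrightarrow> linear_map k A V (\<lambda>a. e (u @ a # v))"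
  using multilinear_etensor by (simp add: multilinear_def)

lemma e_add:
  assumes "a \<in> carrier A" "b \<in> carrier A" "v \<in> lists (carrier A)"
  shows "e ((a \<oplus>\<^bsub>A\<^esub> b) # v) = e (a # v) \<oplus>\<^bsub>V\<^esub> e (b # v)"
  using linear_map_add[OF e_linear[of "[]" v] assms(1,2)] assms(3) by simp

lemma e_smult:
  assumes "a \<in> carrier A" "c \<in> carrier k" "v \<in> lists (carrier A)"
  shows "e ((c \<odot>\<^bsub>A\<^esub> a) # v) = c \<odot>\<^bsub>V\<^esub> e (a # v)"
  using linear_map_smult[OF e_linear[of "[]" v] assms(2,1)] assms(3) by simp

lemma e_zero: "v \<in> lists (carrier A) \<Longrightarrow> e (\<zero>\<^bsub>A\<^esub> # v) = \<zero>\<^bsub>V\<^esub>"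
  using linear_map_zero[OF module V.module_axioms e_linear[of "[]" v]] by simp

lemma e_closed [simp]: "\<lbrakk>a \<in> carrier A; v \<in> lists (carrier A)\<rbrakk> \<Longrightarrow> e (a # v) \<in> carrier V"
  by (intro etensor_closed) auto

lemma multilinear_prefix:
  assumes "a \<in> carrier A"
  shows "multilinear k A V (\<lambda>w. e (a # w))"
  unfolding multilinear_def using e_linear[of "a # u" v for u v] assms by simp

lemma prefix_linear: "a \<in> carrier A \<Longrightarrow> linear_map k V V (tensor_prefix k A a)"
  unfolding tensor_prefix_def by (rule linear_map_lin_ext[OF V.module_axioms multilinear_prefix])

lemma prefix_e [simp]:
  "\<lbrakk>a \<in> carrier A; w \<in> lists (carrier A); w \<noteq> []\<rbrakk> \<Longrightarrow> tensor_prefix k A a (e w) = e (a # w)"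
  unfolding tensor_prefix_def by (rule lin_ext_etensor[OF V.module_axioms multilinear_prefix])

lemma prefix_closed [simp]:
  "\<lbrakk>a \<in> carrier A; x \<in> carrier V\<rbrakk> \<Longrightarrow> tensor_prefix k A a x \<in> carrier V"
  by (rule linear_map_closed[OF prefix_linear])

lemma prefix_add:
  "\<lbrakk>a \<in> carrier A; x \<in> carrier V; y \<in> carrier V\<rbrakk> \<Longrightarrow>
    tensor_prefix k A a (x \<oplus>\<^bsub>V\<^esub> y) = tensor_prefix k A a x \<oplus>\<^bsub>V\<^esub> tensor_prefix k A a y"
  by (rule linear_map_add[OF prefix_linear])

lemma prefix_smult:
  "\<lbrakk>a \<in> carrier A; c \<in> carrier k; x \<in> carrier V\<rbrakk> \<Longrightarrow>
    tensor_prefix k A a (c \<odot>\<^bsub>V\<^esub> x) = c \<odot>\<^bsub>V\<^esub> tensor_prefix k A a x"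
  by (rule linear_map_smult[OF prefix_linear])

lemma smult_comm: "\<lbrakk>b \<in> carrier k; c \<in> carrier k; x \<in> carrier V\<rbrakk> \<Longrightarrow> b \<odot>\<^bsub>V\<^esub> (c \<odot>\<^bsub>V\<^esub> x) = c \<odot>\<^bsub>V\<^esub> (b \<odot>\<^bsub>V\<^esub> x)"
  by (simp add: V.smult_assoc1[symmetric] R.m_comm)

text \<open>Linearity in the prefixed letter, whereas \<open>prefix_linear\<close> concerns the
  tensor. The first letters of two shuffled words enter the result through this argument.\<close>

lemma prefix_linear_letter:
  assumes x: "x \<in> carrier V"
  shows "linear_map k A V (\<lambda>a. tensor_prefix k A a x)"
  using x
proof (induction rule: Sh_induct)
  case (etensor w)
  then have "linear_map k A V (\<lambda>a. e (a # w))"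
    using e_linear[of "[]" w] by simp
  then show ?case
    by (rule linear_map_cong[OF module]) (use etensor in simp)
next
  case (add x y)
  show ?case
    by (rule linear_map_cong[OF module linear_map_plus[OF V.module_axioms add.IH]])
      (use add.hyps in \<open>simp add: prefix_add\<close>)
next
  case (smult c x)
  show ?case
    by (rule linear_map_cong[OF module linear_map_scale[OF V.module_axioms smult.IH smult.hyps(1)]])
      (use smult.hyps in \<open>simp add: prefix_smult\<close>)
qed

section \<open>The shuffle of two words: induction, commutativity, multilinearity\<close>

lemma shuffle_letter_right: "shuffle k A lam (a # u) [b] = e ((a \<otimes>\<^bsub>A\<^esub> b) # u)"
  by (cases u) simp_all

lemma shuffle_Cons:
  assumes "u \<noteq> []" "v \<noteq> []"
  shows "shuffle k A lam (a # u) (b # v) = tensor_prefix k A (a \<otimes>\<^bsub>A\<^esub> b)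
    (shuffle k A lam u (\<one>\<^bsub>A\<^esub> # v) \<oplus>\<^bsub>V\<^esub> shuffle k A lam (\<one>\<^bsub>A\<^esub> # u) v \<oplus>\<^bsub>V\<^esub> lam \<odot>\<^bsub>V\<^esub> shuffle k A lam u v)"
  using assms by (cases u; cases v) simp_all

text \<open>Two of the recursive calls insert a letter \<open>1\<close>, so one of the words keeps
  its length. The sum of the lengths drops in all three calls.\<close>

lemma shuffle_induct [consumes 4, case_names letter_left letter_right Cons]:
  assumes "u \<in> lists (carrier A)" "v \<in> lists (carrier A)" "u \<noteq> []" "v \<noteq> []"
    and "\<And>a b v. \<lbrakk>a \<in> carrier A; b \<in> carrier A; v \<in> lists (carrier A)\<rbrakk> \<Longrightarrow> Q [a] (b # v)"
    and "\<And>a b u. \<lbrakk>a \<in> carrier A; b \<in> carrier A; u \<in> lists (carrier A); u \<noteq> []\<rbrakk> \<Longrightarrow> Q (a # u) [b]"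
    and "\<And>a b u v. \<lbrakk>a \<in> carrier A; b \<in> carrier A; u \<in> lists (carrier A); v \<in> lists (carrier A);
      u \<noteq> []; v \<noteq> []; Q u (\<one>\<^bsub>A\<^esub> # v); Q (\<one>\<^bsub>A\<^esub> # u) v; Q u v\<rbrakk> \<Longrightarrow> Q (a # u) (b # v)"
  shows "Q u v"
  using assms(1-4)
proof (induction "length u + length v" arbitrary: u v rule: less_induct)
  case less
  obtain a u' b v' where uv: "u = a # u'" "v = b # v'"
    using less.prems by (cases u; cases v) auto
  with less.prems have c: "a \<in> carrier A" "b \<in> carrier A" "u' \<in> lists (carrier A)" "v' \<in> lists (carrier A)"
    by auto
  show ?case
  proof (cases "u' = [] \<or> v' = []")
    case True
    then show ?thesis
      unfolding uv using assms(5)[OF c(1,2,4)] assms(6)[OF c(1,2,3)] assms(5)[OF c(1,2), of "[]"]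
      by (cases "u' = []") auto
  next
    case False
    then show ?thesis
      unfolding uv using c uv by (intro assms(7) less.hyps) auto
  qed
qed

lemma shuffle_closed [simp]:
  assumes "u \<in> lists (carrier A)" "v \<in> lists (carrier A)"
  shows "shuffle k A lam u v \<in> carrier V"
proof (cases "u = [] \<or> v = []")
  case True
  then show ?thesis by (cases u; cases v) auto
next
  case False
  with assms have uv: "u \<in> lists (carrier A)" "v \<in> lists (carrier A)" "u \<noteq> []" "v \<noteq> []" by auto
  then show ?thesis
  proof (induction rule: shuffle_induct)
    case (Cons a b u v)
    then show ?case by (simp add: shuffle_Cons weight_closed del: shuffle.simps)
  qed (auto simp: shuffle_letter_right)
qed

text \<open>Exchanging the factors swaps the first two recursive terms and preserves the
  third.\<close>

lemma shuffle_comm: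
  assumes "u \<in> lists (carrier A)" "v \<in> lists (carrier A)" "u \<noteq> []" "v \<noteq> []"
  shows "shuffle k A lam u v = shuffle k A lam v u"
  using assms
proof (induction rule: shuffle_induct)
  case (letter_left a b v)
  then show ?case by (simp add: shuffle_letter_right m_comm)
next
  case (letter_right a b u)
  then show ?case by (simp add: shuffle_letter_right m_comm)
next
  case (Cons a b u v)
  then show ?case
    by (simp add: shuffle_Cons weight_closed m_comm V.M.a_ac del: shuffle.simps)
qed

text \<open>If the varied letter comes first, it occurs only in the product of the two leading
  letters. Otherwise it sits inside the recursive terms, which are covered by induction on the total
  length.\<close>

lemma multilinear_shuffle_left:
  assumes "v \<in> lists (carrier A)" "v \<noteq> []"
  shows "multilinear k A V (\<lambda>u. shuffle k A lam u v)"
proof -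
  have "linear_map k A V (\<lambda>a. shuffle k A lam (p @ a # q) v)"
    if "p \<in> lists (carrier A)" "q \<in> lists (carrier A)" for p q
    using that assms
  proof (induction "length p + length q + length v" arbitrary: p q v rule: less_induct)
    case less
    obtain b v' where v: "v = b # v'" using less.prems by (cases v) auto
    with less.prems have b: "b \<in> carrier A" and v': "v' \<in> lists (carrier A)" by auto
    have mb: "linear_map k A A (\<lambda>a. a \<otimes>\<^bsub>A\<^esub> b)"
      by (rule linear_mapI) (use b in \<open>auto simp: l_distr smult_assoc2\<close>)
    show ?case
    proof (cases p)
      case Nil
      show ?thesis
      proof (cases "q = [] \<or> v' = []")
        case True
        \<comment> \<open>At least one of the tails is empty; \<open>r\<close> is what the two leave
          together.\<close>
        define r where "r = (if q = [] then v' else q)"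
        have r: "r \<in> lists (carrier A)" using less.prems v' by (simp add: r_def)
        have "shuffle k A lam (p @ a # q) v = e ((a \<otimes>\<^bsub>A\<^esub> b) # r)" for a
          using True Nil v by (auto simp: r_def shuffle_letter_right)
        with linear_map_comp[OF mb e_linear[of "[]" r]] r show ?thesis by simp
      next
        case False
        \<comment> \<open>The part of the shuffle that does not contain the varied letter.\<close>
        define X where "X = shuffle k A lam q (\<one>\<^bsub>A\<^esub> # v') \<oplus>\<^bsub>V\<^esub> shuffle k A lam (\<one>\<^bsub>A\<^esub> # q) v'
          \<oplus>\<^bsub>V\<^esub> lam \<odot>\<^bsub>V\<^esub> shuffle k A lam q v'"
        have X: "X \<in> carrier V"
          unfolding X_def using less.prems v' by (intro V.M.a_closed V.smult_closed shuffle_closed weight_closed) auto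
        have "shuffle k A lam (p @ a # q) v = tensor_prefix k A (a \<otimes>\<^bsub>A\<^esub> b) X" for a
          using False Nil v by (simp add: X_def shuffle_Cons del: shuffle.simps)
        with linear_map_comp[OF mb prefix_linear_letter[OF X]] show ?thesis by simp
      qed
    next
      case (Cons c p')
      then have c: "c \<in> carrier A" and p': "p' \<in> lists (carrier A)" using less.prems by auto
      show ?thesis
      proof (cases "v' = []")
        case True
        have "shuffle k A lam (p @ a # q) v = e (((c \<otimes>\<^bsub>A\<^esub> b) # p') @ a # q)" for a
          using True Cons v by (simp add: shuffle_letter_right)
        then show ?thesis
          using e_linear[of "(c \<otimes>\<^bsub>A\<^esub> b) # p'" q] p' c b less.prems by simp
      next
        case False
        have 1: "linear_map k A V (\<lambda>a. shuffle k A lam (p' @ a # q) (\<one>\<^bsub>A\<^esub> # v'))"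
          by (rule less.hyps) (use less.prems p' v' v Cons in auto)
        \<comment> \<open>Here \<open>1 # p'\<close> is as long as \<open>p\<close>, and the
          decrease comes from \<open>v'\<close> replacing \<open>v\<close>.\<close>
        have 2: "linear_map k A V (\<lambda>a. shuffle k A lam (\<one>\<^bsub>A\<^esub> # p' @ a # q) v')"
          using less.hyps[of "\<one>\<^bsub>A\<^esub> # p'" q v'] less.prems p' v' v Cons False by simp
        have 3: "linear_map k A V (\<lambda>a. shuffle k A lam (p' @ a # q) v')"
          by (rule less.hyps) (use less.prems p' v' v Cons False in auto)
        have "linear_map k A V (\<lambda>a. tensor_prefix k A (c \<otimes>\<^bsub>A\<^esub> b)
          (shuffle k A lam (p' @ a # q) (\<one>\<^bsub>A\<^esub> # v') \<oplus>\<^bsub>V\<^esub> shuffle k A lam (\<one>\<^bsub>A\<^esub> # p' @ a # q) v'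
            \<oplus>\<^bsub>V\<^esub> lam \<odot>\<^bsub>V\<^esub> shuffle k A lam (p' @ a # q) v'))"
          using b c by (intro linear_map_comp[OF _ prefix_linear] linear_map_plus[OF V.module_axioms]
              linear_map_scale[OF V.module_axioms] 1 2 3 weight_closed) auto
        then show ?thesis
          using Cons v False by (simp add: shuffle_Cons del: shuffle.simps)
      qed
    qed
  qed
  then show ?thesis by (simp add: multilinear_def)
qed

lemma multilinear_shuffle_right:
  assumes u: "u \<in> lists (carrier A)" "u \<noteq> []"
  shows "multilinear k A V (\<lambda>v. shuffle k A lam u v)"
  unfolding multilinear_def
proof (intro ballI)
  fix p q assume pq: "p \<in> lists (carrier A)" "q \<in> lists (carrier A)"
  with multilinear_shuffle_left[OF u]
  have "linear_map k A V (\<lambda>a. shuffle k A lam (p @ a # q) u)"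
    by (simp add: multilinear_def)
  then show "linear_map k A V (\<lambda>a. shuffle k A lam u (p @ a # q))"
    by (rule linear_map_cong[OF module]) (use u pq in \<open>simp add: shuffle_comm\<close>)
qed

section \<open>The product on the shuffle module\<close>

lemma inner_linear:
  "\<lbrakk>u \<in> lists (carrier A); u \<noteq> []\<rbrakk> \<Longrightarrow> linear_map k V V (lin_ext k A V (shuffle k A lam u))"
  by (rule linear_map_lin_ext[OF V.module_axioms multilinear_shuffle_right])

lemma inner_e:
  "\<lbrakk>u \<in> lists (carrier A); u \<noteq> []; v \<in> lists (carrier A); v \<noteq> []\<rbrakk>
    \<Longrightarrow> lin_ext k A V (shuffle k A lam u) (e v) = shuffle k A lam u v"
  by (rule lin_ext_etensor[OF V.module_axioms multilinear_shuffle_right])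

text \<open>The product nests two linear extensions, and the outer one needs multilinearity in
  \<open>u\<close> for every \<open>t\<close>. For an elementary tensor \<open>t\<close> this is
  multilinearity of \<open>shuffle\<close> on the left, and it persists under linear combinations of
  \<open>t\<close>.\<close>

lemma multilinear_outer:
  assumes t: "t \<in> carrier V"
  shows "multilinear k A V (\<lambda>u. lin_ext k A V (shuffle k A lam u) t)"
  using t
proof (induction rule: Sh_induct)
  case (etensor w)
  then show ?case
    by (intro multilinear_cong[OF module multilinear_shuffle_left[of w]]) (simp_all add: inner_e)
next
  case (add x y)
  show ?case
    by (rule multilinear_cong[OF module multilinear_plus[OF V.module_axioms add.IH]])
      (use add.hyps in \<open>simp add: linear_map_add[OF inner_linear]\<close>)
next
  case (smult c x)
  show ?case
    by (rule multilinear_cong[OF module multilinear_scale[OF V.module_axioms smult.IH smult.hyps(1)]])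
      (use smult.hyps in \<open>simp add: linear_map_smult[OF inner_linear]\<close>)
qed

lemma mult_S: "s \<otimes>\<^bsub>S\<^esub> t = lin_ext k A V (\<lambda>u. lin_ext k A V (shuffle k A lam u) t) s"
  by (simp add: Sh_def)

lemma mult_linear_left: "t \<in> carrier V \<Longrightarrow> linear_map k V V (\<lambda>s. s \<otimes>\<^bsub>S\<^esub> t)"
  unfolding mult_S by (rule linear_map_lin_ext[OF V.module_axioms multilinear_outer])

lemma mult_e_left:
  "\<lbrakk>u \<in> lists (carrier A); u \<noteq> []; t \<in> carrier V\<rbrakk> \<Longrightarrow> e u \<otimes>\<^bsub>S\<^esub> t = lin_ext k A V (shuffle k A lam u) t"
  unfolding mult_S by (rule lin_ext_etensor[OF V.module_axioms multilinear_outer])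

lemma mult_e_e:
  "\<lbrakk>u \<in> lists (carrier A); u \<noteq> []; v \<in> lists (carrier A); v \<noteq> []\<rbrakk> \<Longrightarrow> e u \<otimes>\<^bsub>S\<^esub> e v = shuffle k A lam u v"
  by (simp add: mult_e_left etensor_closed inner_e)

lemma mult_closed [simp]: "\<lbrakk>s \<in> carrier V; t \<in> carrier V\<rbrakk> \<Longrightarrow> s \<otimes>\<^bsub>S\<^esub> t \<in> carrier V"
  by (rule linear_map_closed[OF mult_linear_left])

lemma mult_add_left:
  "\<lbrakk>s \<in> carrier V; s' \<in> carrier V; t \<in> carrier V\<rbrakk> \<Longrightarrow> (s \<oplus>\<^bsub>V\<^esub> s') \<otimes>\<^bsub>S\<^esub> t = s \<otimes>\<^bsub>S\<^esub> t \<oplus>\<^bsub>V\<^esub> s' \<otimes>\<^bsub>S\<^esub> t"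
  by (rule linear_map_add[OF mult_linear_left])

lemma mult_smult_left:
  "\<lbrakk>c \<in> carrier k; s \<in> carrier V; t \<in> carrier V\<rbrakk> \<Longrightarrow> (c \<odot>\<^bsub>V\<^esub> s) \<otimes>\<^bsub>S\<^esub> t = c \<odot>\<^bsub>V\<^esub> (s \<otimes>\<^bsub>S\<^esub> t)"
  by (rule linear_map_smult[OF mult_linear_left])

lemma mult_linear_right:
  assumes s: "s \<in> carrier V"
  shows "linear_map k V V (\<lambda>t. s \<otimes>\<^bsub>S\<^esub> t)"
  using s
proof (induction rule: Sh_induct)
  case (etensor w)
  then show ?case
    by (intro linear_map_cong[OF V.module_axioms inner_linear[of w]]) (auto simp: mult_e_left)
next
  case (add x y)
  then show ?case
    by (intro linear_map_cong[OF V.module_axioms linear_map_plus[OF V.module_axioms add.IH]])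
      (auto simp: mult_add_left)
next
  case (smult c x)
  then show ?case
    by (intro linear_map_cong[OF V.module_axioms linear_map_scale[OF V.module_axioms smult.IH]])
      (auto simp: mult_smult_left)
qed

lemma mult_add_right:
  "\<lbrakk>s \<in> carrier V; t \<in> carrier V; t' \<in> carrier V\<rbrakk> \<Longrightarrow> s \<otimes>\<^bsub>S\<^esub> (t \<oplus>\<^bsub>V\<^esub> t') = s \<otimes>\<^bsub>S\<^esub> t \<oplus>\<^bsub>V\<^esub> s \<otimes>\<^bsub>S\<^esub> t'"
  by (rule linear_map_add[OF mult_linear_right])

lemma mult_smult_right:
  "\<lbrakk>c \<in> carrier k; s \<in> carrier V; t \<in> carrier V\<rbrakk> \<Longrightarrow> s \<otimes>\<^bsub>S\<^esub> (c \<odot>\<^bsub>V\<^esub> t) = c \<odot>\<^bsub>V\<^esub> (s \<otimes>\<^bsub>S\<^esub> t)"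
  by (rule linear_map_smult[OF mult_linear_right])

lemmas mult_bilinear = mult_add_left mult_add_right mult_smult_left mult_smult_right

lemma mult_comm:
  assumes s: "s \<in> carrier V" and t: "t \<in> carrier V"
  shows "s \<otimes>\<^bsub>S\<^esub> t = t \<otimes>\<^bsub>S\<^esub> s"
  using s
proof (induction rule: Sh_induct)
  case (etensor u)
  show ?case
    using t
  proof (induction rule: Sh_induct)
    case (etensor v)
    with \<open>u \<in> lists (carrier A)\<close> \<open>u \<noteq> []\<close> show ?case
      by (simp add: mult_e_e shuffle_comm)
  qed (use etensor in \<open>simp_all add: mult_bilinear etensor_closed\<close>)
qed (use t in \<open>simp_all add: mult_bilinear\<close>)

lemma mult_letter_e:
  "\<lbrakk>a \<in> carrier A; b \<in> carrier A; v \<in> lists (carrier A)\<rbrakk> \<Longrightarrow> e [a] \<otimes>\<^bsub>S\<^esub> e (b # v) = e ((a \<otimes>\<^bsub>A\<^esub> b) # v)"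
  by (simp add: mult_e_e)

lemma mult_letter_prefix:
  assumes "a \<in> carrier A" "b \<in> carrier A" "x \<in> carrier V"
  shows "e [a] \<otimes>\<^bsub>S\<^esub> tensor_prefix k A b x = tensor_prefix k A (a \<otimes>\<^bsub>A\<^esub> b) x"
  using assms(3)
  by (induction rule: Sh_induct)
    (use assms(1,2) in \<open>simp_all add: mult_letter_e mult_bilinear prefix_add prefix_smult\<close>)

lemma mult_one_left:
  assumes "x \<in> carrier V"
  shows "e [\<one>\<^bsub>A\<^esub>] \<otimes>\<^bsub>S\<^esub> x = x"
  using assms
proof (induction rule: Sh_induct)
  case (etensor w)
  then show ?case by (cases w) (auto simp: mult_letter_e)
qed (simp_all add: mult_bilinear)

text \<open>Multiplication by a letter only changes the first letter of each word, so this case of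
  associativity comes down to associativity in \<open>A\<close>, without any induction on
  lengths.\<close>

lemma mult_letter_mult:
  assumes a: "a \<in> carrier A" and x: "x \<in> carrier V" and y: "y \<in> carrier V"
  shows "(e [a] \<otimes>\<^bsub>S\<^esub> x) \<otimes>\<^bsub>S\<^esub> y = e [a] \<otimes>\<^bsub>S\<^esub> (x \<otimes>\<^bsub>S\<^esub> y)"
  using x
proof (induction rule: Sh_induct)
  case (etensor u)
  show ?case
    using y
  proof (induction rule: Sh_induct)
    case (etensor v)
    obtain b u' where u: "u = b # u'" using \<open>u \<noteq> []\<close> by (cases u) auto
    obtain c v' where v: "v = c # v'" using \<open>v \<noteq> []\<close> by (cases v) auto
    have cl: "b \<in> carrier A" "c \<in> carrier A" "u' \<in> lists (carrier A)" "v' \<in> lists (carrier A)"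
      using \<open>u \<in> lists (carrier A)\<close> \<open>v \<in> lists (carrier A)\<close> u v by auto
    have "shuffle k A lam ((a \<otimes>\<^bsub>A\<^esub> b) # u') (c # v') = e [a] \<otimes>\<^bsub>S\<^esub> shuffle k A lam (b # u') (c # v')"
    proof (cases "u' = [] \<or> v' = []")
      case True
      then show ?thesis
        using a cl by (elim disjE) (simp_all add: shuffle_letter_right mult_letter_e m_assoc)
    next
      case False
      then show ?thesis
        using a cl by (simp add: shuffle_Cons mult_letter_prefix m_assoc weight_closed del: shuffle.simps)
    qed
    then show ?case
      using a cl by (simp add: u v mult_letter_e del: shuffle.simps) (simp add: mult_e_e del: shuffle.simps)
  qed (use etensor a in \<open>simp_all add: mult_bilinear etensor_closed\<close>)
qed (use y a in \<open>simp_all add: mult_bilinear\<close>)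

section \<open>The Rota-Baxter identity and associativity\<close>

abbreviation "P \<equiv> Sh_P k A"

lemma P_linear: "linear_map k V V P"
  unfolding Sh_P_def by (rule prefix_linear) simp

lemma P_closed [simp]: "x \<in> carrier V \<Longrightarrow> P x \<in> carrier V"
  by (rule linear_map_closed[OF P_linear])

lemma P_add: "\<lbrakk>x \<in> carrier V; y \<in> carrier V\<rbrakk> \<Longrightarrow> P (x \<oplus>\<^bsub>V\<^esub> y) = P x \<oplus>\<^bsub>V\<^esub> P y"
  by (rule linear_map_add[OF P_linear])

lemma P_smult: "\<lbrakk>c \<in> carrier k; x \<in> carrier V\<rbrakk> \<Longrightarrow> P (c \<odot>\<^bsub>V\<^esub> x) = c \<odot>\<^bsub>V\<^esub> P x"
  by (rule linear_map_smult[OF P_linear])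

lemma P_e: "\<lbrakk>w \<in> lists (carrier A); w \<noteq> []\<rbrakk> \<Longrightarrow> P (e w) = e (\<one>\<^bsub>A\<^esub> # w)"
  by (simp add: Sh_P_def)

lemma e_Cons:
  "\<lbrakk>a \<in> carrier A; w \<in> lists (carrier A); w \<noteq> []\<rbrakk> \<Longrightarrow> e (a # w) = e [a] \<otimes>\<^bsub>S\<^esub> P (e w)"
  by (simp add: P_e mult_letter_e)

text \<open>On elementary tensors this is the recursive clause of \<open>shuffle\<close> for two
  words that begin with \<open>1\<close>: prefixing by \<open>1 * 1\<close> is
  \<open>P\<close>.\<close>

lemma Rota_Baxter:
  assumes x: "x \<in> carrier V" and y: "y \<in> carrier V"
  shows "P x \<otimes>\<^bsub>S\<^esub> P y = P (x \<otimes>\<^bsub>S\<^esub> P y \<oplus>\<^bsub>V\<^esub> P x \<otimes>\<^bsub>S\<^esub> y \<oplus>\<^bsub>V\<^esub> lam \<odot>\<^bsub>V\<^esub> (x \<otimes>\<^bsub>S\<^esub> y))"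
  using x
proof (induction rule: Sh_induct)
  case (etensor u)
  show ?case
    using y
  proof (induction rule: Sh_induct)
    case (etensor v)
    with \<open>u \<in> lists (carrier A)\<close> \<open>u \<noteq> []\<close> show ?case
      by (simp add: P_e mult_e_e shuffle_Cons del: shuffle.simps) (simp add: Sh_P_def)
  qed (use etensor in \<open>simp_all add: mult_bilinear P_add P_smult etensor_closed V.smult_r_distr V.M.a_ac
      weight_closed smult_comm[of lam]\<close>)
qed (use y in \<open>simp_all add: mult_bilinear P_add P_smult V.smult_r_distr V.M.a_ac weight_closed smult_comm[of lam]\<close>)

lemma mult_one_right: "x \<in> carrier V \<Longrightarrow> x \<otimes>\<^bsub>S\<^esub> e [\<one>\<^bsub>A\<^esub>] = x"
  by (simp add: mult_comm[of x] mult_one_left)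

lemma mult_letter_right:
  "\<lbrakk>a \<in> carrier A; x \<in> carrier V; y \<in> carrier V\<rbrakk> \<Longrightarrow> x \<otimes>\<^bsub>S\<^esub> (e [a] \<otimes>\<^bsub>S\<^esub> y) = e [a] \<otimes>\<^bsub>S\<^esub> (x \<otimes>\<^bsub>S\<^esub> y)"
  by (metis e_closed lists.Nil mult_closed mult_comm mult_letter_mult)

text \<open>The hypotheses are associativity for the seven triples obtained by dropping at least one
  of the three occurrences of \<open>P\<close>. Two uses of the Rota-Baxter identity turn each side
  into \<open>P\<close> of a sum of seven products, with coefficients \<open>1\<close>,
  \<open>lam\<close> and \<open>lam^2\<close>, and the hypotheses match these one by one.\<close>

lemma assoc_P:
  assumes xyz: "x \<in> carrier V" "y \<in> carrier V" "z \<in> carrier V"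
    and assoc: "(x \<otimes>\<^bsub>S\<^esub> P y) \<otimes>\<^bsub>S\<^esub> P z = x \<otimes>\<^bsub>S\<^esub> (P y \<otimes>\<^bsub>S\<^esub> P z)"
      "(P x \<otimes>\<^bsub>S\<^esub> y) \<otimes>\<^bsub>S\<^esub> P z = P x \<otimes>\<^bsub>S\<^esub> (y \<otimes>\<^bsub>S\<^esub> P z)"
      "(x \<otimes>\<^bsub>S\<^esub> y) \<otimes>\<^bsub>S\<^esub> P z = x \<otimes>\<^bsub>S\<^esub> (y \<otimes>\<^bsub>S\<^esub> P z)"
      "(P x \<otimes>\<^bsub>S\<^esub> P y) \<otimes>\<^bsub>S\<^esub> z = P x \<otimes>\<^bsub>S\<^esub> (P y \<otimes>\<^bsub>S\<^esub> z)"
      "(x \<otimes>\<^bsub>S\<^esub> P y) \<otimes>\<^bsub>S\<^esub> z = x \<otimes>\<^bsub>S\<^esub> (P y \<otimes>\<^bsub>S\<^esub> z)"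
      "(P x \<otimes>\<^bsub>S\<^esub> y) \<otimes>\<^bsub>S\<^esub> z = P x \<otimes>\<^bsub>S\<^esub> (y \<otimes>\<^bsub>S\<^esub> z)"
      "(x \<otimes>\<^bsub>S\<^esub> y) \<otimes>\<^bsub>S\<^esub> z = x \<otimes>\<^bsub>S\<^esub> (y \<otimes>\<^bsub>S\<^esub> z)"
  shows "(P x \<otimes>\<^bsub>S\<^esub> P y) \<otimes>\<^bsub>S\<^esub> P z = P x \<otimes>\<^bsub>S\<^esub> (P y \<otimes>\<^bsub>S\<^esub> P z)"
proof -
  define W where "W = x \<otimes>\<^bsub>S\<^esub> P y \<oplus>\<^bsub>V\<^esub> P x \<otimes>\<^bsub>S\<^esub> y \<oplus>\<^bsub>V\<^esub> lam \<odot>\<^bsub>V\<^esub> (x \<otimes>\<^bsub>S\<^esub> y)"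
  define W' where "W' = y \<otimes>\<^bsub>S\<^esub> P z \<oplus>\<^bsub>V\<^esub> P y \<otimes>\<^bsub>S\<^esub> z \<oplus>\<^bsub>V\<^esub> lam \<odot>\<^bsub>V\<^esub> (y \<otimes>\<^bsub>S\<^esub> z)"
  have W: "W \<in> carrier V" "W' \<in> carrier V"
    using xyz weight_closed by (simp_all add: W_def W'_def)
  have PW: "P x \<otimes>\<^bsub>S\<^esub> P y = P W" "P y \<otimes>\<^bsub>S\<^esub> P z = P W'"
    unfolding W_def W'_def using xyz by (simp_all add: Rota_Baxter)
  \<comment> \<open>Under the outer \<open>P\<close>, the elements \<open>P W\<close> and
    \<open>P W'\<close> are turned back into products, to which the hypotheses apply.\<close>
  have "W \<otimes>\<^bsub>S\<^esub> P z \<oplus>\<^bsub>V\<^esub> P W \<otimes>\<^bsub>S\<^esub> z \<oplus>\<^bsub>V\<^esub> lam \<odot>\<^bsub>V\<^esub> (W \<otimes>\<^bsub>S\<^esub> z)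
      = x \<otimes>\<^bsub>S\<^esub> P W' \<oplus>\<^bsub>V\<^esub> P x \<otimes>\<^bsub>S\<^esub> W' \<oplus>\<^bsub>V\<^esub> lam \<odot>\<^bsub>V\<^esub> (x \<otimes>\<^bsub>S\<^esub> W')"
    unfolding PW[symmetric] unfolding W_def W'_def
    using xyz weight_closed by (simp add: mult_bilinear assoc V.smult_r_distr V.M.a_ac)
  moreover have "P W \<otimes>\<^bsub>S\<^esub> P z = P (W \<otimes>\<^bsub>S\<^esub> P z \<oplus>\<^bsub>V\<^esub> P W \<otimes>\<^bsub>S\<^esub> z \<oplus>\<^bsub>V\<^esub> lam \<odot>\<^bsub>V\<^esub> (W \<otimes>\<^bsub>S\<^esub> z))"
    using W xyz by (intro Rota_Baxter)
  moreover have "P x \<otimes>\<^bsub>S\<^esub> P W' = P (x \<otimes>\<^bsub>S\<^esub> P W' \<oplus>\<^bsub>V\<^esub> P x \<otimes>\<^bsub>S\<^esub> W' \<oplus>\<^bsub>V\<^esub> lam \<odot>\<^bsub>V\<^esub> (x \<otimes>\<^bsub>S\<^esub> W'))"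
    using W xyz by (intro Rota_Baxter)
  ultimately show ?thesis
    by (simp only: PW)
qed

lemma assoc_e:
  assumes "u \<in> lists (carrier A)" "v \<in> lists (carrier A)" "w \<in> lists (carrier A)" "u \<noteq> []" "v \<noteq> []" "w \<noteq> []"
  shows "(e u \<otimes>\<^bsub>S\<^esub> e v) \<otimes>\<^bsub>S\<^esub> e w = e u \<otimes>\<^bsub>S\<^esub> (e v \<otimes>\<^bsub>S\<^esub> e w)"
  using assms
proof (induction "length u + length v + length w" arbitrary: u v w rule: less_induct)
  case less
  obtain a u' b v' c w' where eq: "u = a # u'" "v = b # v'" "w = c # w'"
    using less.prems by (cases u; cases v; cases w) auto
  with less.prems have c: "a \<in> carrier A" "b \<in> carrier A" "c \<in> carrier A"
      "u' \<in> lists (carrier A)" "v' \<in> lists (carrier A)" "w' \<in> lists (carrier A)"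
    by auto
  \<comment> \<open>The words with their first letter replaced by \<open>1\<close>. Each is the
    unit, if the tail is empty, or an image of \<open>P\<close>.\<close>
  define x y z where xyz: "x = e (\<one>\<^bsub>A\<^esub> # u')" "y = e (\<one>\<^bsub>A\<^esub> # v')" "z = e (\<one>\<^bsub>A\<^esub> # w')"
  have cl: "x \<in> carrier V" "y \<in> carrier V" "z \<in> carrier V"
    using c by (simp_all add: xyz)
  have e_eq: "e u = e [a] \<otimes>\<^bsub>S\<^esub> x" "e v = e [b] \<otimes>\<^bsub>S\<^esub> y" "e w = e [c] \<otimes>\<^bsub>S\<^esub> z"
    using c by (simp_all add: xyz eq mult_letter_e)
  have "(x \<otimes>\<^bsub>S\<^esub> y) \<otimes>\<^bsub>S\<^esub> z = x \<otimes>\<^bsub>S\<^esub> (y \<otimes>\<^bsub>S\<^esub> z)"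
  proof (cases "u' = [] \<or> v' = [] \<or> w' = []")
    case True
    then show ?thesis
      using cl by (elim disjE) (simp_all add: xyz mult_one_left mult_one_right)
  next
    case False
    have P: "x = P (e u')" "y = P (e v')" "z = P (e w')"
      using c False by (simp_all add: xyz P_e)
    \<comment> \<open>Dropping a \<open>P\<close> removes the leading \<open>1\<close> of a word, so
      each hypothesis of \<open>assoc_P\<close> concerns a smaller total length.\<close>
    show ?thesis
      unfolding P
      by (rule assoc_P; (unfold P[symmetric], unfold xyz)?; (rule less.hyps)?)
        (use c False in \<open>auto simp: eq intro!: etensor_closed\<close>)
  qed
  then show ?case
    unfolding e_eq using c cl by (simp add: mult_letter_mult mult_letter_right[of c "x \<otimes>\<^bsub>S\<^esub> y" z]
        mult_letter_right[of b x] mult_letter_right[of c y z] mult_letter_right[of c x])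
qed

lemma mult_assoc:
  assumes x: "x \<in> carrier V" and y: "y \<in> carrier V" and z: "z \<in> carrier V"
  shows "(x \<otimes>\<^bsub>S\<^esub> y) \<otimes>\<^bsub>S\<^esub> z = x \<otimes>\<^bsub>S\<^esub> (y \<otimes>\<^bsub>S\<^esub> z)"
  using x
proof (induction rule: Sh_induct)
  case (etensor u)
  show ?case
    using y
  proof (induction rule: Sh_induct)
    case (etensor v)
    show ?case
      using z
    proof (induction rule: Sh_induct)
      case (etensor w)
      with \<open>u \<in> lists (carrier A)\<close> \<open>u \<noteq> []\<close> \<open>v \<in> lists (carrier A)\<close> \<open>v \<noteq> []\<close> show ?case
        by (simp add: assoc_e)
    qed (use etensor \<open>u \<in> lists (carrier A)\<close> \<open>u \<noteq> []\<close> in \<open>simp_all add: mult_bilinear etensor_closed\<close>)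
  qed (use etensor z in \<open>simp_all add: mult_bilinear etensor_closed\<close>)
qed (use y z in \<open>simp_all add: mult_bilinear\<close>)

lemma cring_S: "cring S"
proof (rule cringI)
  show "abelian_group S"
    by (rule abelian_groupI) (use V.M.l_neg in \<open>auto simp: V.M.a_ac intro: V.M.a_inv_closed\<close>)
  show "comm_monoid S"
    by (rule comm_monoidI) (auto simp: mult_assoc mult_one_left intro: mult_comm)
qed (simp add: mult_add_left)

lemma algebra_S: "algebra k S"
  by (rule algebraI)
    (auto simp: cring_S R.is_cring V.smult_l_distr V.smult_r_distr V.smult_assoc1 mult_smult_left)

sublocale SA: algebra k S
  by (rule algebra_S)

section \<open>The derivation and its Leibniz rule\<close>

abbreviation "\<delta> \<equiv> Sh_d k A lam d"

lemma d_closed [simp]: "a \<in> carrier A \<Longrightarrow> d a \<in> carrier A"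
  by (rule linear_map_closed[OF d_linear])

lemma mult_letter_linear:
  assumes "b \<in> carrier A"
  shows "linear_map k A A (\<lambda>a. a \<otimes>\<^bsub>A\<^esub> b)" "linear_map k A A (\<lambda>a. b \<otimes>\<^bsub>A\<^esub> a)"
proof -
  show *: "linear_map k A A (\<lambda>a. a \<otimes>\<^bsub>A\<^esub> b)"
    by (rule linear_mapI) (use assms in \<open>auto simp: l_distr smult_assoc2\<close>)
  show "linear_map k A A (\<lambda>a. b \<otimes>\<^bsub>A\<^esub> a)"
    by (rule linear_map_cong[OF module *]) (use assms in \<open>simp add: m_comm\<close>)
qed

lemma multilinear_d_word: "multilinear k A V (d_word k A lam d)"
  unfolding multilinear_def
proof (intro ballI)
  fix p q assume p: "p \<in> lists (carrier A)" and q: "q \<in> lists (carrier A)"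
  note sum = linear_map_plus[OF V.module_axioms] linear_map_scale[OF V.module_axioms _ weight_closed]
  have head: "linear_map k A V (\<lambda>a. e (f a # v))" if "linear_map k A A f" "v \<in> lists (carrier A)" for f v
    using linear_map_comp[OF that(1) e_linear[of "[]" v]] that(2) by simp
  have tail: "linear_map k A V (\<lambda>a. e (b # u @ a # q))" if "b \<in> carrier A" "u \<in> lists (carrier A)" for b u
    using e_linear[of "b # u" q] that q by simp
  \<comment> \<open>\<open>d_word\<close> changes only the first two letters, so the varied letter
    is the first, the second or a later one.\<close>
  show "linear_map k A V (\<lambda>a. d_word k A lam d (p @ a # q))"
  proof (cases p)
    case Nil
    show ?thesis
    proof (cases q)
      case Nil
      then show ?thesis using head[OF d_linear, of "[]"] \<open>p = []\<close> by simp
    next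
      case (Cons b q')
      then have b: "b \<in> carrier A" "q' \<in> lists (carrier A)" using q by auto
      have "linear_map k A V (\<lambda>a. e (d a # b # q') \<oplus>\<^bsub>V\<^esub> e ((a \<otimes>\<^bsub>A\<^esub> b) # q') \<oplus>\<^bsub>V\<^esub> lam \<odot>\<^bsub>V\<^esub> e ((d a \<otimes>\<^bsub>A\<^esub> b) # q'))"
        using b by (intro sum head d_linear mult_letter_linear linear_map_comp[OF d_linear mult_letter_linear(1)]) auto
      then show ?thesis using Cons \<open>p = []\<close> by simp
    qed
  next
    case (Cons c p')
    then have c: "c \<in> carrier A" "p' \<in> lists (carrier A)" using p by auto
    show ?thesis
    proof (cases p')
      case Nil
      have "linear_map k A V (\<lambda>a. e (d c # a # q) \<oplus>\<^bsub>V\<^esub> e ((c \<otimes>\<^bsub>A\<^esub> a) # q) \<oplus>\<^bsub>V\<^esub> lam \<odot>\<^bsub>V\<^esub> e ((d c \<otimes>\<^bsub>A\<^esub> a) # q))"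
        using c q tail[of "d c" "[]"] by (intro sum head mult_letter_linear) auto
      then show ?thesis using Cons Nil by simp
    next
      case (Cons b p'')
      then have b: "b \<in> carrier A" "p'' \<in> lists (carrier A)" using c by auto
      have "linear_map k A V (\<lambda>a. e (d c # b # p'' @ a # q) \<oplus>\<^bsub>V\<^esub> e ((c \<otimes>\<^bsub>A\<^esub> b) # p'' @ a # q)
          \<oplus>\<^bsub>V\<^esub> lam \<odot>\<^bsub>V\<^esub> e ((d c \<otimes>\<^bsub>A\<^esub> b) # p'' @ a # q))"
        using c b tail[of "d c" "b # p''"] tail[of "c \<otimes>\<^bsub>A\<^esub> b" p''] tail[of "d c \<otimes>\<^bsub>A\<^esub> b" p'']
        by (intro sum) auto
      then show ?thesis using Cons \<open>p = c # p'\<close> by simp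
    qed
  qed
qed

lemma \<delta>_linear: "linear_map k V V \<delta>"
  unfolding Sh_d_def by (rule linear_map_lin_ext[OF V.module_axioms multilinear_d_word])

lemma \<delta>_e: "\<lbrakk>w \<in> lists (carrier A); w \<noteq> []\<rbrakk> \<Longrightarrow> \<delta> (e w) = d_word k A lam d w"
  unfolding Sh_d_def by (rule lin_ext_etensor[OF V.module_axioms multilinear_d_word])

lemma \<delta>_closed [simp]: "x \<in> carrier V \<Longrightarrow> \<delta> x \<in> carrier V"
  by (rule linear_map_closed[OF \<delta>_linear])

lemma \<delta>_add: "\<lbrakk>x \<in> carrier V; y \<in> carrier V\<rbrakk> \<Longrightarrow> \<delta> (x \<oplus>\<^bsub>V\<^esub> y) = \<delta> x \<oplus>\<^bsub>V\<^esub> \<delta> y"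
  by (rule linear_map_add[OF \<delta>_linear])

lemma \<delta>_smult: "\<lbrakk>c \<in> carrier k; x \<in> carrier V\<rbrakk> \<Longrightarrow> \<delta> (c \<odot>\<^bsub>V\<^esub> x) = c \<odot>\<^bsub>V\<^esub> \<delta> x"
  by (rule linear_map_smult[OF \<delta>_linear])

lemma \<delta>_letter: "a \<in> carrier A \<Longrightarrow> \<delta> (e [a]) = e [d a]"
  by (simp add: \<delta>_e)

lemma \<delta>_one: "\<delta> (e [\<one>\<^bsub>A\<^esub>]) = \<zero>\<^bsub>V\<^esub>"
  by (simp add: \<delta>_letter d_one e_zero)

text \<open>The recursive clause of \<open>d_word\<close> written with products. It is the Leibniz
  rule for a letter times \<open>P x\<close>, with \<open>x\<close> standing where
  \<open>\<delta> (P x)\<close> is expected.\<close>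

lemma \<delta>_letter_P:
  assumes a: "a \<in> carrier A" and x: "x \<in> carrier V"
  shows "\<delta> (e [a] \<otimes>\<^bsub>S\<^esub> P x) = e [d a] \<otimes>\<^bsub>S\<^esub> P x \<oplus>\<^bsub>V\<^esub> e [a] \<otimes>\<^bsub>S\<^esub> x \<oplus>\<^bsub>V\<^esub> lam \<odot>\<^bsub>V\<^esub> (e [d a] \<otimes>\<^bsub>S\<^esub> x)"
  using x
proof (induction rule: Sh_induct)
  case (etensor w)
  obtain b v where w: "w = b # v"
    using etensor(2) by (cases w) auto
  with etensor(1) have "b \<in> carrier A" "v \<in> lists (carrier A)"
    by auto
  then show ?case
    using a w by (simp add: P_e mult_letter_e \<delta>_e)
qed (use a in \<open>simp_all add: P_add P_smult mult_bilinear \<delta>_add \<delta>_smult V.smult_r_distr V.M.a_ac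
    weight_closed smult_comm[of lam]\<close>)

text \<open>The case \<open>a = 1\<close> of the preceding lemma: \<open>d 1 = 0\<close> leaves only
  the middle term.\<close>

lemma \<delta>_P:
  assumes "x \<in> carrier V"
  shows "\<delta> (P x) = x"
proof -
  have zero: "\<zero>\<^bsub>V\<^esub> \<otimes>\<^bsub>S\<^esub> y = \<zero>\<^bsub>V\<^esub>" if "y \<in> carrier V" for y
    using SA.l_null[of y] that by simp
  show ?thesis
    using \<delta>_letter_P[of "\<one>\<^bsub>A\<^esub>" x] assms by (simp add: mult_one_left d_one e_zero zero weight_closed)
qed

text \<open>The condition on \<open>x\<close> describes the cofactor left when the first letter of
  an elementary tensor is split off: the unit for a one-letter word, an image of \<open>P\<close>
  for a longer one.\<close>

lemma \<delta>_mult_letter: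
  assumes a: "a \<in> carrier A" and x: "x = e [\<one>\<^bsub>A\<^esub>] \<or> (\<exists>u\<in>carrier V. x = P u)"
  shows "\<delta> (e [a] \<otimes>\<^bsub>S\<^esub> x) = e [d a] \<otimes>\<^bsub>S\<^esub> x \<oplus>\<^bsub>V\<^esub> e [a] \<otimes>\<^bsub>S\<^esub> \<delta> x \<oplus>\<^bsub>V\<^esub> lam \<odot>\<^bsub>V\<^esub> (e [d a] \<otimes>\<^bsub>S\<^esub> \<delta> x)"
  using x
proof (elim disjE bexE)
  have zero: "y \<otimes>\<^bsub>S\<^esub> \<zero>\<^bsub>V\<^esub> = \<zero>\<^bsub>V\<^esub>" if "y \<in> carrier V" for y
    using SA.r_null[of y] that by simp
  assume "x = e [\<one>\<^bsub>A\<^esub>]"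
  then show ?thesis
    using a by (simp add: mult_one_right \<delta>_letter \<delta>_one d_one e_zero zero weight_closed)
next
  fix u assume "u \<in> carrier V" "x = P u"
  then show ?thesis using a by (simp add: \<delta>_letter_P \<delta>_P)
qed

text \<open>For two images of \<open>P\<close>, apply \<open>\<delta>\<close> to the Rota-Baxter
  identity: it cancels the outer \<open>P\<close>, and what remains is the Leibniz rule. By the
  second claim cofactors are closed under products, so that \<open>\<delta>_mult_letter\<close> can
  be used with \<open>x y\<close>.\<close>

lemma \<delta>_mult_P:
  assumes "x = e [\<one>\<^bsub>A\<^esub>] \<or> (\<exists>u\<in>carrier V. x = P u)" "y = e [\<one>\<^bsub>A\<^esub>] \<or> (\<exists>u\<in>carrier V. y = P u)"
  shows "\<delta> (x \<otimes>\<^bsub>S\<^esub> y) = \<delta> x \<otimes>\<^bsub>S\<^esub> y \<oplus>\<^bsub>V\<^esub> x \<otimes>\<^bsub>S\<^esub> \<delta> y \<oplus>\<^bsub>V\<^esub> lam \<odot>\<^bsub>V\<^esub> (\<delta> x \<otimes>\<^bsub>S\<^esub> \<delta> y)"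
    and "x \<otimes>\<^bsub>S\<^esub> y = e [\<one>\<^bsub>A\<^esub>] \<or> (\<exists>u\<in>carrier V. x \<otimes>\<^bsub>S\<^esub> y = P u)"
proof -
  have zero: "\<zero>\<^bsub>V\<^esub> \<otimes>\<^bsub>S\<^esub> y = \<zero>\<^bsub>V\<^esub>" "y \<otimes>\<^bsub>S\<^esub> \<zero>\<^bsub>V\<^esub> = \<zero>\<^bsub>V\<^esub>" if "y \<in> carrier V" for y
    using SA.l_null[of y] SA.r_null[of y] that by simp_all
  have "(\<delta> (x \<otimes>\<^bsub>S\<^esub> y) = \<delta> x \<otimes>\<^bsub>S\<^esub> y \<oplus>\<^bsub>V\<^esub> x \<otimes>\<^bsub>S\<^esub> \<delta> y \<oplus>\<^bsub>V\<^esub> lam \<odot>\<^bsub>V\<^esub> (\<delta> x \<otimes>\<^bsub>S\<^esub> \<delta> y))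
    \<and> (x \<otimes>\<^bsub>S\<^esub> y = e [\<one>\<^bsub>A\<^esub>] \<or> (\<exists>u\<in>carrier V. x \<otimes>\<^bsub>S\<^esub> y = P u))"
  proof (cases "x = e [\<one>\<^bsub>A\<^esub>] \<or> y = e [\<one>\<^bsub>A\<^esub>]")
    case True
    have "x \<in> carrier V" "y \<in> carrier V" using assms by auto
    with True show ?thesis
      using assms by (elim disjE[of "x = _" "y = _"]) (simp_all add: mult_one_left mult_one_right \<delta>_one zero weight_closed)
  next
    case False
    then obtain u v where uv: "u \<in> carrier V" "v \<in> carrier V" "x = P u" "y = P v"
      using assms by blast
    have "x \<otimes>\<^bsub>S\<^esub> y = P (u \<otimes>\<^bsub>S\<^esub> P v \<oplus>\<^bsub>V\<^esub> P u \<otimes>\<^bsub>S\<^esub> v \<oplus>\<^bsub>V\<^esub> lam \<odot>\<^bsub>V\<^esub> (u \<otimes>\<^bsub>S\<^esub> v))" (is "_ = P ?w")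
      using uv Rota_Baxter by simp
    moreover have "?w \<in> carrier V" using uv weight_closed by simp
    ultimately show ?thesis
      using uv by (auto simp: \<delta>_P V.M.a_ac)
  qed
  then show "\<delta> (x \<otimes>\<^bsub>S\<^esub> y) = \<delta> x \<otimes>\<^bsub>S\<^esub> y \<oplus>\<^bsub>V\<^esub> x \<otimes>\<^bsub>S\<^esub> \<delta> y \<oplus>\<^bsub>V\<^esub> lam \<odot>\<^bsub>V\<^esub> (\<delta> x \<otimes>\<^bsub>S\<^esub> \<delta> y)"
    and "x \<otimes>\<^bsub>S\<^esub> y = e [\<one>\<^bsub>A\<^esub>] \<or> (\<exists>u\<in>carrier V. x \<otimes>\<^bsub>S\<^esub> y = P u)"
    by blast+
qed

text \<open>Write the words as \<open>a x\<close> and \<open>b y\<close> with letters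
  \<open>a\<close>, \<open>b\<close> and cofactors \<open>x\<close>, \<open>y\<close>. The Leibniz
  rule is known for \<open>a b\<close>, for \<open>x y\<close> and for the product of these two;
  \<open>derivation_product\<close> regroups the outcome into the rule for \<open>a x\<close> times
  \<open>b y\<close>.\<close>

lemma \<delta>_mult_e:
  assumes u: "u \<in> lists (carrier A)" "u \<noteq> []" and v: "v \<in> lists (carrier A)" "v \<noteq> []"
  shows "\<delta> (e u \<otimes>\<^bsub>S\<^esub> e v) = \<delta> (e u) \<otimes>\<^bsub>S\<^esub> e v \<oplus>\<^bsub>V\<^esub> e u \<otimes>\<^bsub>S\<^esub> \<delta> (e v) \<oplus>\<^bsub>V\<^esub> lam \<odot>\<^bsub>V\<^esub> (\<delta> (e u) \<otimes>\<^bsub>S\<^esub> \<delta> (e v))"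
proof -
  have factor: "\<exists>a\<in>carrier A. \<exists>x. (x = e [\<one>\<^bsub>A\<^esub>] \<or> (\<exists>u\<in>carrier V. x = P u)) \<and> e w = e [a] \<otimes>\<^bsub>S\<^esub> x"
    if wA: "w \<in> lists (carrier A)" and w_ne: "w \<noteq> []" for w
  proof -
    obtain a w' where "w = a # w'"
      using w_ne by (cases w) auto
    with wA have w: "w = a # w'" "a \<in> carrier A" "w' \<in> lists (carrier A)"
      by auto
    show ?thesis
    proof (cases "w' = []")
      case True
      with w show ?thesis by (intro bexI[of _ a] exI[of _ "e [\<one>\<^bsub>A\<^esub>]"]) (auto simp: mult_one_right)
    next
      case False
      with w have "e w = e [a] \<otimes>\<^bsub>S\<^esub> P (e w')" by (simp add: e_Cons)
      with w False show ?thesis using etensor_closed by blast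
    qed
  qed
  obtain a x where a: "a \<in> carrier A" and x: "x = e [\<one>\<^bsub>A\<^esub>] \<or> (\<exists>u\<in>carrier V. x = P u)" and eu: "e u = e [a] \<otimes>\<^bsub>S\<^esub> x"
    using factor[OF u] by blast
  obtain b y where b: "b \<in> carrier A" and y: "y = e [\<one>\<^bsub>A\<^esub>] \<or> (\<exists>u\<in>carrier V. y = P u)" and ev: "e v = e [b] \<otimes>\<^bsub>S\<^esub> y"
    using factor[OF v] by blast
  have cl: "x \<in> carrier V" "y \<in> carrier V" using x y by auto
  \<comment> \<open>The weight as an element of the algebra: the scalar action becomes
    multiplication, and the remaining identity is one of commutative rings.\<close>
  define l where "l = lam \<odot>\<^bsub>V\<^esub> e [\<one>\<^bsub>A\<^esub>]"
  have l: "l \<in> carrier V" using weight_closed by (simp add: l_def)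
  have lam: "lam \<odot>\<^bsub>V\<^esub> z = l \<otimes>\<^bsub>S\<^esub> z" if "z \<in> carrier V" for z
    using that weight_closed by (simp add: l_def mult_smult_left mult_one_left)
  have ab: "e [d (a \<otimes>\<^bsub>A\<^esub> b)] = e [d a] \<otimes>\<^bsub>S\<^esub> e [b] \<oplus>\<^bsub>V\<^esub> e [a] \<otimes>\<^bsub>S\<^esub> e [d b] \<oplus>\<^bsub>V\<^esub> l \<otimes>\<^bsub>S\<^esub> (e [d a] \<otimes>\<^bsub>S\<^esub> e [d b])"
    using a b weight_closed by (simp add: d_mult lam[symmetric] mult_letter_e e_add e_smult)
  have "e u \<otimes>\<^bsub>S\<^esub> e v = e [a] \<otimes>\<^bsub>S\<^esub> (e [b] \<otimes>\<^bsub>S\<^esub> (x \<otimes>\<^bsub>S\<^esub> y))"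
    using a b cl by (simp add: eu ev mult_letter_mult mult_letter_right[of b x])
  also have "\<dots> = (e [a] \<otimes>\<^bsub>S\<^esub> e [b]) \<otimes>\<^bsub>S\<^esub> (x \<otimes>\<^bsub>S\<^esub> y)"
    using a b cl by (simp add: mult_letter_mult)
  also have "\<dots> = e [a \<otimes>\<^bsub>A\<^esub> b] \<otimes>\<^bsub>S\<^esub> (x \<otimes>\<^bsub>S\<^esub> y)"
    using a b by (simp only: mult_letter_e lists.Nil)
  finally have "\<delta> (e u \<otimes>\<^bsub>S\<^esub> e v) = e [d (a \<otimes>\<^bsub>A\<^esub> b)] \<otimes>\<^bsub>S\<^esub> (x \<otimes>\<^bsub>S\<^esub> y)
      \<oplus>\<^bsub>V\<^esub> (e [a] \<otimes>\<^bsub>S\<^esub> e [b]) \<otimes>\<^bsub>S\<^esub> \<delta> (x \<otimes>\<^bsub>S\<^esub> y) \<oplus>\<^bsub>V\<^esub> l \<otimes>\<^bsub>S\<^esub> (e [d (a \<otimes>\<^bsub>A\<^esub> b)] \<otimes>\<^bsub>S\<^esub> \<delta> (x \<otimes>\<^bsub>S\<^esub> y))"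
    using a b cl by (simp add: \<delta>_mult_letter[OF _ \<delta>_mult_P(2)[OF x y]] lam mult_letter_e)
  also have "\<delta> (x \<otimes>\<^bsub>S\<^esub> y) = \<delta> x \<otimes>\<^bsub>S\<^esub> y \<oplus>\<^bsub>V\<^esub> x \<otimes>\<^bsub>S\<^esub> \<delta> y \<oplus>\<^bsub>V\<^esub> l \<otimes>\<^bsub>S\<^esub> (\<delta> x \<otimes>\<^bsub>S\<^esub> \<delta> y)"
    using cl by (simp add: \<delta>_mult_P(1)[OF x y] lam)
  finally have 1: "\<delta> (e u \<otimes>\<^bsub>S\<^esub> e v) =
      (e [d a] \<otimes>\<^bsub>S\<^esub> x \<oplus>\<^bsub>V\<^esub> e [a] \<otimes>\<^bsub>S\<^esub> \<delta> x \<oplus>\<^bsub>V\<^esub> l \<otimes>\<^bsub>S\<^esub> (e [d a] \<otimes>\<^bsub>S\<^esub> \<delta> x)) \<otimes>\<^bsub>S\<^esub> (e [b] \<otimes>\<^bsub>S\<^esub> y)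
      \<oplus>\<^bsub>V\<^esub> (e [a] \<otimes>\<^bsub>S\<^esub> x) \<otimes>\<^bsub>S\<^esub> (e [d b] \<otimes>\<^bsub>S\<^esub> y \<oplus>\<^bsub>V\<^esub> e [b] \<otimes>\<^bsub>S\<^esub> \<delta> y \<oplus>\<^bsub>V\<^esub> l \<otimes>\<^bsub>S\<^esub> (e [d b] \<otimes>\<^bsub>S\<^esub> \<delta> y))
      \<oplus>\<^bsub>V\<^esub> l \<otimes>\<^bsub>S\<^esub> ((e [d a] \<otimes>\<^bsub>S\<^esub> x \<oplus>\<^bsub>V\<^esub> e [a] \<otimes>\<^bsub>S\<^esub> \<delta> x \<oplus>\<^bsub>V\<^esub> l \<otimes>\<^bsub>S\<^esub> (e [d a] \<otimes>\<^bsub>S\<^esub> \<delta> x))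
        \<otimes>\<^bsub>S\<^esub> (e [d b] \<otimes>\<^bsub>S\<^esub> y \<oplus>\<^bsub>V\<^esub> e [b] \<otimes>\<^bsub>S\<^esub> \<delta> y \<oplus>\<^bsub>V\<^esub> l \<otimes>\<^bsub>S\<^esub> (e [d b] \<otimes>\<^bsub>S\<^esub> \<delta> y)))"
    unfolding ab using a b cl l
      SA.derivation_product[of "e [a]" "e [d a]" "e [b]" "e [d b]" x "\<delta> x" y "\<delta> y" l] by simp
  have 2: "\<delta> (e u) = e [d a] \<otimes>\<^bsub>S\<^esub> x \<oplus>\<^bsub>V\<^esub> e [a] \<otimes>\<^bsub>S\<^esub> \<delta> x \<oplus>\<^bsub>V\<^esub> l \<otimes>\<^bsub>S\<^esub> (e [d a] \<otimes>\<^bsub>S\<^esub> \<delta> x)"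
    using a cl by (simp add: eu \<delta>_mult_letter[OF a x] lam)
  have 3: "\<delta> (e v) = e [d b] \<otimes>\<^bsub>S\<^esub> y \<oplus>\<^bsub>V\<^esub> e [b] \<otimes>\<^bsub>S\<^esub> \<delta> y \<oplus>\<^bsub>V\<^esub> l \<otimes>\<^bsub>S\<^esub> (e [d b] \<otimes>\<^bsub>S\<^esub> \<delta> y)"
    using b cl by (simp add: ev \<delta>_mult_letter[OF b y] lam)
  have "\<delta> (e u) \<otimes>\<^bsub>S\<^esub> \<delta> (e v) \<in> carrier V"
    using u v by (intro mult_closed \<delta>_closed etensor_closed)
  from lam[OF this] 1 show ?thesis
    unfolding 2 3 by (simp only: eu ev)
qed

lemma \<delta>_mult:
  assumes x: "x \<in> carrier V" and y: "y \<in> carrier V"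
  shows "\<delta> (x \<otimes>\<^bsub>S\<^esub> y) = \<delta> x \<otimes>\<^bsub>S\<^esub> y \<oplus>\<^bsub>V\<^esub> x \<otimes>\<^bsub>S\<^esub> \<delta> y \<oplus>\<^bsub>V\<^esub> lam \<odot>\<^bsub>V\<^esub> (\<delta> x \<otimes>\<^bsub>S\<^esub> \<delta> y)"
  using x
proof (induction rule: Sh_induct)
  case (etensor u)
  show ?case
    using y
  proof (induction rule: Sh_induct)
    case (etensor v)
    with \<open>u \<in> lists (carrier A)\<close> \<open>u \<noteq> []\<close> show ?case
      by (intro \<delta>_mult_e)
  qed (use etensor in \<open>simp_all add: mult_bilinear \<delta>_add \<delta>_smult etensor_closed V.smult_r_distr V.M.a_ac
      weight_closed smult_comm[of lam]\<close>)
qed (use y in \<open>simp_all add: mult_bilinear \<delta>_add \<delta>_smult V.smult_r_distr V.M.a_ac weight_closed smult_comm[of lam]\<close>)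

lemma linear_map_S [simp]:
  "linear_map k S N f = linear_map k V N f" "linear_map k M S g = linear_map k M V g"
  by (simp_all add: linear_map_def)

lemma diff_RB_S: "comm_diff_RB_algebra k S lam \<delta> P"
  by (intro comm_diff_RB_algebra.intro comm_differential_algebra.intro algebra_S
      comm_differential_algebra_axioms.intro comm_diff_RB_algebra_axioms.intro)
    (simp_all add: weight_closed \<delta>_linear P_linear \<delta>_mult \<delta>_one \<delta>_P Rota_Baxter)

end

section \<open>Integro-differential quotients\<close>

context comm_integro_differential_algebra
begin

text \<open>Solves the hybrid axiom for its last term, cancelling the summand \<open>u\<close> that
  occurs on both sides.\<close>

lemma P_D_eq:
  assumes "x \<in> carrier R" "y \<in> carrier R"
    and "P (D x) \<otimes>\<^bsub>R\<^esub> P (D y) = u" "P (D x) \<otimes>\<^bsub>R\<^esub> y \<oplus>\<^bsub>R\<^esub> x \<otimes>\<^bsub>R\<^esub> P (D y) = u \<oplus>\<^bsub>R\<^esub> v" "u \<in> carrier R" "v \<in> carrier R"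
  shows "P (D (x \<otimes>\<^bsub>R\<^esub> y)) = v"
proof -
  have cl: "P (D (x \<otimes>\<^bsub>R\<^esub> y)) \<in> carrier R"
    using assms by (intro linear_map_closed[OF P_linear] linear_map_closed[OF d_linear]) simp
  have "u = (u \<oplus>\<^bsub>R\<^esub> v) \<ominus>\<^bsub>R\<^esub> P (D (x \<otimes>\<^bsub>R\<^esub> y))"
    using hybrid[OF assms(1,2)] assms(3,4) by simp
  then have "u \<oplus>\<^bsub>R\<^esub> P (D (x \<otimes>\<^bsub>R\<^esub> y)) = u \<oplus>\<^bsub>R\<^esub> v"
    using cl assms(5,6) by (simp add: M.add.inv_solve_right a_minus_def)
  then show ?thesis
    using cl assms(5,6) by (simp)
qed

text \<open>Take the hybrid axiom at \<open>E x\<close> and \<open>J y\<close>. Since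
  \<open>D (E x) = 0\<close>, the left side and the first term on the right vanish; since
  \<open>J\<close> fixes \<open>J y\<close>, the second term is \<open>E x J y\<close>.\<close>

lemma P_D_eval_mult:
  assumes x: "x \<in> carrier R" and y: "y \<in> carrier R"
  shows "P (D ((x \<ominus>\<^bsub>R\<^esub> P (D x)) \<otimes>\<^bsub>R\<^esub> P (D y))) = (x \<ominus>\<^bsub>R\<^esub> P (D x)) \<otimes>\<^bsub>R\<^esub> P (D y)"
proof -
  note D = linear_map_closed[OF d_linear] and P = linear_map_closed[OF P_linear]
  let ?p = "x \<ominus>\<^bsub>R\<^esub> P (D x)"
  have cl: "?p \<in> carrier R" "P (D y) \<in> carrier R"
    using x y by (simp_all add: D P)
  have "D ?p = D x \<ominus>\<^bsub>R\<^esub> D (P (D x))"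
    using x by (intro linear_map_minus[OF module module d_linear] D P)
  then have "D ?p = \<zero>\<^bsub>R\<^esub>"
    using x by (simp add: D D_P M.r_neg a_minus_def)
  then have "P (D ?p) = \<zero>\<^bsub>R\<^esub>"
    by (simp add: linear_map_zero[OF module module P_linear])
  moreover have "P (D (P (D y))) = P (D y)"
    using y by (simp add: D_P D)
  ultimately show ?thesis
    using cl by (intro P_D_eq[of _ _ "\<zero>\<^bsub>R\<^esub>"]) simp_all
qed

text \<open>At \<open>P x\<close> and \<open>P y\<close> the hybrid axiom reads
  \<open>u = u + u - J u\<close> with \<open>u = P x P y\<close>, because \<open>D\<close> cancels
  \<open>P\<close>. So \<open>J\<close> fixes \<open>u\<close>, and expanding \<open>D u\<close> by
  the Leibniz rule gives the identity.\<close>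

lemma Rota_Baxter:
  assumes x: "x \<in> carrier R" and y: "y \<in> carrier R"
  shows "P x \<otimes>\<^bsub>R\<^esub> P y = P (x \<otimes>\<^bsub>R\<^esub> P y \<oplus>\<^bsub>R\<^esub> P x \<otimes>\<^bsub>R\<^esub> y \<oplus>\<^bsub>R\<^esub> lam \<odot>\<^bsub>R\<^esub> (x \<otimes>\<^bsub>R\<^esub> y))"
proof -
  note P = linear_map_closed[OF P_linear]
  have "P (D (P x \<otimes>\<^bsub>R\<^esub> P y)) = P x \<otimes>\<^bsub>R\<^esub> P y"
    using x y by (intro P_D_eq[of _ _ "P x \<otimes>\<^bsub>R\<^esub> P y"]) (simp_all add: P D_P)
  moreover have "D (P x \<otimes>\<^bsub>R\<^esub> P y) = x \<otimes>\<^bsub>R\<^esub> P y \<oplus>\<^bsub>R\<^esub> P x \<otimes>\<^bsub>R\<^esub> y \<oplus>\<^bsub>R\<^esub> lam \<odot>\<^bsub>R\<^esub> (x \<otimes>\<^bsub>R\<^esub> y)"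
    using x y by (simp add: d_mult P D_P)
  ultimately show ?thesis by simp
qed

end

context comm_diff_RB_algebra
begin

lemma D_closed [simp]: "x \<in> carrier R \<Longrightarrow> D x \<in> carrier R"
  by (rule linear_map_closed[OF d_linear])

lemma P_closed [simp]: "x \<in> carrier R \<Longrightarrow> P x \<in> carrier R"
  by (rule linear_map_closed[OF P_linear])

lemma P_D_mult_image:
  assumes "x \<in> carrier R" "y \<in> carrier R"
  shows "P (D (P x \<otimes>\<^bsub>R\<^esub> P y)) = P x \<otimes>\<^bsub>R\<^esub> P y"
  using assms weight_closed by (simp add: Rota_Baxter D_P)

lemma comm_integro_differential_algebraI:
  assumes eval: "\<And>x y. \<lbrakk>x \<in> carrier R; y \<in> carrier R\<rbrakk> \<Longrightarrow>
    P (D ((x \<ominus>\<^bsub>R\<^esub> P (D x)) \<otimes>\<^bsub>R\<^esub> P (D y))) = (x \<ominus>\<^bsub>R\<^esub> P (D x)) \<otimes>\<^bsub>R\<^esub> P (D y)"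
  shows "comm_integro_differential_algebra k R lam D P"
proof (intro comm_integro_differential_algebra.intro comm_differential_algebra_axioms
    comm_integro_differential_algebra_axioms.intro P_linear D_P)
  fix x y assume x: "x \<in> carrier R" and y: "y \<in> carrier R"
  \<comment> \<open>These are \<open>E x\<close>, \<open>E y\<close>, \<open>J x\<close> and
    \<open>J y\<close>.\<close>
  define p q u v where defs: "p = x \<ominus>\<^bsub>R\<^esub> P (D x)" "q = y \<ominus>\<^bsub>R\<^esub> P (D y)" "u = P (D x)" "v = P (D y)"
  have cl: "p \<in> carrier R" "q \<in> carrier R" "u \<in> carrier R" "v \<in> carrier R"
    using x y by (simp_all add: defs)
  have xy: "x = p \<oplus>\<^bsub>R\<^esub> u" "y = q \<oplus>\<^bsub>R\<^esub> v"
    using x y by (simp_all add: defs a_minus_def M.a_assoc M.l_neg)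
  have "D (z \<ominus>\<^bsub>R\<^esub> P (D z)) = \<zero>\<^bsub>R\<^esub>" if "z \<in> carrier R" for z
  proof -
    have "D (z \<ominus>\<^bsub>R\<^esub> P (D z)) = D z \<ominus>\<^bsub>R\<^esub> D (P (D z))"
      using that by (intro linear_map_minus[OF module module d_linear] D_closed P_closed)
    then show ?thesis
      using that by (simp add: D_P M.r_neg a_minus_def)
  qed
  then have D0: "D p = \<zero>\<^bsub>R\<^esub>" "D q = \<zero>\<^bsub>R\<^esub>"
    using x y by (simp_all add: defs)
  have P0: "P \<zero>\<^bsub>R\<^esub> = \<zero>\<^bsub>R\<^esub>"
    by (rule linear_map_zero[OF module module P_linear])
  \<comment> \<open>Of the four products of components, \<open>J\<close> kills this one and fixes
    the other three: two by the assumed relation, the last by the Rota-Baxter identity.\<close>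
  have pq: "P (D (p \<otimes>\<^bsub>R\<^esub> q)) = \<zero>\<^bsub>R\<^esub>"
    using cl by (simp add: d_mult D0 P0 weight_closed)
  have pv: "P (D (p \<otimes>\<^bsub>R\<^esub> v)) = p \<otimes>\<^bsub>R\<^esub> v"
    unfolding defs using x y by (rule eval)
  have uq: "P (D (u \<otimes>\<^bsub>R\<^esub> q)) = u \<otimes>\<^bsub>R\<^esub> q"
    using eval[OF y x] cl by (simp add: defs m_comm)
  have uv: "P (D (u \<otimes>\<^bsub>R\<^esub> v)) = u \<otimes>\<^bsub>R\<^esub> v"
    unfolding defs using x y by (simp add: P_D_mult_image)
  have "x \<otimes>\<^bsub>R\<^esub> y = p \<otimes>\<^bsub>R\<^esub> q \<oplus>\<^bsub>R\<^esub> p \<otimes>\<^bsub>R\<^esub> v \<oplus>\<^bsub>R\<^esub> u \<otimes>\<^bsub>R\<^esub> q \<oplus>\<^bsub>R\<^esub> u \<otimes>\<^bsub>R\<^esub> v"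
    unfolding xy using cl by (simp add: l_distr r_distr M.a_ac)
  then have J: "P (D (x \<otimes>\<^bsub>R\<^esub> y)) = p \<otimes>\<^bsub>R\<^esub> v \<oplus>\<^bsub>R\<^esub> u \<otimes>\<^bsub>R\<^esub> q \<oplus>\<^bsub>R\<^esub> u \<otimes>\<^bsub>R\<^esub> v" (is "_ = ?s")
    using cl by (simp add: linear_map_add[OF d_linear] linear_map_add[OF P_linear] pq pv uq uv)
  \<comment> \<open>The sum \<open>u y + x v\<close> contains \<open>u v\<close> twice and
    \<open>J (x y)\<close> contains it once; the difference is the left side of the hybrid
    axiom.\<close>
  have "u \<otimes>\<^bsub>R\<^esub> y \<oplus>\<^bsub>R\<^esub> x \<otimes>\<^bsub>R\<^esub> v = u \<otimes>\<^bsub>R\<^esub> v \<oplus>\<^bsub>R\<^esub> ?s"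
    unfolding xy using cl by (simp add: l_distr r_distr M.a_ac)
  then have "u \<otimes>\<^bsub>R\<^esub> y \<oplus>\<^bsub>R\<^esub> x \<otimes>\<^bsub>R\<^esub> v \<ominus>\<^bsub>R\<^esub> ?s = u \<otimes>\<^bsub>R\<^esub> v"
    using cl by (simp add: a_minus_def M.a_assoc M.r_neg)
  then show "P (D x) \<otimes>\<^bsub>R\<^esub> P (D y) = P (D x) \<otimes>\<^bsub>R\<^esub> y \<oplus>\<^bsub>R\<^esub> x \<otimes>\<^bsub>R\<^esub> P (D y) \<ominus>\<^bsub>R\<^esub> P (D (x \<otimes>\<^bsub>R\<^esub> y))"
    unfolding J by (simp add: defs(3,4))
qed

lemma diff_RB_ideal_gen:
  assumes "S \<subseteq> carrier R"
  shows "diff_RB_ideal R D P (gen_diff_RB_ideal R D P S)"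
proof -
  have "ideal (gen_diff_RB_ideal R D P S) R"
    unfolding gen_diff_RB_ideal_def
  proof (rule i_Intersect)
    \<comment> \<open>The intersection has to be taken over a nonempty family; the whole algebra
      belongs to it.\<close>
    have "diff_RB_ideal R D P (carrier R) \<and> S \<subseteq> carrier R"
      using assms by (auto simp: diff_RB_ideal_def oneideal)
    then show "{I. diff_RB_ideal R D P I \<and> S \<subseteq> I} \<noteq> {}"
      by blast
  qed (simp add: diff_RB_ideal_def)
  then show ?thesis
    by (auto simp: diff_RB_ideal_def gen_diff_RB_ideal_def)
qed

end

section \<open>Quotients by differential Rota-Baxter ideals\<close>

locale diff_RB_quotient = comm_diff_RB_algebra k R lam D P
  for k :: "('k, 'x) ring_scheme" (structure) and R :: "('k, 'r, 'y) module_scheme" (structure)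
    and lam :: 'k and D P :: "'r \<Rightarrow> 'r" +
  fixes I assumes diff_RB_ideal: "diff_RB_ideal R D P I"
begin

sublocale I: ideal I R
  using diff_RB_ideal by (simp add: diff_RB_ideal_def)

sublocale Q: quotient_module k R I
proof (intro quotient_module.intro quotient_module_axioms.intro module submoduleI)
  \<comment> \<open>A ring ideal of a unital algebra is a submodule, since scaling by
    \<open>c\<close> is multiplication by \<open>c\<close> times the unit.\<close>
  show "c \<odot>\<^bsub>R\<^esub> x \<in> I" if "c \<in> carrier k" "x \<in> I" for c x
    using I.I_l_closed[OF that(2), of "c \<odot>\<^bsub>R\<^esub> \<one>\<^bsub>R\<^esub>"] that I.a_subset smult_assoc2[of c "\<one>\<^bsub>R\<^esub>" x]
    by auto
qed (use I.a_subset in auto)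

abbreviation "Q \<equiv> quotient R I"
abbreviation "D' \<equiv> coset_map R I D"
abbreviation "P' \<equiv> coset_map R I P"

lemma D'_coset: "x \<in> carrier R \<Longrightarrow> D' (I +>\<^bsub>R\<^esub> x) = I +>\<^bsub>R\<^esub> D x"
  using diff_RB_ideal
  by (intro Q.coset_map_coset) (auto simp: linear_map_add[OF d_linear] diff_RB_ideal_def)

lemma P'_coset: "x \<in> carrier R \<Longrightarrow> P' (I +>\<^bsub>R\<^esub> x) = I +>\<^bsub>R\<^esub> P x"
  using diff_RB_ideal
  by (intro Q.coset_map_coset) (auto simp: linear_map_add[OF P_linear] diff_RB_ideal_def)

lemma mult_coset:
  "\<lbrakk>x \<in> carrier R; y \<in> carrier R\<rbrakk> \<Longrightarrow> (I +>\<^bsub>R\<^esub> x) \<otimes>\<^bsub>Q\<^esub> (I +>\<^bsub>R\<^esub> y) = I +>\<^bsub>R\<^esub> (x \<otimes>\<^bsub>R\<^esub> y)"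
  by (simp add: quotient_def FactRing_def I.rcoset_mult_add)

lemma one_coset: "\<one>\<^bsub>Q\<^esub> = I +>\<^bsub>R\<^esub> \<one>\<^bsub>R\<^esub>"
  by (simp add: quotient_def FactRing_def)

lemmas coset_simps = Q.carrier_quotient Q.quotient_simps mult_coset one_coset D'_coset P'_coset

lemma cring_quotient: "cring Q"
proof (rule cringI)
  show "abelian_group Q"
    using Q.module_quotient by (rule module.axioms(2))
  show "comm_monoid Q"
    by (rule comm_monoidI) (auto simp: coset_simps m_ac)
qed (auto simp: coset_simps l_distr)

lemma algebra_quotient: "algebra k Q"
proof -
  interpret QM: module k Q by (rule Q.module_quotient)
  show ?thesis
    by (intro algebra.intro Q.module_quotient cring_quotient algebra_axioms.intro)
      (auto simp: coset_simps smult_assoc2)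
qed

lemma comm_diff_RB_algebra_quotient: "comm_diff_RB_algebra k Q lam D' P'"
proof (intro comm_diff_RB_algebra.intro comm_differential_algebra.intro algebra_quotient
    comm_differential_algebra_axioms.intro comm_diff_RB_algebra_axioms.intro weight_closed)
  show "linear_map k Q Q D'"
    by (rule linear_mapI) (auto simp: coset_simps linear_map_add[OF d_linear] linear_map_smult[OF d_linear])
  show "linear_map k Q Q P'"
    by (rule linear_mapI) (auto simp: coset_simps linear_map_add[OF P_linear] linear_map_smult[OF P_linear])
qed (auto simp: coset_simps weight_closed d_mult d_one D_P Rota_Baxter)

lemma coset_minus:
  "\<lbrakk>x \<in> carrier R; y \<in> carrier R\<rbrakk> \<Longrightarrow> (I +>\<^bsub>R\<^esub> x) \<ominus>\<^bsub>Q\<^esub> (I +>\<^bsub>R\<^esub> y) = I +>\<^bsub>R\<^esub> (x \<ominus>\<^bsub>R\<^esub> y)"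
  by (rule linear_map_minus[OF module Q.module_quotient Q.linear_map_coset, symmetric])

text \<open>Modulo \<open>I\<close> the relation becomes the equation that the criterion
  \<open>comm_integro_differential_algebraI\<close> asks for.\<close>

lemma comm_integro_differential_algebra_quotient:
  assumes rel: "\<And>x y. \<lbrakk>x \<in> carrier R; y \<in> carrier R\<rbrakk> \<Longrightarrow>
    P (D ((x \<ominus>\<^bsub>R\<^esub> P (D x)) \<otimes>\<^bsub>R\<^esub> P (D y))) \<ominus>\<^bsub>R\<^esub> (x \<ominus>\<^bsub>R\<^esub> P (D x)) \<otimes>\<^bsub>R\<^esub> P (D y) \<in> I"
  shows "comm_integro_differential_algebra k Q lam D' P'"
proof (rule comm_diff_RB_algebra.comm_integro_differential_algebraI[OF comm_diff_RB_algebra_quotient])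
  fix X Y assume "X \<in> carrier Q" "Y \<in> carrier Q"
  then obtain x y where x: "x \<in> carrier R" "X = I +>\<^bsub>R\<^esub> x" and y: "y \<in> carrier R" "Y = I +>\<^bsub>R\<^esub> y"
    by (auto simp: Q.carrier_quotient)
  have "I +>\<^bsub>R\<^esub> P (D ((x \<ominus>\<^bsub>R\<^esub> P (D x)) \<otimes>\<^bsub>R\<^esub> P (D y))) = I +>\<^bsub>R\<^esub> ((x \<ominus>\<^bsub>R\<^esub> P (D x)) \<otimes>\<^bsub>R\<^esub> P (D y))"
    by (rule iffD2[OF Q.coset_eq_iff rel]) (use x y in simp_all)
  then show "P' (D' ((X \<ominus>\<^bsub>Q\<^esub> P' (D' X)) \<otimes>\<^bsub>Q\<^esub> P' (D' Y))) = (X \<ominus>\<^bsub>Q\<^esub> P' (D' X)) \<otimes>\<^bsub>Q\<^esub> P' (D' Y)"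
    using x y by (simp add: coset_minus mult_coset D'_coset P'_coset)
qed

end

section \<open>The quotient \<open>ID\<close> and the map from \<open>A\<close> into it\<close>

context shuffle_algebra
begin

sublocale SR: comm_diff_RB_algebra k S lam \<delta> P
  by (rule diff_RB_S)

abbreviation "I \<equiv> ID_ideal k A lam d"

lemma J_E: "Sh_J k A lam d x = P (\<delta> x)" "Sh_E k A lam d x = x \<ominus>\<^bsub>S\<^esub> P (\<delta> x)"
  by (simp_all add: Sh_J_def Sh_E_def)

lemma ID_ideal_eq: "I = gen_diff_RB_ideal S \<delta> P
    {P (\<delta> ((x \<ominus>\<^bsub>S\<^esub> P (\<delta> x)) \<otimes>\<^bsub>S\<^esub> P (\<delta> y))) \<ominus>\<^bsub>S\<^esub> (x \<ominus>\<^bsub>S\<^esub> P (\<delta> x)) \<otimes>\<^bsub>S\<^esub> P (\<delta> y) | x y.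
      x \<in> carrier S \<and> y \<in> carrier S}" (is "_ = gen_diff_RB_ideal _ _ _ ?G")
  by (simp add: ID_ideal_def Let_def J_E)

lemma ID_relation:
  "\<lbrakk>x \<in> carrier S; y \<in> carrier S\<rbrakk> \<Longrightarrow>
    P (\<delta> ((x \<ominus>\<^bsub>S\<^esub> P (\<delta> x)) \<otimes>\<^bsub>S\<^esub> P (\<delta> y))) \<ominus>\<^bsub>S\<^esub> (x \<ominus>\<^bsub>S\<^esub> P (\<delta> x)) \<otimes>\<^bsub>S\<^esub> P (\<delta> y) \<in> I"
  unfolding ID_ideal_eq gen_diff_RB_ideal_def by blast

lemma diff_RB_ideal_ID: "diff_RB_ideal S \<delta> P I"
  unfolding ID_ideal_eq
proof (rule SR.diff_RB_ideal_gen, safe)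
  fix x y assume xy: "x \<in> carrier S" "y \<in> carrier S"
  then show "P (\<delta> ((x \<ominus>\<^bsub>S\<^esub> P (\<delta> x)) \<otimes>\<^bsub>S\<^esub> P (\<delta> y))) \<ominus>\<^bsub>S\<^esub> (x \<ominus>\<^bsub>S\<^esub> P (\<delta> x)) \<otimes>\<^bsub>S\<^esub> P (\<delta> y) \<in> carrier S"
    by (intro SA.minus_closed SR.P_closed SR.D_closed SA.m_closed)
qed

sublocale I: diff_RB_quotient k S lam \<delta> P I
  by (intro diff_RB_quotient.intro diff_RB_S diff_RB_quotient_axioms.intro diff_RB_ideal_ID)

lemma ID_eqs:
  "ID k A lam d = quotient S I" "ID_delta k A lam d = coset_map S I \<delta>" "ID_Pi k A lam d = coset_map S I P"
  "ID_incl k A lam d a = I +>\<^bsub>S\<^esub> e [a]"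
  by (simp_all add: ID_def ID_delta_def ID_Pi_def ID_incl_def)

text \<open>Stated over \<open>V\<close>, so that the projection can be combined with
  \<open>e_linear\<close> and \<open>Sh_linear_unique\<close>.\<close>

lemma coset_linear: "linear_map k V (quotient S I) (\<lambda>x. I +>\<^bsub>S\<^esub> x)"
  using I.Q.linear_map_coset by (simp only: linear_map_S)

lemma ID_integro_differential:
  "comm_integro_differential_algebra k (ID k A lam d) lam (ID_delta k A lam d) (ID_Pi k A lam d)"
  unfolding ID_eqs by (rule I.comm_integro_differential_algebra_quotient) (rule ID_relation)

lemma ID_incl_hom: "ID_incl k A lam d \<in> differential_hom k A d (ID k A lam d) (ID_delta k A lam d)"
proof -
  have e: "e [a] \<in> carrier S" if "a \<in> carrier A" for a using that by simp
  have "ID_incl k A lam d \<in> ring_hom A (quotient S I)"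
  proof (rule ring_hom_memI)
    fix a b assume ab: "a \<in> carrier A" "b \<in> carrier A"
    show "ID_incl k A lam d a \<in> carrier (quotient S I)"
      using e[OF ab(1)] unfolding ID_eqs I.Q.carrier_quotient by (rule imageI)
    show "ID_incl k A lam d (a \<otimes>\<^bsub>A\<^esub> b) = ID_incl k A lam d a \<otimes>\<^bsub>quotient S I\<^esub> ID_incl k A lam d b"
      unfolding ID_eqs I.mult_coset[OF e[OF ab(1)] e[OF ab(2)]] using ab by (simp add: mult_letter_e)
    show "ID_incl k A lam d (a \<oplus>\<^bsub>A\<^esub> b) = ID_incl k A lam d a \<oplus>\<^bsub>quotient S I\<^esub> ID_incl k A lam d b"
      unfolding ID_eqs I.Q.quotient_simps(1)[OF e[OF ab(1)] e[OF ab(2)]] using ab by (simp add: e_add)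
  next
    show "ID_incl k A lam d \<one>\<^bsub>A\<^esub> = \<one>\<^bsub>quotient S I\<^esub>"
      unfolding ID_eqs I.one_coset by simp
  qed
  moreover have "linear_map k A (quotient S I) (ID_incl k A lam d)"
    unfolding ID_eqs(4)[abs_def]
    using linear_map_comp[OF e_linear[of "[]" "[]"] coset_linear] by simp
  moreover have "ID_incl k A lam d (d a) = ID_delta k A lam d (ID_incl k A lam d a)" if "a \<in> carrier A" for a
    unfolding ID_eqs I.D'_coset[OF e[OF that]] using that by (simp add: \<delta>_letter)
  ultimately show ?thesis
    by (simp add: differential_hom_def ID_eqs(1))
qed

end

section \<open>The universal property\<close>

locale shuffle_extension = shuffle_algebra k A lam d + T: comm_integro_differential_algebra k R lam D Q
  for k :: "('k, 'x) ring_scheme" (structure) and A :: "('k, 'a, 'y) module_scheme" (structure)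
    and lam :: 'k and d :: "'a \<Rightarrow> 'a"
    and R :: "('k, 'r, 'z) module_scheme" (structure) and D Q :: "'r \<Rightarrow> 'r" +
  fixes f :: "'a \<Rightarrow> 'r"
  assumes f_hom: "f \<in> differential_hom k A d R D"
begin

lemma
  shows f_linear: "linear_map k A R f"
    and f_closed [simp]: "a \<in> carrier A \<Longrightarrow> f a \<in> carrier R"
    and f_mult: "\<lbrakk>a \<in> carrier A; b \<in> carrier A\<rbrakk> \<Longrightarrow> f (a \<otimes>\<^bsub>A\<^esub> b) = f a \<otimes>\<^bsub>R\<^esub> f b"
    and f_one: "f \<one>\<^bsub>A\<^esub> = \<one>\<^bsub>R\<^esub>"
    and f_d: "a \<in> carrier A \<Longrightarrow> f (d a) = D (f a)"
  using f_hom by (auto simp: differential_hom_def ring_hom_mult ring_hom_one intro: linear_map_closed)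

lemma Q_closed [simp]: "x \<in> carrier R \<Longrightarrow> Q x \<in> carrier R"
  by (rule linear_map_closed[OF T.P_linear])

lemma D_closed [simp]: "x \<in> carrier R \<Longrightarrow> D x \<in> carrier R"
  by (rule linear_map_closed[OF T.d_linear])

text \<open>The value at the empty word is a default that lets \<open>word_ext_closed\<close> hold
  for all words.\<close>

fun word_ext :: "'a list \<Rightarrow> 'r" where
  "word_ext [] = \<zero>\<^bsub>R\<^esub>"
| "word_ext [a] = f a"
| "word_ext (a # b # w) = f a \<otimes>\<^bsub>R\<^esub> Q (word_ext (b # w))"

lemma word_ext_Cons: "w \<noteq> [] \<Longrightarrow> word_ext (a # w) = f a \<otimes>\<^bsub>R\<^esub> Q (word_ext w)"
  by (cases w) simp_all

lemma word_ext_closed [simp]: "w \<in> lists (carrier A) \<Longrightarrow> word_ext w \<in> carrier R"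
  by (induction w rule: word_ext.induct) auto

lemma mult_linear:
  assumes "r \<in> carrier R"
  shows "linear_map k R R (\<lambda>x. x \<otimes>\<^bsub>R\<^esub> r)" "linear_map k R R (\<lambda>x. r \<otimes>\<^bsub>R\<^esub> x)"
proof -
  show *: "linear_map k R R (\<lambda>x. x \<otimes>\<^bsub>R\<^esub> r)"
    by (rule linear_mapI) (use assms in \<open>auto simp: T.l_distr T.smult_assoc2\<close>)
  show "linear_map k R R (\<lambda>x. r \<otimes>\<^bsub>R\<^esub> x)"
    by (rule linear_map_cong[OF T.module *]) (use assms in \<open>simp add: T.m_comm\<close>)
qed

lemma multilinear_word_ext: "multilinear k A R word_ext"
  unfolding multilinear_def
proof (intro ballI)
  fix p q assume "p \<in> lists (carrier A)" and q: "q \<in> lists (carrier A)"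
  then show "linear_map k A R (\<lambda>a. word_ext (p @ a # q))"
  proof (induction p)
    case Nil
    show ?case
    proof (cases "q = []")
      case True
      then show ?thesis by (simp add: f_linear)
    next
      case False
      then show ?thesis
        using linear_map_comp[OF f_linear mult_linear(1)[of "Q (word_ext q)"]] q by (simp add: word_ext_Cons)
    qed
  next
    case (Cons c p)
    have "linear_map k A R (\<lambda>a. f c \<otimes>\<^bsub>R\<^esub> Q (word_ext (p @ a # q)))"
      using Cons q by (intro linear_map_comp[OF linear_map_comp[OF _ T.P_linear] mult_linear(2)]) auto
    then show ?case
      by (simp add: word_ext_Cons)
  qed
qed

section \<open>The extension of \<open>f\<close> to the shuffle algebra\<close>

definition "ext = lin_ext k A R word_ext"

lemma ext_linear: "linear_map k V R ext"
  unfolding ext_def by (rule linear_map_lin_ext[OF T.module multilinear_word_ext])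

lemma ext_e: "\<lbrakk>w \<in> lists (carrier A); w \<noteq> []\<rbrakk> \<Longrightarrow> ext (e w) = word_ext w"
  unfolding ext_def by (rule lin_ext_etensor[OF T.module multilinear_word_ext])

lemma ext_closed [simp]: "x \<in> carrier V \<Longrightarrow> ext x \<in> carrier R"
  by (rule linear_map_closed[OF ext_linear])

lemmas ext_add = linear_map_add[OF ext_linear]
lemmas ext_smult = linear_map_smult[OF ext_linear]
lemmas Q_add = linear_map_add[OF T.P_linear]
lemmas Q_smult = linear_map_smult[OF T.P_linear]
lemmas D_add = linear_map_add[OF T.d_linear]
lemmas D_smult = linear_map_smult[OF T.d_linear]

lemma ext_P:
  assumes "x \<in> carrier V"
  shows "ext (P x) = Q (ext x)"
  using assms
  by (induction rule: Sh_induct)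
    (simp_all add: P_e ext_e word_ext_Cons f_one P_add P_smult ext_add ext_smult Q_add Q_smult)

lemma ext_letter: "a \<in> carrier A \<Longrightarrow> ext (e [a]) = f a"
  by (simp add: ext_e)

lemma T_smult_right:
  "\<lbrakk>c \<in> carrier k; x \<in> carrier R; y \<in> carrier R\<rbrakk> \<Longrightarrow> x \<otimes>\<^bsub>R\<^esub> (c \<odot>\<^bsub>R\<^esub> y) = c \<odot>\<^bsub>R\<^esub> (x \<otimes>\<^bsub>R\<^esub> y)"
  by (rule linear_map_smult[OF mult_linear(2)])

text \<open>The one-letter case of multiplicativity comes first because each step of the shuffle
  recursion splits off the letter \<open>a b\<close>.\<close>

lemma ext_letter_mult:
  assumes a: "a \<in> carrier A" and x: "x \<in> carrier V"
  shows "ext (e [a] \<otimes>\<^bsub>S\<^esub> x) = f a \<otimes>\<^bsub>R\<^esub> ext x"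
  using x
proof (induction rule: Sh_induct)
  case (etensor w)
  obtain b v where w: "w = b # v" using etensor(2) by (cases w) auto
  with etensor(1) have b: "b \<in> carrier A" "v \<in> lists (carrier A)" by auto
  show ?case
  proof (cases "v = []")
    case True
    then show ?thesis using a b w by (simp add: mult_letter_e ext_e f_mult)
  next
    case False
    then show ?thesis using a b w by (simp add: mult_letter_e ext_e f_mult word_ext_Cons T.m_assoc)
  qed
qed (use a in \<open>simp_all add: mult_bilinear ext_add ext_smult T.r_distr T_smult_right\<close>)

text \<open>By induction the three recursive terms are sent to the three summands in the Rota-Baxter
  identity of \<open>R\<close> for \<open>word_ext u\<close> and \<open>word_ext v\<close>; applying
  \<open>Q\<close> to their sum then yields a product.\<close>

lemma ext_shuffle:
  assumes "u \<in> lists (carrier A)" "v \<in> lists (carrier A)" "u \<noteq> []" "v \<noteq> []"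
  shows "ext (shuffle k A lam u v) = word_ext u \<otimes>\<^bsub>R\<^esub> word_ext v"
  using assms
proof (induction rule: shuffle_induct)
  case (letter_left a b v)
  then show ?case
    using ext_letter_mult[of a "e (b # v)"] by (simp add: mult_letter_e ext_e)
next
  case (letter_right a b u)
  then show ?case
    using ext_letter_mult[of b "e (a # u)"] by (simp add: mult_letter_e ext_e shuffle_letter_right m_comm T.m_comm)
next
  case (Cons a b u v)
  define X where "X = shuffle k A lam u (\<one>\<^bsub>A\<^esub> # v) \<oplus>\<^bsub>V\<^esub> shuffle k A lam (\<one>\<^bsub>A\<^esub> # u) v \<oplus>\<^bsub>V\<^esub> lam \<odot>\<^bsub>V\<^esub> shuffle k A lam u v"
  have X: "X \<in> carrier V"
    unfolding X_def using Cons.hyps by (intro V.M.a_closed V.smult_closed shuffle_closed weight_closed) auto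
  have "shuffle k A lam (a # u) (b # v) = e [a \<otimes>\<^bsub>A\<^esub> b] \<otimes>\<^bsub>S\<^esub> P X"
    using Cons.hyps X by (simp add: shuffle_Cons X_def[symmetric] mult_letter_prefix Sh_P_def del: shuffle.simps)
  then have "ext (shuffle k A lam (a # u) (b # v)) = f a \<otimes>\<^bsub>R\<^esub> f b \<otimes>\<^bsub>R\<^esub> Q (ext X)"
    using Cons.hyps X by (simp only: ext_letter_mult m_closed P_closed f_mult ext_P)
  also have "ext X = word_ext u \<otimes>\<^bsub>R\<^esub> Q (word_ext v) \<oplus>\<^bsub>R\<^esub> Q (word_ext u) \<otimes>\<^bsub>R\<^esub> word_ext v
      \<oplus>\<^bsub>R\<^esub> lam \<odot>\<^bsub>R\<^esub> (word_ext u \<otimes>\<^bsub>R\<^esub> word_ext v)"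
    using Cons by (simp add: X_def ext_add ext_smult weight_closed word_ext_Cons f_one del: shuffle.simps)
  also have "Q \<dots> = Q (word_ext u) \<otimes>\<^bsub>R\<^esub> Q (word_ext v)"
    using Cons.hyps by (simp add: T.Rota_Baxter)
  finally show ?case
    using Cons.hyps by (simp add: word_ext_Cons T.m_ac)
qed

lemma ext_mult:
  assumes x: "x \<in> carrier V" and y: "y \<in> carrier V"
  shows "ext (x \<otimes>\<^bsub>S\<^esub> y) = ext x \<otimes>\<^bsub>R\<^esub> ext y"
  using x
proof (induction rule: Sh_induct)
  case (etensor u)
  show ?case
    using y
  proof (induction rule: Sh_induct)
    case (etensor v)
    with \<open>u \<in> lists (carrier A)\<close> \<open>u \<noteq> []\<close> show ?case
      by (simp add: mult_e_e ext_shuffle ext_e)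
  qed (use etensor in \<open>simp_all add: mult_bilinear ext_add ext_smult etensor_closed T.r_distr T_smult_right\<close>)
qed (use y in \<open>simp_all add: mult_bilinear ext_add ext_smult T.l_distr T.smult_assoc2\<close>)

lemma ext_one: "ext (e [\<one>\<^bsub>A\<^esub>]) = \<one>\<^bsub>R\<^esub>"
  by (simp add: ext_letter f_one)

text \<open>For a longer word, \<open>ext\<close> turns \<open>\<delta>_letter_P\<close> into the
  Leibniz rule of \<open>R\<close> for \<open>f a\<close> times an image of \<open>Q\<close>, where
  \<open>D\<close> cancels \<open>Q\<close>.\<close>

lemma ext_\<delta>:
  assumes x: "x \<in> carrier V"
  shows "ext (\<delta> x) = D (ext x)"
  using x
proof (induction rule: Sh_induct)
  case (etensor w)
  obtain a v where w: "w = a # v" using etensor(2) by (cases w) auto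
  with etensor(1) have a: "a \<in> carrier A" "v \<in> lists (carrier A)" by auto
  show ?case
  proof (cases "v = []")
    case True
    then show ?thesis using a w by (simp add: \<delta>_letter ext_letter f_d)
  next
    case False
    have v: "e v \<in> carrier V" using a False by (simp add: etensor_closed)
    have "ext (\<delta> (e w)) = f (d a) \<otimes>\<^bsub>R\<^esub> Q (ext (e v)) \<oplus>\<^bsub>R\<^esub> f a \<otimes>\<^bsub>R\<^esub> ext (e v)
        \<oplus>\<^bsub>R\<^esub> lam \<odot>\<^bsub>R\<^esub> (f (d a) \<otimes>\<^bsub>R\<^esub> ext (e v))"
      using a v w False
      by (simp add: e_Cons \<delta>_letter_P ext_add ext_smult weight_closed ext_letter_mult ext_P)
    also have "\<dots> = D (f a \<otimes>\<^bsub>R\<^esub> Q (ext (e v)))"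
      using a v by (simp add: T.d_mult T.D_P f_d)
    also have "f a \<otimes>\<^bsub>R\<^esub> Q (ext (e v)) = ext (e w)"
      using a w v False by (simp add: e_Cons ext_letter_mult ext_P)
    finally show ?thesis .
  qed
qed (simp_all add: \<delta>_add \<delta>_smult ext_add ext_smult D_add D_smult)

lemma ext_minus: "\<lbrakk>x \<in> carrier S; y \<in> carrier S\<rbrakk> \<Longrightarrow> ext (x \<ominus>\<^bsub>S\<^esub> y) = ext x \<ominus>\<^bsub>R\<^esub> ext y"
  by (rule linear_map_minus[OF SA.module T.module, of ext]) (simp_all add: ext_linear)

text \<open>The kernel of \<open>ext\<close> is a differential Rota-Baxter ideal and contains the
  generators of \<open>I\<close>, by \<open>P_D_eval_mult\<close> in \<open>R\<close>. Minimality of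
  \<open>I\<close> does the rest.\<close>

lemma ext_ID_ideal:
  assumes "x \<in> I"
  shows "ext x = \<zero>\<^bsub>R\<^esub>"
proof -
  define K where "K = {x \<in> carrier S. ext x = \<zero>\<^bsub>R\<^esub>}"
  have "ideal K S"
  proof (rule idealI)
    show "ring S" by (rule SA.ring_axioms)
    have "submodule K k S"
      unfolding K_def
      by (rule submodule_equalizer[OF SA.module T.module _ linear_map_const_zero[OF T.module]])
        (simp add: ext_linear)
    then show "subgroup K (add_monoid S)"
      by (rule submodule.axioms(1))
  qed (auto simp: K_def ext_mult)
  moreover have "\<delta> ` K \<subseteq> K" "P ` K \<subseteq> K"
    by (auto simp: K_def ext_\<delta> ext_P linear_map_zero[OF T.module T.module T.d_linear]
        linear_map_zero[OF T.module T.module T.P_linear])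
  ultimately have "diff_RB_ideal S \<delta> P K"
    by (simp add: diff_RB_ideal_def)
  moreover have "P (\<delta> ((x \<ominus>\<^bsub>S\<^esub> P (\<delta> x)) \<otimes>\<^bsub>S\<^esub> P (\<delta> y))) \<ominus>\<^bsub>S\<^esub> (x \<ominus>\<^bsub>S\<^esub> P (\<delta> x)) \<otimes>\<^bsub>S\<^esub> P (\<delta> y) \<in> K"
    if x: "x \<in> carrier S" and y: "y \<in> carrier S" for x y
  proof -
    let ?p = "x \<ominus>\<^bsub>S\<^esub> P (\<delta> x)" and ?v = "P (\<delta> y)"
    have cl: "?p \<in> carrier S" "?v \<in> carrier S" "?p \<otimes>\<^bsub>S\<^esub> ?v \<in> carrier S" "P (\<delta> (?p \<otimes>\<^bsub>S\<^esub> ?v)) \<in> carrier S"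
      using x y by (auto intro!: SA.minus_closed SR.P_closed SR.D_closed SA.m_closed simp del: Sh_simps)
    have p: "ext ?p = ext x \<ominus>\<^bsub>R\<^esub> Q (D (ext x))"
      using x by (subst ext_minus) (simp_all add: ext_P ext_\<delta>)
    have v: "ext ?v = Q (D (ext y))"
      using y by (simp add: ext_P ext_\<delta>)
    have pv: "ext (?p \<otimes>\<^bsub>S\<^esub> ?v) = ext ?p \<otimes>\<^bsub>R\<^esub> ext ?v"
      using cl by (intro ext_mult) simp_all
    have "ext (P (\<delta> (?p \<otimes>\<^bsub>S\<^esub> ?v))) = Q (D (ext (?p \<otimes>\<^bsub>S\<^esub> ?v)))"
      using cl(3) by (simp add: ext_P ext_\<delta>)
    also have "\<dots> = ext (?p \<otimes>\<^bsub>S\<^esub> ?v)"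
      unfolding pv p v using x y by (intro T.P_D_eval_mult) simp_all
    finally have "ext (P (\<delta> (?p \<otimes>\<^bsub>S\<^esub> ?v)) \<ominus>\<^bsub>S\<^esub> ?p \<otimes>\<^bsub>S\<^esub> ?v) = \<zero>\<^bsub>R\<^esub>"
      unfolding ext_minus[OF cl(4,3)] using cl(3) by (simp add: a_minus_def T.M.r_neg)
    with SA.minus_closed[OF cl(4,3)] show ?thesis
      by (simp add: K_def)
  qed
  ultimately have "I \<subseteq> K"
    unfolding ID_ideal_eq gen_diff_RB_ideal_def by blast
  with assms show ?thesis
    by (auto simp: K_def)
qed

section \<open>Existence and uniqueness on the quotient\<close>

lemma ID_extension:
  "\<exists>g. g \<in> extensional (carrier (ID k A lam d))
    \<and> g \<in> integro_differential_hom k (ID k A lam d) (ID_delta k A lam d) (ID_Pi k A lam d) R D Q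
    \<and> (\<forall>a\<in>carrier A. g (ID_incl k A lam d a) = f a)"
proof -
  have ext_S: "linear_map k S R ext" by (simp add: ext_linear)
  obtain h where h: "linear_map k (quotient S I) R h" and h_coset: "\<And>x. x \<in> carrier S \<Longrightarrow> h (I +>\<^bsub>S\<^esub> x) = ext x"
    by (rule I.Q.factor_linear_map[OF T.module ext_S ext_ID_ideal]) (assumption, rule that)
  \<comment> \<open>Among the functions that agree with \<open>h\<close> on the carrier, this is the
    extensional one.\<close>
  define g where "g = restrict h (carrier (quotient S I))"
  have g: "g (I +>\<^bsub>S\<^esub> x) = ext x" if "x \<in> carrier S" for x
    using that by (simp add: g_def I.Q.carrier_quotient h_coset)
  have lin: "linear_map k (quotient S I) R g"
    by (rule linear_map_cong[OF I.Q.module_quotient h]) (simp add: g_def)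
  have "g \<in> ring_hom (quotient S I) R"
  proof (rule ring_hom_memI)
    fix X Y assume "X \<in> carrier (quotient S I)" "Y \<in> carrier (quotient S I)"
    then obtain x y where "x \<in> carrier S" "X = I +>\<^bsub>S\<^esub> x" "y \<in> carrier S" "Y = I +>\<^bsub>S\<^esub> y"
      unfolding I.Q.carrier_quotient by blast
    then show "g (X \<otimes>\<^bsub>quotient S I\<^esub> Y) = g X \<otimes>\<^bsub>R\<^esub> g Y"
      using g[of "x \<otimes>\<^bsub>S\<^esub> y"] by (simp add: I.mult_coset g ext_mult)
  next
    show "g \<one>\<^bsub>quotient S I\<^esub> = \<one>\<^bsub>R\<^esub>"
      unfolding I.one_coset using g[of "\<one>\<^bsub>S\<^esub>"] by (simp add: ext_one)
  qed (use lin in \<open>simp_all add: linear_map_closed linear_map_add\<close>)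
  moreover have "g (coset_map S I \<delta> X) = D (g X) \<and> g (coset_map S I P X) = Q (g X)"
    if "X \<in> carrier (quotient S I)" for X
  proof -
    obtain x where x: "x \<in> carrier S" "X = I +>\<^bsub>S\<^esub> x"
      using \<open>X \<in> carrier (quotient S I)\<close> unfolding I.Q.carrier_quotient by blast
    then show ?thesis
      by (simp add: I.D'_coset I.P'_coset g ext_\<delta> ext_P)
  qed
  moreover have "g (I +>\<^bsub>S\<^esub> e [a]) = f a" if "a \<in> carrier A" for a
    using that by (simp add: g ext_letter)
  moreover have "g \<in> extensional (carrier (quotient S I))"
    by (simp add: g_def)
  ultimately show ?thesis
    using lin unfolding ID_eqs integro_differential_hom_def differential_hom_def by blast
qed

lemma ID_extension_unique:
  assumes g: "g \<in> extensional (carrier (ID k A lam d))"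
      "g \<in> integro_differential_hom k (ID k A lam d) (ID_delta k A lam d) (ID_Pi k A lam d) R D Q"
      "\<forall>a\<in>carrier A. g (ID_incl k A lam d a) = f a"
    and g': "g' \<in> extensional (carrier (ID k A lam d))"
      "g' \<in> integro_differential_hom k (ID k A lam d) (ID_delta k A lam d) (ID_Pi k A lam d) R D Q"
      "\<forall>a\<in>carrier A. g' (ID_incl k A lam d a) = f a"
  shows "g = g'"
proof -
  \<comment> \<open>Any candidate, composed with the projection, is linear on \<open>V\<close> with
    prescribed values on elementary tensors; two candidates are then compared by
    \<open>Sh_linear_unique\<close>.\<close>
  have hom_values: "h (I +>\<^bsub>S\<^esub> e w) = word_ext w" and lin: "linear_map k V R (\<lambda>x. h (I +>\<^bsub>S\<^esub> x))"
    if h: "h \<in> integro_differential_hom k (ID k A lam d) (ID_delta k A lam d) (ID_Pi k A lam d) R D Q"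
      and incl: "\<forall>a\<in>carrier A. h (ID_incl k A lam d a) = f a"
      and w: "w \<in> lists (carrier A)" "w \<noteq> []" for h w
  proof -
    have hom: "h \<in> ring_hom (quotient S I) R" and h_lin: "linear_map k (quotient S I) R h"
      and h_P: "\<And>X. X \<in> carrier (quotient S I) \<Longrightarrow> h (coset_map S I P X) = Q (h X)"
      using h unfolding integro_differential_hom_def differential_hom_def ID_eqs by blast+
    have h_f: "\<And>a. a \<in> carrier A \<Longrightarrow> h (I +>\<^bsub>S\<^esub> e [a]) = f a"
      using incl unfolding ID_eqs by blast
    show "linear_map k V R (\<lambda>x. h (I +>\<^bsub>S\<^esub> x))"
      by (rule linear_map_comp[OF coset_linear h_lin])
    have cl: "I +>\<^bsub>S\<^esub> x \<in> carrier (quotient S I)" if "x \<in> carrier S" for x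
      unfolding I.Q.carrier_quotient using that by (rule imageI)
    show "h (I +>\<^bsub>S\<^esub> e w) = word_ext w"
      using w
    proof (induction w rule: list.induct)
      case (Cons a w)
      show ?case
      proof (cases "w = []")
        case True
        then show ?thesis using Cons.prems by (simp add: h_f)
      next
        case False
        have a: "e [a] \<in> carrier S" and w: "e w \<in> carrier S" and Pw: "P (e w) \<in> carrier S"
          using Cons.prems False by (auto intro!: etensor_closed P_closed)
        have "I +>\<^bsub>S\<^esub> e (a # w) = (I +>\<^bsub>S\<^esub> e [a]) \<otimes>\<^bsub>quotient S I\<^esub> coset_map S I P (I +>\<^bsub>S\<^esub> e w)"
          unfolding I.P'_coset[OF w] I.mult_coset[OF a Pw] using Cons.prems False by (simp add: e_Cons)
        then have "h (I +>\<^bsub>S\<^esub> e (a # w)) = h (I +>\<^bsub>S\<^esub> e [a]) \<otimes>\<^bsub>R\<^esub> Q (h (I +>\<^bsub>S\<^esub> e w))"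
          using ring_hom_mult[OF hom cl[OF a] cl[OF Pw]] h_P[OF cl[OF w]] by (simp add: I.P'_coset[OF w])
        then show ?thesis
          using Cons False by (simp add: h_f word_ext_Cons)
      qed
    qed simp
  qed
  \<comment> \<open>\<open>lin\<close> was proved together with \<open>hom_values\<close> and
    inherits premises on a word that its conclusion does not mention; the word \<open>[1]\<close>
    discharges them.\<close>
  have nonempty: "[\<one>\<^bsub>A\<^esub>] \<in> lists (carrier A)" "[\<one>\<^bsub>A\<^esub>] \<noteq> []" by simp_all
  show ?thesis
  proof (rule extensionalityI[OF g(1) g'(1)])
    fix X assume "X \<in> carrier (ID k A lam d)"
    then obtain x where x: "x \<in> carrier V" "X = I +>\<^bsub>S\<^esub> x"
      unfolding ID_eqs I.Q.carrier_quotient by auto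
    have "g (I +>\<^bsub>S\<^esub> x) = g' (I +>\<^bsub>S\<^esub> x)"
    proof (rule Sh_linear_unique[OF T.module lin[OF g(2,3) nonempty] lin[OF g'(2,3) nonempty] _ x(1)])
      fix w assume w: "w \<in> lists (carrier A)" "w \<noteq> []"
      show "g (I +>\<^bsub>S\<^esub> e w) = g' (I +>\<^bsub>S\<^esub> e w)"
        by (rule trans[OF hom_values[OF g(2,3) w] hom_values[OF g'(2,3) w, symmetric]])
    qed
    with x show "g X = g' X" by simp
  qed
qed

end

text \<open>Functions are total, so a homomorphism is determined only on the carrier of
  \<open>ID\<close>. Requiring \<open>g\<close> to be extensional fixes its other values and makes
  uniqueness an equality of functions.\<close>

theorem theorem3p6:
  fixes k :: "('k, 'x) ring_scheme" and A :: "('k, 'a, 'y) module_scheme"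
    and lam :: 'k and d :: "'a \<Rightarrow> 'a"
  assumes "cring k" and "lam \<in> carrier k" and "comm_differential_algebra k A lam d"
  shows "comm_integro_differential_algebra k (ID k A lam d) lam (ID_delta k A lam d) (ID_Pi k A lam d)
    \<and> ID_incl k A lam d \<in> differential_hom k A d (ID k A lam d) (ID_delta k A lam d)
    \<and> (\<forall>(R :: ('k, 'r, 'z) module_scheme) D Q f.
         comm_integro_differential_algebra k R lam D Q
         \<and> f \<in> differential_hom k A d R D
         \<longrightarrow> (\<exists>!g. g \<in> extensional (carrier (ID k A lam d))
               \<and> g \<in> integro_differential_hom k (ID k A lam d) (ID_delta k A lam d) (ID_Pi k A lam d) R D Q
               \<and> (\<forall>a\<in>carrier A. g (ID_incl k A lam d a) = f a)))"
proof -
  interpret shuffle_algebra k A lam d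
    by (rule shuffle_algebra.intro) (rule assms(3))
  show ?thesis
  proof (intro conjI allI impI ID_integro_differential ID_incl_hom)
    fix R :: "('k, 'r, 'z) module_scheme" and D Q f
    assume "comm_integro_differential_algebra k R lam D Q \<and> f \<in> differential_hom k A d R D"
    then interpret shuffle_extension k A lam d R D Q f
      by (intro shuffle_extension.intro shuffle_algebra_axioms shuffle_extension_axioms.intro) simp_all
    show "\<exists>!g. g \<in> extensional (carrier (ID k A lam d))
               \<and> g \<in> integro_differential_hom k (ID k A lam d) (ID_delta k A lam d) (ID_Pi k A lam d) R D Q
               \<and> (\<forall>a\<in>carrier A. g (ID_incl k A lam d a) = f a)"
      using ID_extension ID_extension_unique by (intro ex_ex1I) blast+
  qed
qed

end
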